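(* Let $J:(0,1]\to(0,\infty)$ be measurable with $\inf_{t\in(0,1]}J(t)/t>0$, let $j\in\mathbb N$, and let $\|\cdot\|_{X(0,1)}$, $\|\cdot\|_{Y(0,1)}$ be rearrangement-invariant norms. Consider (i) $H^j_J:X(0,1)\rightarrow\rightarrow Y(0,1)$; (ii) $\lim_{a\to0_+}\sup_{\|f\|_{X(0,1)}\le1}\|H^j_J(\chi_{(0,a)}f)\|_{Y(0,1)}=0$. If $X(0,1)=L^1(0,1)$, $Y(0,1)=L^\infty(0,1)$, $j=1$ and $\lim_{a\to0_+}\operatorname{ess\,sup}_{t\in(0,a)}\frac1{J(t)}=0$, then (ii) holds but (i) does not. In all other cases, (i) holds if and only if (ii) holds.
   Context: Rearrangement-invariant norms: $f^*(t)=\inf\{\lambda\ge0:\lambda_1(\{|f|>\lambda\})\le t\}$. A rearrangement-invariant (r.i.) norm on $(0,1)$ is a functional $\|\cdot\|_{X(0,1)}$ on measurable functions with values in $[0,\infty]$ satisfying: for $f,g\ge0$, $a\ge0$, $\|f\|=0$ iff $f=0$ a.e., $\|af\|=a\|f\|$, $\|f+g\|\le\|f\|+\|g\|$; $f\le g$ a.e. $\Rightarrow\|f\|\le\|g\|$; $0\le f_k\uparrow f$ a.e. $\Rightarrow\|f_k\|\uparrow\|f\|$; $\|1\|<\infty$; $\int_0^1f\le C\|f\|$; equimeasurable functions have equal norm. $X(0,1)=L^1(0,1)$ means equality as sets (equivalently, equivalent norms). $T:X(0,1)\rightarrow\rightarrow Y(0,1)$ means $T$ maps $X(0,1)$ into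 $Y(0,1)$ and maps bounded subsets into relatively compact subsets of $Y(0,1)$. Operator: $H^j_Jf(t)=\frac{1}{(j-1)!}\int_t^1\frac{|f(s)|}{J(s)}\big(\int_t^s\frac{dr}{J(r)}\big)^{j-1}ds$, $t\in(0,1)$. *)

theory Defs
  imports "HOL-Analysis.Analysis" "HOL-Probability.Essential_Supremum"
begin

abbreviation I01 :: "real measure" where
  "I01 \<equiv> lebesgue_on {0<..<1}"

definition distrib_fun :: "(real \<Rightarrow> real) \<Rightarrow> real \<Rightarrow> ennreal" where
  "distrib_fun f y = emeasure I01 {t \<in> {0<..<1}. \<bar>f t\<bar> > y}"

definition equimeasurable :: "(real \<Rightarrow> real) \<Rightarrow> (real \<Rightarrow> real) \<Rightarrow> bool" where
  "equimeasurable f g \<longleftrightarrow> (\<forall>y. distrib_fun f y = distrib_fun g y)"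

text \<open>A rearrangement-invariant norm on (0,1), given by its values on nonnegative
  measurable functions (values in [0,\<infinity>]).\<close>
definition nonneg_meas :: "(real \<Rightarrow> real) \<Rightarrow> bool" where
  "nonneg_meas f \<longleftrightarrow> f \<in> borel_measurable I01 \<and> (\<forall>t. 0 \<le> f t)"

definition ri_norm :: "((real \<Rightarrow> real) \<Rightarrow> ennreal) \<Rightarrow> bool" where
  "ri_norm N \<longleftrightarrow>
     (\<forall>f. nonneg_meas f \<longrightarrow> (N f = 0 \<longleftrightarrow> (AE t in I01. f t = 0))) \<and>
     (\<forall>f a. nonneg_meas f \<and> 0 \<le> a \<longrightarrow> N (\<lambda>t. a * f t) = ennreal a * N f) \<and>
     (\<forall>f g. nonneg_meas f \<and> nonneg_meas g \<longrightarrow> N (\<lambda>t. f t + g t) \<le> N f + N g) \<and>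
     (\<forall>f g. nonneg_meas f \<and> nonneg_meas g \<and> (AE t in I01. f t \<le> g t) \<longrightarrow> N f \<le> N g) \<and>
     (\<forall>fs f. (\<forall>k. nonneg_meas (fs k)) \<and> nonneg_meas f \<and>
         (AE t in I01. incseq (\<lambda>k. fs k t) \<and> (\<lambda>k. fs k t) \<longlonglongrightarrow> f t)
         \<longrightarrow> (\<lambda>k. N (fs k)) \<longlonglongrightarrow> N f) \<and>
     N (\<lambda>_. 1) < \<infinity> \<and>
     (\<exists>C. \<forall>f. nonneg_meas f \<longrightarrow> (\<integral>\<^sup>+ t. ennreal (f t) \<partial>I01) \<le> ennreal C * N f) \<and>
     (\<forall>f g. nonneg_meas f \<and> nonneg_meas g \<and> equimeasurable f g \<longrightarrow> N f = N g)"

definition rinorm :: "((real \<Rightarrow> real) \<Rightarrow> ennreal) \<Rightarrow> (real \<Rightarrow> real) \<Rightarrow> ennreal" where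
  "rinorm N f = N (\<lambda>t. \<bar>f t\<bar>)"

definition ri_space :: "((real \<Rightarrow> real) \<Rightarrow> ennreal) \<Rightarrow> (real \<Rightarrow> real) set" where
  "ri_space N = {f. f \<in> borel_measurable I01 \<and> rinorm N f < \<infinity>}"

definition L1_space :: "(real \<Rightarrow> real) set" where
  "L1_space = {f. f \<in> borel_measurable I01 \<and> integrable I01 f}"

definition Linf_space :: "(real \<Rightarrow> real) set" where
  "Linf_space = {f. f \<in> borel_measurable I01 \<and> (\<exists>C. AE t in I01. \<bar>f t\<bar> \<le> C)}"

definition ri_norm_ext :: "((real \<Rightarrow> real) \<Rightarrow> ennreal) \<Rightarrow> (real \<Rightarrow> ennreal) \<Rightarrow> ennreal" where
  "ri_norm_ext N g = (if AE t in I01. g t \<noteq> \<infinity> then N (\<lambda>t. enn2real (g t)) else \<infinity>)"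

definition Hop :: "nat \<Rightarrow> (real \<Rightarrow> real) \<Rightarrow> (real \<Rightarrow> real) \<Rightarrow> real \<Rightarrow> ennreal" where
  "Hop j J f t =
     (\<integral>\<^sup>+ s. indicator {t..1} s * ennreal (\<bar>f s\<bar> / J s) *
         (\<integral>\<^sup>+ r. indicator {t..s} r * ennreal (1 / J r) \<partial>lborel) ^ (j - 1) \<partial>lborel)
     / ennreal (fact (j - 1))"

text \<open>T maps X into Y and bounded subsets of X into relatively compact subsets of Y
  (sequential formulation: every bounded sequence has an image subsequence converging in Y).\<close>
definition compact_into ::
  "((real \<Rightarrow> real) \<Rightarrow> real \<Rightarrow> ennreal) \<Rightarrow> ((real \<Rightarrow> real) \<Rightarrow> ennreal) \<Rightarrow> ((real \<Rightarrow> real) \<Rightarrow> ennreal) \<Rightarrow> bool"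
  where
  "compact_into T NX NY \<longleftrightarrow>
     (\<forall>f \<in> ri_space NX. (AE t in I01. T f t \<noteq> \<infinity>) \<and> (\<lambda>t. enn2real (T f t)) \<in> ri_space NY) \<and>
     (\<forall>fs::nat \<Rightarrow> real \<Rightarrow> real. (\<forall>n. fs n \<in> ri_space NX) \<and> (\<exists>C::real. \<forall>n. rinorm NX (fs n) \<le> ennreal C) \<longrightarrow>
        (\<exists>(r::nat \<Rightarrow> nat) g. strict_mono r \<and> g \<in> ri_space NY \<and>
           (\<lambda>n::nat. rinorm NY (\<lambda>t. enn2real (T (fs (r n)) t) - g t)) \<longlonglongrightarrow> 0))"

end

theory Submission
  imports Defs "HOL-Probability.Probability_Measure" "HOL-Complex_Analysis.Great_Picard"
begin

text \<open>
  Compactness forces the tails to vanish because the image of a function supported in \<open>(0,a)\<close> is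
  again supported in \<open>(0,a)\<close>, so that a limit in \<open>Y\<close> of images of functions with shrinking supports
  must be \<open>0\<close>.

  Conversely, the images of a bounded sequence are nonincreasing, so a diagonal subsequence converges
  almost everywhere. It is Cauchy in \<open>Y\<close>: the part coming from \<open>(0,b)\<close> is small by assumption; the
  part coming from \<open>[b,1)\<close> is, on \<open>(0,b)\<close>, a polynomial of degree at most \<open>j-1\<close> in the weight
  \<open>\<integral>\<^sub>t\<^sup>b 1/J\<close> with convergent coefficients, and the \<open>(j-1)\<close>-st power of that weight lies in \<open>Y\<close>
  (test the tail condition with a characteristic function). On \<open>[b,1)\<close> the images are equicontinuous
  if \<open>j \<ge> 2\<close>, or if \<open>X \<noteq> L\<^sup>1\<close> since then the unit ball of \<open>X\<close> is uniformly integrable; if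
  \<open>Y \<noteq> L\<^sup>\<infinity>\<close> the norm of \<open>Y\<close> satisfies dominated convergence. In the remaining case \<open>j = 1\<close>,
  \<open>X = L\<^sup>1\<close>, \<open>Y = L\<^sup>\<infinity>\<close>, vanishing tails mean exactly that \<open>1/J\<close> tends to \<open>0\<close> essentially, while
  concentrating unit masses destroys compactness.
\<close>

section \<open>Rearrangement-invariant norms\<close>


text \<open>The hypotheses on X and Y concern sets of functions, while every estimate needs a
  number. The bridge is the fundamental function, the norm of the characteristic function of (0,t):
  it is O(t) exactly when X is L^1, and bounded away from 0 exactly when Y is L^infinity. Uniform
  integrability for X other than L^1 rests on one inequality: averaging a function over a set of
  measure t does not increase its norm. It is obtained from rearrangement invariance alone, without
  associate norms: the cyclic shifts of a step function are equimeasurable and add up to a constant.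
  The polynomial on (0,b) comes from K(t,s) = K(t,b) + K(b,s) for t \<le> b \<le> s, where K(t,s) is
  the integral of 1/J over (t,s), and the binomial theorem. Only the top power of K(t,b) has to lie
  in Y, since a lower power is at most 1 plus the top one. To see that it does, the test function
  must have mass to the right of b, hence the two points b < a. Completeness of Y is not among the
  axioms; a Fatou property identifies the limit of a Cauchy sequence with its almost everywhere
  limit.\<close>

lemma space_I01 [simp]: "space I01 = {0<..<1}"
  by (simp add: space_restrict_space)

lemma sets_I01_iff: "A \<in> sets I01 \<longleftrightarrow> A \<in> sets lebesgue \<and> A \<subseteq> {0<..<1}"
  by (auto simp: sets_restrict_space_iff)

lemma emeasure_I01: "A \<subseteq> {0<..<1} \<Longrightarrow> emeasure I01 A = emeasure lebesgue A"
  by (simp add: emeasure_restrict_space)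

interpretation I01: prob_space I01
  by (rule prob_spaceI) (simp add: emeasure_I01)

lemma interval_in_sets_I01 [measurable]: "t \<le> 1 \<Longrightarrow> {0<..<t} \<in> sets I01"
  by (auto simp: sets_I01_iff)

lemma borel_set_I01: "A \<in> sets borel \<Longrightarrow> A \<inter> {0<..<1} \<in> sets I01"
  by (auto simp: sets_I01_iff)

lemma borel_measurable_I01: "f \<in> borel_measurable borel \<Longrightarrow> f \<in> borel_measurable I01"
  by (rule measurable_restrict_space1[OF measurable_completion]) simp

lemma emeasure_I01_interval:
  assumes "0 \<le> t" "t \<le> 1"
  shows "emeasure I01 {0<..<t} = ennreal t"
  using assms by (subst emeasure_I01) auto

lemma nonneg_measI: "f \<in> borel_measurable I01 \<Longrightarrow> (\<And>t. 0 \<le> f t) \<Longrightarrow> nonneg_meas f"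
  by (simp add: nonneg_meas_def)

lemma nonneg_meas_indicator: "A \<in> sets I01 \<Longrightarrow> nonneg_meas (indicator A)"
  by (intro nonneg_measI) auto

lemma distrib_indicator:
  assumes "A \<in> sets I01"
  shows "distrib_fun (indicator A) y = (if y < 0 then 1 else if y < 1 then emeasure I01 A else 0)"
proof -
  have *: "A \<subseteq> {0<..<1}" using assms by (auto simp: sets_I01_iff)
  have "{t \<in> {0<..<1}. \<bar>indicator A t :: real\<bar> > y} =
      (if y < 0 then {0<..<1} else if y < 1 then A else {})"
    using * by (auto simp: indicator_def split: if_splits)
  then show ?thesis
    using I01.emeasure_space_1 by (auto simp: distrib_fun_def)
qed

locale ri =
  fixes N :: "(real \<Rightarrow> real) \<Rightarrow> ennreal"
  assumes ri: "ri_norm N"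
begin

lemma zero_iff: "nonneg_meas f \<Longrightarrow> N f = 0 \<longleftrightarrow> (AE t in I01. f t = 0)"
  and scale: "nonneg_meas f \<Longrightarrow> 0 \<le> a \<Longrightarrow> N (\<lambda>t. a * f t) = ennreal a * N f"
  and subadd: "nonneg_meas f \<Longrightarrow> nonneg_meas g \<Longrightarrow> N (\<lambda>t. f t + g t) \<le> N f + N g"
  and mono: "nonneg_meas f \<Longrightarrow> nonneg_meas g \<Longrightarrow> AE t in I01. f t \<le> g t \<Longrightarrow> N f \<le> N g"
  and lim: "(\<And>k. nonneg_meas (fs k)) \<Longrightarrow> nonneg_meas f \<Longrightarrow>
         (AE t in I01. incseq (\<lambda>k. fs k t) \<and> (\<lambda>k. fs k t) \<longlonglongrightarrow> f t) \<Longrightarrow> (\<lambda>k. N (fs k)) \<longlonglongrightarrow> N f"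
  and one: "N (\<lambda>_. 1) < \<infinity>"
  and equi: "nonneg_meas f \<Longrightarrow> nonneg_meas g \<Longrightarrow> equimeasurable f g \<Longrightarrow> N f = N g"
  using ri unfolding ri_norm_def by blast+

lemma L1: obtains C where "0 < C" "\<And>f. nonneg_meas f \<Longrightarrow> (\<integral>\<^sup>+ t. ennreal (f t) \<partial>I01) \<le> ennreal C * N f"
proof -
  obtain C where C: "\<And>f. nonneg_meas f \<Longrightarrow> (\<integral>\<^sup>+ t. ennreal (f t) \<partial>I01) \<le> ennreal C * N f"
    using ri unfolding ri_norm_def by blast
  show thesis
  proof (rule that[of "max C 1"])
    fix f assume "nonneg_meas f"
    then have "(\<integral>\<^sup>+ t. ennreal (f t) \<partial>I01) \<le> ennreal C * N f" by (rule C)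
    also have "\<dots> \<le> ennreal (max C 1) * N f"
      by (intro mult_right_mono ennreal_leI) auto
    finally show "(\<integral>\<^sup>+ t. ennreal (f t) \<partial>I01) \<le> ennreal (max C 1) * N f" .
  qed simp
qed

lemma cong_AE: "nonneg_meas f \<Longrightarrow> nonneg_meas g \<Longrightarrow> AE t in I01. f t = g t \<Longrightarrow> N f = N g"
  by (rule antisym; rule mono) auto

lemma one_pos: "N (\<lambda>_. 1) \<noteq> 0"
proof -
  have "\<not> (AE t in I01. (1::real) = 0)"
    using I01.AE_False by auto
  then show ?thesis using zero_iff[of "\<lambda>_. 1"] by (simp add: nonneg_meas_def)
qed

text \<open>The infima over the tails of the sequence increase to the limit, so monotone convergence
  applies to them. This turns a Cauchy estimate between members of a sequence into an estimate
  against the pointwise limit.\<close>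

lemma fatou:
  assumes "\<And>m. nonneg_meas (h m)" "nonneg_meas g" "AE t in I01. (\<lambda>m. h m t) \<longlonglongrightarrow> g t"
    and le: "eventually (\<lambda>m. N (h m) \<le> e) sequentially"
  shows "N g \<le> e"
proof -
  define u where "u k t = (INF m. h (m + k) t)" for k t
  have hm: "h m \<in> borel_measurable I01" "0 \<le> h m t" for m t
    using assms(1) by (auto simp: nonneg_meas_def)
  have bdd: "bdd_below (range (\<lambda>m. h (m + k) t))" for k t
    by (rule bdd_belowI[of _ 0]) (auto simp: hm)
  have u0: "0 \<le> u k t" for k t
    unfolding u_def by (rule cINF_greatest) (auto simp: hm)
  have um: "u k \<in> borel_measurable I01" for k
    unfolding u_def by (rule borel_measurable_cINF_real) (auto simp: hm)
  have unm: "nonneg_meas (u k)" for k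
    by (simp add: nonneg_meas_def um u0)
  have inc: "incseq (\<lambda>k. u k t)" for t
  proof (rule incseq_SucI)
    fix k show "u k t \<le> u (Suc k) t"
      unfolding u_def
    proof (rule cINF_greatest)
      fix m show "(INF m. h (m + k) t) \<le> h (m + Suc k) t"
        using cINF_lower[OF bdd[of k t], of "Suc m"] by simp
    qed simp
  qed
  have conv: "(\<lambda>k. u k t) \<longlonglongrightarrow> g t" if ht: "(\<lambda>m. h m t) \<longlonglongrightarrow> g t" for t
  proof (rule LIMSEQ_I)
    fix r :: real assume "0 < r"
    then obtain M where M: "\<And>m. m \<ge> M \<Longrightarrow> norm (h m t - g t) < r / 2"
      using LIMSEQ_D[OF ht, of "r/2"] by auto
    have "norm (u k t - g t) < r" if "k \<ge> M" for k
    proof -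
      have "g t - r / 2 \<le> u k t"
        unfolding u_def by (rule cINF_greatest) (simp, smt (verit) M that trans_le_add2 real_norm_def)
      moreover have "u k t \<le> h k t"
        unfolding u_def using cINF_lower[OF bdd[of k t], of 0] by simp
      ultimately show ?thesis using M[OF that] \<open>0 < r\<close> unfolding real_norm_def by linarith
    qed
    then show "\<exists>no. \<forall>n\<ge>no. norm (u n t - g t) < r" by blast
  qed
  have "(\<lambda>k. N (u k)) \<longlonglongrightarrow> N g"
    using assms(3) by (intro lim unm assms) (auto elim!: eventually_mono intro: inc conv)
  moreover have "N (u k) \<le> N (h k)" for k
    by (intro mono unm assms AE_I2) (use cINF_lower[OF bdd, of 0] in \<open>auto simp: u_def\<close>)
  then have "eventually (\<lambda>k. N (u k) \<le> e) sequentially"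
    using le by (auto elim!: eventually_mono intro: order_trans)
  ultimately show ?thesis
    by (rule tendsto_upperbound) simp
qed

text \<open>Up to equimeasurability a characteristic function is determined by the measure of its
  set, so its norm is a value of the fundamental function.\<close>

lemma indicator_interval:
  assumes "A \<in> sets I01"
  shows "N (indicator A) = N (indicator {0<..<measure I01 A})"
proof -
  have m: "measure I01 A \<le> 1" by simp
  have "equimeasurable (indicator A) (indicator {0<..<measure I01 A})"
    unfolding equimeasurable_def
    using assms m by (simp add: distrib_indicator interval_in_sets_I01 emeasure_I01_interval flip: I01.emeasure_eq_measure)
  then show ?thesis
    using assms m by (intro equi nonneg_meas_indicator) auto
qed

lemma phi_mono:
  assumes "s \<le> t" "t \<le> 1"
  shows "N (indicator {0<..<s}) \<le> N (indicator {0<..<t})"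
  using assms by (intro mono nonneg_meas_indicator AE_I2) (auto simp: indicator_def)

lemma finite_sum:
  assumes "finite S" "\<And>i. i \<in> S \<Longrightarrow> nonneg_meas (f i)"
  shows "N (\<lambda>t. \<Sum>i\<in>S. f i t) \<le> (\<Sum>i\<in>S. N (f i))"
  using assms
proof (induction S rule: finite_induct)
  case empty
  then show ?case using zero_iff[of "\<lambda>_. 0"] by (simp add: nonneg_meas_def)
next
  case (insert i S)
  have "nonneg_meas (\<lambda>t. \<Sum>i\<in>S. f i t)"
    using insert.prems by (auto simp: nonneg_meas_def intro!: sum_nonneg borel_measurable_sum)
  then have "N (\<lambda>t. \<Sum>i\<in>insert i S. f i t) \<le> N (f i) + N (\<lambda>t. \<Sum>i\<in>S. f i t)"
    using insert subadd[of "f i" "\<lambda>t. \<Sum>i\<in>S. f i t"] by simp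
  also have "\<dots> \<le> N (f i) + (\<Sum>i\<in>S. N (f i))"
    using insert by (intro add_left_mono) auto
  finally show ?case using insert by simp
qed

lemma rinorm_triangle:
  assumes "f \<in> borel_measurable I01" "g \<in> borel_measurable I01"
  shows "rinorm N (\<lambda>t. f t + g t) \<le> rinorm N f + rinorm N g"
proof -
  have "rinorm N (\<lambda>t. f t + g t) \<le> N (\<lambda>t. \<bar>f t\<bar> + \<bar>g t\<bar>)"
    unfolding rinorm_def using assms by (intro mono) (auto simp: nonneg_meas_def)
  also have "\<dots> \<le> rinorm N f + rinorm N g"
    unfolding rinorm_def using assms by (intro subadd) (auto simp: nonneg_meas_def)
  finally show ?thesis .
qed

end

section \<open>Decreasing rearrangement and averaging\<close>


text \<open>The nonincreasing rearrangement. At \<open>x = 0\<close> the set of admissible levels is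
  empty if \<open>h\<close> is essentially unbounded, so the infimum is used for
  \<open>x > 0\<close> only.\<close>

definition rearr :: "(real \<Rightarrow> real) \<Rightarrow> real \<Rightarrow> real" where
  "rearr h x = (if 0 < x then Inf {y. 0 \<le> y \<and> distrib_fun h y \<le> ennreal x} else 0)"

lemma superlevel_sets:
  assumes "h \<in> borel_measurable I01"
  shows "{t \<in> {0<..<1}. \<bar>h t\<bar> > (y::real)} \<in> sets I01"
proof -
  have "{t \<in> space I01. \<bar>h t\<bar> > y} \<in> sets I01"
    using assms by measurable
  then show ?thesis by simp
qed

lemma distrib_fun_antimono:
  assumes "h \<in> borel_measurable I01" "y \<le> z"
  shows "distrib_fun h z \<le> distrib_fun h y"
  unfolding distrib_fun_def
  by (rule emeasure_mono) (use assms superlevel_sets in auto)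

lemma distrib_fun_le_1: "h \<in> borel_measurable I01 \<Longrightarrow> distrib_fun h y \<le> 1"
  unfolding distrib_fun_def by (rule I01.emeasure_le_1)

text \<open>The superlevel sets at integer levels decrease to the empty set. Hence the infimum in
  \<open>rearr\<close> is taken over a nonempty set.\<close>

lemma distrib_fun_small:
  assumes h: "h \<in> borel_measurable I01" and "0 < x"
  shows "\<exists>y\<ge>0. distrib_fun h y \<le> ennreal x"
proof -
  let ?A = "\<lambda>n::nat. {t \<in> {0<..<1}. \<bar>h t\<bar> > real n}"
  have "(\<lambda>n. emeasure I01 (?A n)) \<longlonglongrightarrow> emeasure I01 (\<Inter>n. ?A n)"
    by (rule Lim_emeasure_decseq) (use superlevel_sets[OF h] in \<open>auto simp: decseq_def\<close>)
  moreover have "(\<Inter>n. ?A n) = {}"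
    by (auto simp: not_less) (meson less_imp_le reals_Archimedean2 not_less_iff_gr_or_eq)
  ultimately have "(\<lambda>n. distrib_fun h (real n)) \<longlonglongrightarrow> 0"
    by (simp add: distrib_fun_def)
  then have "eventually (\<lambda>n. distrib_fun h (real n) < ennreal x) sequentially"
    using \<open>0 < x\<close> by (intro order_tendstoD) auto
  then obtain n where "distrib_fun h (real n) < ennreal x"
    by (auto simp: eventually_sequentially)
  then show ?thesis by (intro exI[of _ "real n"]) auto
qed

text \<open>Right continuity of the distribution function, in the only form needed: the superlevel
  sets at \<open>y + 1/(n+1)\<close> increase to the one at \<open>y\<close>.\<close>

lemma distrib_fun_right_cont:
  assumes h: "h \<in> borel_measurable I01" and "e < distrib_fun h y"
  shows "\<exists>z>y. e < distrib_fun h z"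
proof -
  let ?A = "\<lambda>n::nat. {t \<in> {0<..<1}. \<bar>h t\<bar> > y + 1 / Suc n}"
  have "(SUP n. emeasure I01 (?A n)) = emeasure I01 (\<Union>n. ?A n)"
  proof (rule SUP_emeasure_incseq)
    show "incseq ?A"
    proof (rule incseq_SucI, rule subsetI)
      fix n t assume t: "t \<in> ?A n"
      have "1 / real (Suc (Suc n)) \<le> 1 / real (Suc n)"
        by (simp add: field_simps)
      then show "t \<in> ?A (Suc n)" using t by auto
    qed
  qed (use superlevel_sets[OF h] in auto)
  also have "(\<Union>n. ?A n) = {t \<in> {0<..<1}. \<bar>h t\<bar> > y}"
  proof (intro equalityI subsetI)
    fix t assume t: "t \<in> {t \<in> {0<..<1}. \<bar>h t\<bar> > y}"
    then obtain n where "1 / Suc n < \<bar>h t\<bar> - y"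
      using reals_Archimedean[of "\<bar>h t\<bar> - y"] by (auto simp: inverse_eq_divide)
    then show "t \<in> (\<Union>n. ?A n)" using t by (auto intro!: exI[of _ n])
  next
    fix t assume "t \<in> (\<Union>n. ?A n)"
    then obtain n where "t \<in> {0<..<1}" "y + 1 / Suc n < \<bar>h t\<bar>" by auto
    moreover have "0 < 1 / real (Suc n)" by simp
    ultimately have "t \<in> {0<..<1}" "y < \<bar>h t\<bar>" by linarith+
    then show "t \<in> {t \<in> {0<..<1}. \<bar>h t\<bar> > y}" by simp
  qed
  finally have "e < (SUP n. emeasure I01 (?A n))"
    using assms(2) by (simp add: distrib_fun_def)
  then obtain n where "e < distrib_fun h (y + 1 / Suc n)"
    by (auto simp: less_SUP_iff distrib_fun_def)
  then show ?thesis by (intro exI[of _ "y + 1 / Suc n"]) auto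
qed

lemma rearr_nonneg: "h \<in> borel_measurable I01 \<Longrightarrow> 0 \<le> rearr h x"
  unfolding rearr_def using distrib_fun_small[of h x] by (auto intro!: cInf_greatest)

text \<open>For the backward direction right continuity supplies a level \<open>z > y\<close> that
  is still inadmissible; the infimum is then at least \<open>z\<close>, which makes the inequality
  strict.\<close>

lemma rearr_greater_iff:
  assumes h: "h \<in> borel_measurable I01" and "0 \<le> y" "0 < x"
  shows "y < rearr h x \<longleftrightarrow> ennreal x < distrib_fun h y"
proof
  assume "y < rearr h x"
  moreover have "rearr h x \<le> y" if "distrib_fun h y \<le> ennreal x"
    unfolding rearr_def using assms that by (auto intro!: cInf_lower bdd_belowI[of _ 0])
  ultimately show "ennreal x < distrib_fun h y" by force
next
  assume "ennreal x < distrib_fun h y"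
  then obtain z where z: "z > y" "ennreal x < distrib_fun h z"
    using distrib_fun_right_cont[OF h] by blast
  have "z \<le> rearr h x"
  proof -
    have "z \<le> u" if u: "0 \<le> u" "distrib_fun h u \<le> ennreal x" for u
      using z distrib_fun_antimono[OF h, of u z] u(2) by (meson leD le_cases order_trans)
    then show ?thesis
      unfolding rearr_def using assms distrib_fun_small[OF h, of x] by (auto intro!: cInf_greatest)
  qed
  then show "y < rearr h x" using z by simp
qed

lemma rearr_superlevel:
  assumes h: "h \<in> borel_measurable I01" and "0 \<le> y"
  shows "{x \<in> {0<..<1}. y < rearr h x} = {0<..<enn2real (distrib_fun h y)}"
proof -
  have fin: "distrib_fun h y \<le> 1" by (rule distrib_fun_le_1[OF h])
  then have eq: "ennreal (enn2real (distrib_fun h y)) = distrib_fun h y"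
    by (metis ennreal_enn2real_if ennreal_one_neq_top top.extremum_unique)
  have "enn2real (distrib_fun h y) \<le> 1"
    using fin enn2real_mono[OF fin] by simp
  moreover have "ennreal x < distrib_fun h y \<longleftrightarrow> x < enn2real (distrib_fun h y)" if "0 < x" for x
    using that by (subst eq[symmetric]) (simp add: ennreal_less_iff)
  ultimately show ?thesis
    using rearr_greater_iff[OF assms] by auto
qed

lemma rearr_measurable:
  assumes h: "h \<in> borel_measurable I01"
  shows "rearr h \<in> borel_measurable I01"
  unfolding borel_measurable_iff_greater
proof
  fix y :: real
  show "{w \<in> space I01. y < rearr h w} \<in> sets I01"
  proof (cases "0 \<le> y")
    case True
    then show ?thesis
      using rearr_superlevel[OF h True] distrib_fun_le_1[OF h, of y] enn2real_mono[of "distrib_fun h y" 1]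
      by (simp add: interval_in_sets_I01)
  next
    case False
    then have "{w \<in> space I01. y < rearr h w} = space I01"
      using rearr_nonneg[OF h] by (auto intro: less_le_trans simp: not_le)
    then show ?thesis by (metis sets.top)
  qed
qed

lemma rearr_nonneg_meas: "h \<in> borel_measurable I01 \<Longrightarrow> nonneg_meas (rearr h)"
  by (simp add: nonneg_meas_def rearr_measurable rearr_nonneg)

lemma equimeasurable_rearr:
  assumes h: "h \<in> borel_measurable I01"
  shows "equimeasurable h (rearr h)"
  unfolding equimeasurable_def
proof
  fix y
  show "distrib_fun h y = distrib_fun (rearr h) y"
  proof (cases "0 \<le> y")
    case True
    have fin: "distrib_fun h y \<le> 1" by (rule distrib_fun_le_1[OF h])
    then have eq: "ennreal (enn2real (distrib_fun h y)) = distrib_fun h y"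
      by (metis ennreal_enn2real_if ennreal_one_neq_top top.extremum_unique)
    have le: "enn2real (distrib_fun h y) \<le> 1"
      using fin enn2real_mono[OF fin] by simp
    have "distrib_fun (rearr h) y = emeasure I01 {x \<in> {0<..<1}. y < rearr h x}"
      by (simp add: distrib_fun_def rearr_nonneg[OF h])
    also have "\<dots> = distrib_fun h y"
      unfolding rearr_superlevel[OF h True] using le by (subst emeasure_I01_interval) (auto simp: eq)
    finally show ?thesis by simp
  next
    case False
    then show ?thesis unfolding distrib_fun_def
      by (intro arg_cong[where f="emeasure I01"]) auto
  qed
qed

lemma rearr_antimono:
  assumes h: "h \<in> borel_measurable I01" and "0 < x" "x \<le> x'"
  shows "rearr h x' \<le> rearr h x"
proof -
  have "{y. 0 \<le> y \<and> distrib_fun h y \<le> ennreal x} \<subseteq> {y. 0 \<le> y \<and> distrib_fun h y \<le> ennreal x'}"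
    using assms by (auto intro: order_trans ennreal_leI)
  then show ?thesis
    unfolding rearr_def using assms distrib_fun_small[OF h, of x]
    by (auto intro!: cInf_superset_mono bdd_belowI[of _ 0])
qed

text \<open>Equal distribution functions mean image measures that agree on all open half-lines,
  hence agree; both integrals are integrals of the identity against this image.\<close>

lemma nn_integral_equimeasurable:
  assumes "nonneg_meas f" "nonneg_meas g" and eq: "equimeasurable f g"
  shows "(\<integral>\<^sup>+ t. ennreal (f t) \<partial>I01) = (\<integral>\<^sup>+ t. ennreal (g t) \<partial>I01)"
proof -
  have [measurable]: "f \<in> borel_measurable I01" "g \<in> borel_measurable I01"
    and pos: "\<And>t. 0 \<le> f t" "\<And>t. 0 \<le> g t"
    using assms by (auto simp: nonneg_meas_def)
  have em: "emeasure (distr I01 borel u) {x<..} = distrib_fun u x"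
    if "u \<in> borel_measurable I01" "\<And>t. 0 \<le> u t" for u x
    using that by (subst emeasure_distr)
      (auto simp: distrib_fun_def intro!: arg_cong[where f="emeasure I01"])
  have "distr I01 borel f = distr I01 borel g"
  proof (rule measure_eqI_lessThan)
    fix x show "emeasure (distr I01 borel f) {x<..} < \<infinity>"
      using distrib_fun_le_1[of f x] by (simp add: em pos) (metis ennreal_one_less_top order_le_less_trans)
    show "emeasure (distr I01 borel f) {x<..} = emeasure (distr I01 borel g) {x<..}"
      using eq by (simp add: em pos equimeasurable_def)
  qed auto
  then have "(\<integral>\<^sup>+ x. ennreal x \<partial>distr I01 borel f) = (\<integral>\<^sup>+ x. ennreal x \<partial>distr I01 borel g)"
    by simp
  then show ?thesis by (simp add: nn_integral_distr)
qed

section \<open>Step functions on equal cells and their cyclic shifts\<close>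

lemma bij_betw_mod_shift: "bij_betw (\<lambda>k. (k + m) mod n) {..<n} {..<(n::nat)}"
proof (rule bij_betw_imageI)
  show inj: "inj_on (\<lambda>k. (k + m) mod n) {..<n}"
  proof (rule inj_onI)
    fix x y assume "x \<in> {..<n}" "y \<in> {..<n}" "(x + m) mod n = (y + m) mod n"
    then have "int x mod int n = int y mod int n"
      by (metis add_diff_cancel_right' mod_diff_left_eq of_nat_add of_nat_mod)
    then show "x = y" using \<open>x \<in> _\<close> \<open>y \<in> _\<close> by (simp flip: of_nat_mod)
  qed
  show "(\<lambda>k. (k + m) mod n) ` {..<n} = {..<n}"
    by (rule endo_inj_surj[OF _ _ inj]) auto
qed

text \<open>The function with value \<open>d k\<close> on the k-th of \<open>n\<close> cells of
  length \<open>t/n\<close>. Indexing by a floor lets a cyclic shift act on the coefficients instead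
  of on the variable.\<close>

definition step_fun :: "real \<Rightarrow> nat \<Rightarrow> (nat \<Rightarrow> real) \<Rightarrow> real \<Rightarrow> real" where
  "step_fun t n d x = (if 0 < x \<and> x < t then d (nat \<lfloor>x * real n / t\<rfloor>) else 0)"

lemma floor_cell:
  assumes "0 < t" "0 < (n::nat)" "0 < x"
  shows "nat \<lfloor>x * real n / t\<rfloor> = k \<longleftrightarrow> real k * t / n \<le> x \<and> x < real (Suc k) * t / n"
proof -
  have "nat \<lfloor>x * real n / t\<rfloor> = k \<longleftrightarrow> \<lfloor>x * real n / t\<rfloor> = int k"
    using assms by (metis divide_nonneg_pos floor_of_nat int_nat_eq less_eq_real_def mult_nonneg_nonneg nat_int of_nat_0_le_iff zero_le_floor)
  also have "\<dots> \<longleftrightarrow> real k \<le> x * n / t \<and> x * n / t < real k + 1"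
    by (simp add: floor_eq_iff)
  also have "\<dots> \<longleftrightarrow> real k * t / n \<le> x \<and> x < real (Suc k) * t / n"
    using assms by (simp add: field_simps)
  finally show ?thesis .
qed

lemma floor_cell_less:
  assumes "0 < t" "0 < (n::nat)" "0 < x" "x < t"
  shows "nat \<lfloor>x * real n / t\<rfloor> < n"
proof -
  have "x * n / t < n" using assms by (simp add: field_simps)
  then have "\<lfloor>x * real n / t\<rfloor> < int n" by (simp add: floor_less_iff)
  then show ?thesis using assms(2) by linarith
qed

lemma step_cell_measure:
  assumes "0 < t" "t \<le> 1" "0 < (n::nat)" "k < n"
  defines "C \<equiv> {x \<in> {0<..<t}. nat \<lfloor>x * real n / t\<rfloor> = k}"
  shows "C \<in> sets I01" "emeasure I01 C = ennreal (t / n)"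
proof -
  have C: "C = {real k * t / n ..< real (Suc k) * t / n} \<inter> {0<..<t}"
  proof (rule set_eqI)
    fix x show "x \<in> C \<longleftrightarrow> x \<in> {real k * t / n ..< real (Suc k) * t / n} \<inter> {0<..<t}"
    proof (cases "0 < x")
      case True
      then show ?thesis
        unfolding C_def using floor_cell[OF assms(1,3) True, of k] by (simp del: of_nat_Suc) blast
    qed (auto simp: C_def)
  qed
  show m: "C \<in> sets I01"
    unfolding sets_I01_iff C using assms by auto
  have sub: "real (Suc k) * t / n \<le> t"
  proof -
    have "real (Suc k) * t \<le> real n * t"
      using assms by (intro mult_right_mono) auto
    then show ?thesis using assms by (simp add: field_simps)
  qed
  have "0 \<le> real k * t / n" using assms by simp
  have 1: "real (Suc k) * t / n - real k * t / n = t / n"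
    by (simp add: algebra_simps flip: diff_divide_distrib)
  have 2: "real k * t / n \<le> real (Suc k) * t / n"
    using assms by (intro divide_right_mono mult_right_mono) auto
  have "emeasure I01 C = emeasure lebesgue C"
    using assms(2) by (intro emeasure_I01) (auto simp: C)
  also have "\<dots> = ennreal (t / n)"
  \<comment> \<open>Cell 0 lacks its left endpoint and the others contain theirs; squeezing between
    the closed and the open interval treats all cells at once.\<close>
  proof (rule antisym)
    have "emeasure lebesgue C \<le> emeasure lebesgue {real k * t / n .. real (Suc k) * t / n}"
      by (rule emeasure_mono) (auto simp: C)
    also have "\<dots> = ennreal (t / n)" using 1 2 by simp
    finally show "emeasure lebesgue C \<le> ennreal (t / n)" .
    have "ennreal (t / n) = emeasure lebesgue {real k * t / n <..< real (Suc k) * t / n}"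
      using 1 2 by simp
    also have "\<dots> \<le> emeasure lebesgue C"
      by (rule emeasure_mono) (use m sub \<open>0 \<le> real k * t / n\<close> in \<open>auto simp: C\<close>)
    finally show "ennreal (t / n) \<le> emeasure lebesgue C" .
  qed
  finally show "emeasure I01 C = ennreal (t / n)" .
qed

lemma step_fun_superlevel:
  assumes "0 < t" "t \<le> 1" "0 < (n::nat)" "\<And>k. 0 \<le> d k" "0 \<le> y"
  shows "{x \<in> {0<..<1}. \<bar>step_fun t n d x\<bar> > y} =
    (\<Union>k\<in>{k\<in>{..<n}. d k > y}. {x \<in> {0<..<t}. nat \<lfloor>x * real n / t\<rfloor> = k})"
proof -
  have "x < 1" if "x < t" for x using that assms by simp
  then show ?thesis
    using assms floor_cell_less[OF assms(1,3)] by (auto simp: step_fun_def split: if_splits)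
qed

lemma step_fun_distrib:
  assumes "0 < t" "t \<le> 1" "0 < (n::nat)" "\<And>k. 0 \<le> d k" "0 \<le> y"
  shows "distrib_fun (step_fun t n d) y = of_nat (card {k\<in>{..<n}. d k > y}) * ennreal (t / n)"
proof -
  have "distrib_fun (step_fun t n d) y =
      (\<Sum>k\<in>{k\<in>{..<n}. d k > y}. emeasure I01 {x \<in> {0<..<t}. nat \<lfloor>x * real n / t\<rfloor> = k})"
    unfolding distrib_fun_def step_fun_superlevel[OF assms]
    using step_cell_measure(1)[OF assms(1-3)]
    by (intro sum_emeasure[symmetric]) (auto simp: disjoint_family_on_def)
  also have "\<dots> = (\<Sum>k\<in>{k\<in>{..<n}. d k > y}. ennreal (t / n))"
    using step_cell_measure(2)[OF assms(1-3)] by (intro sum.cong) auto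
  finally show ?thesis by simp
qed

lemma step_fun_nonneg_meas:
  assumes "0 < t" "t \<le> 1" "0 < (n::nat)" "\<And>k. 0 \<le> d k"
  shows "nonneg_meas (step_fun t n d)"
proof -
  have nn: "0 \<le> step_fun t n d x" for x
    using assms by (simp add: step_fun_def)
  have "step_fun t n d \<in> borel_measurable I01"
    by (rule borel_measurable_I01) (unfold step_fun_def, measurable)
  then show ?thesis using nn by (simp add: nonneg_meas_def)
qed

text \<open>The shift permutes the values among cells of equal measure, so at each nonnegative level
  the number of cells above it is unchanged.\<close>

lemma step_fun_equi:
  assumes "0 < t" "t \<le> 1" "0 < (n::nat)" "\<And>k. 0 \<le> d k"
  shows "equimeasurable (step_fun t n d) (step_fun t n (\<lambda>k. d ((k + m) mod n)))"
  unfolding equimeasurable_def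
proof
  fix y
  let ?d = "\<lambda>k. d ((k + m) mod n)"
  show "distrib_fun (step_fun t n d) y = distrib_fun (step_fun t n ?d) y"
  proof (cases "0 \<le> y")
    case True
    have "bij_betw (\<lambda>k. (k + m) mod n) {k\<in>{..<n}. ?d k > y} {k\<in>{..<n}. d k > y}"
      by (rule bij_betw_Collect[OF bij_betw_mod_shift]) simp
    then have "card {k\<in>{..<n}. ?d k > y} = card {k\<in>{..<n}. d k > y}"
      by (rule bij_betw_same_card)
    then show ?thesis using assms True by (simp add: step_fun_distrib)
  next
    case False
    then show ?thesis unfolding distrib_fun_def
      by (intro arg_cong[where f="emeasure I01"]) auto
  qed
qed

text \<open>As the shift runs through all residues, a fixed point of (0,t) meets every coefficient
  exactly once.\<close>

lemma step_fun_sum: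
  assumes "0 < t" "0 < (n::nat)"
  shows "(\<Sum>m<n. step_fun t n (\<lambda>k. d ((k + m) mod n)) x) = (\<Sum>k<n. d k) * indicator {0<..<t} x"
proof (cases "0 < x \<and> x < t")
  case True
  let ?k = "nat \<lfloor>x * real n / t\<rfloor>"
  have "(\<Sum>m<n. step_fun t n (\<lambda>k. d ((k + m) mod n)) x) = (\<Sum>m<n. d ((m + ?k) mod n))"
    using True by (simp add: step_fun_def add.commute)
  also have "\<dots> = (\<Sum>k<n. d k)"
    by (rule sum.reindex_bij_betw[OF bij_betw_mod_shift])
  finally show ?thesis using True by simp
qed (auto simp: step_fun_def)

context ri begin

text \<open>Averaging the cyclic shifts of a lower step function of the decreasing rearrangement.\<close>
lemma averaging:
  assumes h: "nonneg_meas h" and t: "0 < t" "t \<le> 1" and supp: "distrib_fun h 0 \<le> ennreal t"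
  shows "(\<integral>\<^sup>+ x. ennreal (h x) \<partial>I01) * N (indicator {0<..<t}) \<le> ennreal t * N h"
proof -
  have hm: "h \<in> borel_measurable I01" using h by (simp add: nonneg_meas_def)
  define g where "g = rearr h"
  have gm[measurable]: "g \<in> borel_measurable I01" and g0: "0 \<le> g x" for x
    using rearr_measurable[OF hm] rearr_nonneg[OF hm] by (auto simp: g_def)
  have gN: "N g = N h" and gI: "(\<integral>\<^sup>+ x. ennreal (g x) \<partial>I01) = (\<integral>\<^sup>+ x. ennreal (h x) \<partial>I01)"
    using equi[OF h _ equimeasurable_rearr[OF hm]] nn_integral_equimeasurable[OF h _ equimeasurable_rearr[OF hm]]
      rearr_nonneg_meas[OF hm] by (auto simp: g_def)
  \<comment> \<open>The support bound says that the distribution function at level 0 is at most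
    \<open>t\<close>, so the rearrangement lives on (0,t).\<close>
  have g_out: "g x = 0" if "t \<le> x" for x
  proof -
    have "\<not> 0 < rearr h x"
      using rearr_greater_iff[OF hm, of 0 x] that t supp
      by (meson ennreal_leI leD less_le_trans order.refl order_trans)
    then show ?thesis using g0[of x] by (simp add: g_def)
  qed
  have g_anti: "g x' \<le> g x" if "0 < x" "x \<le> x'" for x x'
    using rearr_antimono[OF hm that] by (simp add: g_def)
  let ?I = "\<lambda>n. \<integral>\<^sup>+ x. ennreal (g x) * indicator {t / Suc n..} x \<partial>I01"
  have main: "?I n * N (indicator {0<..<t}) \<le> ennreal t * N h" for n
  proof -
    let ?n = "Suc n"
    \<comment> \<open>The value at the right end of cell \<open>k\<close>. As \<open>g\<close> is
      nonincreasing, the step function lies below \<open>g\<close>, while \<open>c k\<close> bounds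
      \<open>g\<close> from above on cell \<open>k + 1\<close>.\<close>
    define c where "c k = g (real (Suc k) * t / ?n)" for k
    have c0: "0 \<le> c k" for k by (simp add: c_def g0)
    define S where "S = (\<Sum>k<?n. c k)"
    have S0: "0 \<le> S" unfolding S_def by (intro sum_nonneg) (simp add: c0)
    have step_le: "step_fun t ?n c x \<le> g x" for x
    proof (cases "0 < x \<and> x < t")
      case True
      let ?k = "nat \<lfloor>x * real ?n / t\<rfloor>"
      have "x < real (Suc ?k) * t / ?n"
        using floor_cell[of t ?n x ?k] t True by blast
      then have "c ?k \<le> g x" unfolding c_def using True by (intro g_anti) auto
      then show ?thesis using True by (simp add: step_fun_def)
    qed (auto simp: step_fun_def g0)
    have nm: "nonneg_meas (step_fun t ?n (\<lambda>k. c ((k + m) mod ?n)))" for m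
      using t c0 by (intro step_fun_nonneg_meas) auto
    have nm0: "nonneg_meas (step_fun t ?n c)"
      using t c0 by (intro step_fun_nonneg_meas) auto
    have gnm: "nonneg_meas g" by (simp add: nonneg_meas_def g0)
    have Nle: "N (step_fun t ?n (\<lambda>k. c ((k + m) mod ?n))) \<le> N h" for m
    proof -
      have "N (step_fun t ?n (\<lambda>k. c ((k + m) mod ?n))) = N (step_fun t ?n c)"
        using t c0 by (intro equi[symmetric] nm nm0 step_fun_equi) auto
      also have "\<dots> \<le> N g" by (intro mono nm0 gnm AE_I2 step_le)
      finally show ?thesis by (simp add: gN)
    qed
    \<comment> \<open>The n+1 shifts sum to the constant \<open>S\<close> on (0,t), and each has
      norm at most \<open>N h\<close>.\<close>
    have "ennreal S * N (indicator {0<..<t}) = N (\<lambda>x. S * indicator {0<..<t} x)"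
      using t S0 by (intro scale[symmetric] nonneg_meas_indicator interval_in_sets_I01)
    also have "\<dots> = N (\<lambda>x. \<Sum>m<?n. step_fun t ?n (\<lambda>k. c ((k + m) mod ?n)) x)"
      using t by (subst step_fun_sum) (auto simp: S_def)
    also have "\<dots> \<le> (\<Sum>m<?n. N (step_fun t ?n (\<lambda>k. c ((k + m) mod ?n))))"
      by (intro finite_sum nm) auto
    also have "\<dots> \<le> (\<Sum>m<?n. N h)" by (intro sum_mono Nle)
    finally have SN: "ennreal S * N (indicator {0<..<t}) \<le> ennreal ?n * N h"
      by (simp del: of_nat_Suc add: ennreal_of_nat_eq_real_of_nat)
    let ?C = "\<lambda>k. {x \<in> {0<..<t}. nat \<lfloor>x * real ?n / t\<rfloor> = k}"
    \<comment> \<open>Upper bound for \<open>g\<close> by the coefficient of the preceding cell.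
      Cell 0 has no predecessor and \<open>g\<close> may be unbounded on it, which is why the
      integral starts at \<open>t/(n+1)\<close>.\<close>
    have pw: "ennreal (g x) * indicator {t / ?n..} x \<le> (\<Sum>k<n. ennreal (c k) * indicator (?C (Suc k)) x)"
      if x: "x \<in> space I01" for x
    proof (cases "t / ?n \<le> x \<and> x < t")
      case True
      then have x0: "0 < x" using t by (meson divide_pos_pos less_le_trans of_nat_0_less_iff zero_less_Suc)
      define k where "k = nat \<lfloor>x * real ?n / t\<rfloor>"
      have k: "real k * t / ?n \<le> x" "x < real (Suc k) * t / ?n"
        using floor_cell[of t ?n x k] t x0 k_def by blast+
      have kn: "k < ?n" using floor_cell_less[of t ?n x] t x0 True by (simp add: k_def)
      have "k \<noteq> 0"
      proof
        assume "k = 0"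
        then show False using k(2) True by simp
      qed
      then obtain i where i: "k = Suc i" using not0_implies_Suc by blast
      have "g x \<le> c i" unfolding c_def using t k(1) i by (intro g_anti) auto
      then have "ennreal (g x) * indicator {t / ?n..} x \<le> ennreal (c i) * indicator (?C (Suc i)) x"
        using True x0 i k_def by (auto simp: indicator_def intro: ennreal_leI)
      also have "\<dots> \<le> (\<Sum>k<n. ennreal (c k) * indicator (?C (Suc k)) x)"
        using kn i by (intro member_le_sum) auto
      finally show ?thesis .
    next
      case False
      then show ?thesis using g_out by (auto simp: indicator_def not_le not_less)
    qed
    have Cm: "?C (Suc k) \<in> sets I01" if "k < n" for k
      using that t by (intro step_cell_measure) auto
    have "?I n \<le> (\<integral>\<^sup>+ x. (\<Sum>k<n. ennreal (c k) * indicator (?C (Suc k)) x) \<partial>I01)"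
      by (intro nn_integral_mono pw)
    also have "\<dots> = (\<Sum>k<n. ennreal (c k) * emeasure I01 (?C (Suc k)))"
      using Cm by (subst nn_integral_sum) (auto intro!: sum.cong nn_integral_cmult_indicator)
    also have "\<dots> = (\<Sum>k<n. ennreal (c k) * ennreal (t / ?n))"
      using t by (intro sum.cong refl arg_cong2[where f="(*)"] step_cell_measure) auto
    also have "\<dots> = ennreal ((\<Sum>k<n. c k) * (t / ?n))"
      using c0 t by (simp add: sum_distrib_right del: of_nat_Suc times_divide_eq_right flip: ennreal_mult)
    also have "\<dots> \<le> ennreal (S * (t / ?n))"
      unfolding S_def using t c0 by (intro ennreal_leI mult_right_mono) auto
    finally have IS: "?I n \<le> ennreal S * ennreal (t / ?n)"
      using S0 t by (subst (asm) ennreal_mult) auto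
    have "?I n * N (indicator {0<..<t}) \<le> ennreal S * ennreal (t / ?n) * N (indicator {0<..<t})"
      by (intro mult_right_mono IS) auto
    also have "\<dots> = ennreal (t / ?n) * (ennreal S * N (indicator {0<..<t}))"
      by (simp add: mult_ac)
    also have "\<dots> \<le> ennreal (t / ?n) * (ennreal ?n * N h)"
      by (intro mult_left_mono SN) auto
    also have "\<dots> = ennreal (t / ?n * ?n) * N h"
      using t by (subst ennreal_mult) (auto simp: mult.assoc)
    also have "t / ?n * ?n = t" by simp
    finally show ?thesis .
  qed
  \<comment> \<open>The omitted first cell shrinks to nothing, so monotone convergence recovers the
    full integral.\<close>
  have "incseq (\<lambda>n x. ennreal (g x) * indicator {t / Suc n..} x)"
  proof (intro incseq_SucI le_funI mult_left_mono)
    fix n x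
    have "t / Suc (Suc n) \<le> t / Suc n" using t by (intro divide_left_mono) auto
    then show "(indicator {t / Suc n..} x :: ennreal) \<le> indicator {t / Suc (Suc n)..} x"
      by (auto simp: indicator_def)
  qed auto
  moreover have "(\<lambda>x. ennreal (g x) * indicator {t / Suc n..} x) \<in> borel_measurable I01" for n
    by (intro borel_measurable_times_ennreal measurable_compose_rev[OF measurable_ennreal] gm
        borel_measurable_I01 borel_measurable_indicator) auto
  ultimately have "(\<integral>\<^sup>+ x. (SUP n. ennreal (g x) * indicator {t / Suc n..} x) \<partial>I01) = (SUP n. ?I n)"
    by (intro nn_integral_monotone_convergence_SUP) 
  moreover have "(SUP n. ennreal (g x) * indicator {t / Suc n..} x) = ennreal (g x)" if "x \<in> space I01" for x
  proof (rule antisym)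
    show "(SUP n. ennreal (g x) * indicator {t / Suc n..} x) \<le> ennreal (g x)"
      by (intro SUP_least) (auto simp: indicator_def)
    have "0 < x / t" using that t by simp
    then obtain n where "1 / Suc n < x / t" using reals_Archimedean by (auto simp: inverse_eq_divide)
    then have "t / Suc n \<le> x" using t by (simp add: field_simps)
    then show "ennreal (g x) \<le> (SUP n. ennreal (g x) * indicator {t / Suc n..} x)"
      by (intro SUP_upper2[of n]) (auto simp: indicator_def)
  qed
  ultimately have "(\<integral>\<^sup>+ x. ennreal (h x) \<partial>I01) = (SUP n. ?I n)"
    unfolding gI[symmetric] by (simp cong: nn_integral_cong_simp)
  then show ?thesis
    using main by (simp add: SUP_mult_right_ennreal SUP_le_iff)
qed

end

section \<open>Fundamental function\<close>


lemma tendsto_ennreal_0I: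
  fixes X :: "'a \<Rightarrow> ennreal"
  assumes "\<And>e::real. 0 < e \<Longrightarrow> \<forall>\<^sub>F x in F. X x \<le> ennreal e"
  shows "(X \<longlongrightarrow> 0) F"
proof (rule order_tendstoI)
  fix a :: ennreal assume "0 < a"
  then obtain z where z: "0 < z" "z < a" using dense by blast
  then have "z < top" by (meson order_less_le_trans top_greatest)
  then have "z = ennreal (enn2real z)" "0 < enn2real z"
    using z by (auto simp: enn2real_positive_iff)
  then show "\<forall>\<^sub>F x in F. X x < a"
    using assms[of "enn2real z"] z by (auto elim!: eventually_mono)
qed auto

context ri begin

abbreviation \<phi> :: "real \<Rightarrow> ennreal" where "\<phi> t \<equiv> N (indicator {0<..<t})"

text \<open>The bound on characteristic functions survives scaling, sums and increasing limits,
  because the integral is additive and the norm subadditive.\<close>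

lemma le_integral_of_phi_le:
  assumes C: "\<And>t. 0 < t \<Longrightarrow> t \<le> 1 \<Longrightarrow> \<phi> t \<le> ennreal C * ennreal t"
    and f: "nonneg_meas f"
  shows "N f \<le> ennreal C * (\<integral>\<^sup>+x. ennreal (f x) \<partial>I01)"
proof -
  have "f \<in> borel_measurable I01" "\<And>x. 0 \<le> f x" using f by (auto simp: nonneg_meas_def)
  then show ?thesis
  proof (induction rule: borel_measurable_induct_real)
    case (set A)
    have "N (indicator A) = \<phi> (measure I01 A)" by (rule indicator_interval[OF set])
    also have "\<dots> \<le> ennreal C * ennreal (measure I01 A)"
    proof (cases "measure I01 A = 0")
      case True
      then show ?thesis
        using zero_iff[of "indicator {}"] by (simp add: nonneg_meas_indicator)
    next
      case False
      then show ?thesis by (intro C) (auto simp: zero_less_measure_iff measure_nonneg order_less_le)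
    qed
    also have "ennreal (measure I01 A) = (\<integral>\<^sup>+x. ennreal (indicator A x) \<partial>I01)"
      using set by (simp add: ennreal_indicator I01.emeasure_eq_measure)
    finally show ?case .
  next
    case (mult u c)
    then have "N (\<lambda>x. c * u x) = ennreal c * N u" by (intro scale nonneg_measI)
    also have "\<dots> \<le> ennreal c * (ennreal C * (\<integral>\<^sup>+x. ennreal (u x) \<partial>I01))"
      by (intro mult_left_mono mult) auto
    also have "\<dots> = ennreal C * (\<integral>\<^sup>+x. ennreal (c * u x) \<partial>I01)"
      using mult by (simp add: ennreal_mult nn_integral_cmult mult_ac)
    finally show ?case .
  next
    case (add u v)
    then have "N (\<lambda>x. v x + u x) \<le> N v + N u" by (intro subadd nonneg_measI)
    also have "\<dots> \<le> ennreal C * (\<integral>\<^sup>+x. ennreal (v x) \<partial>I01) + ennreal C * (\<integral>\<^sup>+x. ennreal (u x) \<partial>I01)"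
      by (intro add_mono add)
    also have "\<dots> = ennreal C * (\<integral>\<^sup>+x. ennreal (v x + u x) \<partial>I01)"
      using add by (simp add: nn_integral_add distrib_left)
    finally show ?case .
  next
    case (seq U)
    have u0: "0 \<le> f x" for x using f by (simp add: nonneg_meas_def)
    have inc: "incseq (\<lambda>k. U k x)" for x using \<open>incseq U\<close> by (auto simp: incseq_def le_fun_def)
    have Uf: "(\<lambda>k. U k x) \<longlonglongrightarrow> f x" if "x \<in> space I01" for x using seq that by blast
    have "(\<lambda>k. N (U k)) \<longlonglongrightarrow> N f"
      using seq f by (intro lim nonneg_measI AE_I2 conjI inc Uf) (auto simp: nonneg_meas_def)
    moreover have "N (U k) \<le> ennreal C * (\<integral>\<^sup>+x. ennreal (f x) \<partial>I01)" for k
    proof -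
      have "N (U k) \<le> ennreal C * (\<integral>\<^sup>+x. ennreal (U k x) \<partial>I01)" by (rule seq)
      also have "\<dots> \<le> ennreal C * (\<integral>\<^sup>+x. ennreal (f x) \<partial>I01)"
        using incseq_le[OF inc Uf] by (intro mult_left_mono nn_integral_mono ennreal_leI) auto
      finally show ?thesis .
    qed
    ultimately show ?case by (intro LIMSEQ_le_const2) auto
  qed
qed

section \<open>The spaces L^1 and L^infinity recognised by the fundamental function\<close>

lemma ri_space_subset_L1: "ri_space N \<subseteq> L1_space"
proof
  fix f assume f: "f \<in> ri_space N"
  obtain C where C: "\<And>f. nonneg_meas f \<Longrightarrow> (\<integral>\<^sup>+ t. ennreal (f t) \<partial>I01) \<le> ennreal C * N f"
    using L1 by metis
  have "(\<integral>\<^sup>+ t. ennreal \<bar>f t\<bar> \<partial>I01) \<le> ennreal C * rinorm N f"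
    unfolding rinorm_def using f by (intro C nonneg_measI) (auto simp: ri_space_def)
  also have "\<dots> < \<infinity>" using f by (auto simp: ri_space_def ennreal_mult_less_top)
  finally show "f \<in> L1_space"
    using f by (simp add: L1_space_def ri_space_def integrable_iff_bounded)
qed

lemma Linf_subset_ri_space: "Linf_space \<subseteq> ri_space N"
proof
  fix f assume "f \<in> Linf_space"
  then obtain C where f: "f \<in> borel_measurable I01" and C: "AE t in I01. \<bar>f t\<bar> \<le> C"
    by (auto simp: Linf_space_def)
  have "rinorm N f \<le> N (\<lambda>t. \<bar>C\<bar> * 1)"
    unfolding rinorm_def using f C
    by (intro mono nonneg_measI) (auto elim!: eventually_mono)
  also have "\<dots> = ennreal \<bar>C\<bar> * N (\<lambda>_. 1)" by (rule scale) (auto simp: nonneg_meas_def)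
  also have "\<dots> < \<infinity>" using one by (simp add: ennreal_mult_less_top)
  finally show "f \<in> ri_space N" using f by (simp add: ri_space_def)
qed

text \<open>If the quotient \<phi>(t)/t were bounded, the norm would be dominated by a multiple of
  the integral, and every integrable function would lie in the space.\<close>

lemma phi_unbounded_of_not_L1:
  assumes "ri_space N \<noteq> L1_space"
  shows "\<exists>t. 0 < t \<and> t \<le> 1 \<and> ennreal C * ennreal t < \<phi> t"
proof (rule ccontr)
  assume "\<not> ?thesis"
  then have C: "\<phi> t \<le> ennreal C * ennreal t" if "0 < t" "t \<le> 1" for t
    using that not_less by blast
  have "L1_space \<subseteq> ri_space N"
  proof
    fix f assume f: "f \<in> L1_space"
    have "rinorm N f \<le> ennreal C * (\<integral>\<^sup>+x. ennreal \<bar>f x\<bar> \<partial>I01)"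
      unfolding rinorm_def using f C
      by (intro le_integral_of_phi_le nonneg_measI) (auto simp: L1_space_def)
    also have "\<dots> < \<infinity>" using f by (auto simp: L1_space_def integrable_iff_bounded ennreal_mult_less_top)
    finally show "f \<in> ri_space N" using f by (simp add: ri_space_def L1_space_def)
  qed
  then show False using assms ri_space_subset_L1 by auto
qed

lemma suminf_half_powers: "(\<Sum>k. ennreal ((1/2) ^ k)) = 2"
proof -
  have "(\<lambda>k. ennreal ((1/2) ^ k)) sums ennreal 2"
    using geometric_sums[of "1/2::real"] by (subst sums_ennreal) auto
  then show ?thesis by (simp add: sums_iff)
qed

text \<open>Gliding hump. If \<phi>(t)/t exceeded 4^k at some \<open>t k\<close> for every k,
  suitable multiples of the characteristic functions of (0, \<open>t k\<close>) would add up to an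
  integrable function of infinite norm.\<close>

lemma phi_le_of_L1:
  assumes "ri_space N = L1_space"
  shows "\<exists>C>0. \<forall>t. 0 < t \<longrightarrow> t \<le> 1 \<longrightarrow> \<phi> t \<le> ennreal C * ennreal t"
proof (rule ccontr)
  assume "\<not> ?thesis"
  then have "\<exists>t. 0 < t \<and> t \<le> 1 \<and> \<not> \<phi> t \<le> ennreal C * ennreal t" if "0 < C" for C
    using that by blast
  then have "\<forall>k::nat. \<exists>t. 0 < t \<and> t \<le> 1 \<and> ennreal (4 ^ k) * ennreal t < \<phi> t"
    by (metis not_le zero_less_numeral zero_less_power)
  then obtain t where t: "\<And>k. 0 < t k" "\<And>k. t k \<le> 1" "\<And>k::nat. ennreal (4 ^ k) * ennreal (t k) < \<phi> (t k)"
    by metis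
  \<comment> \<open>The k-th summand has integral \<open>(1/2)^k\<close> and norm above
    \<open>2^k\<close>: of the factor \<open>4^k\<close>, one half makes the integrals summable and
    the other makes the norms unbounded.\<close>
  define u where "u x = (\<Sum>k. ennreal ((1/2)^k / t k) * indicator {0<..<t k} x)" for x
  have um[measurable]: "u \<in> borel_measurable I01"
    unfolding u_def using t by (intro borel_measurable_I01 borel_measurable_suminf) measurable
  have "(\<integral>\<^sup>+x. u x \<partial>I01) = (\<Sum>k. \<integral>\<^sup>+x. ennreal ((1/2)^k / t k) * indicator {0<..<t k} x \<partial>I01)"
    unfolding u_def using t by (intro nn_integral_suminf) (auto intro!: borel_measurable_indicator)
  also have "\<dots> = (\<Sum>k. ennreal ((1/2)^k))"
  proof (rule suminf_cong)
    fix k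
    have "(\<integral>\<^sup>+x. ennreal ((1/2)^k / t k) * indicator {0<..<t k} x \<partial>I01) = ennreal ((1/2)^k / t k) * ennreal (t k)"
      using t[of k] by (subst nn_integral_cmult_indicator) (auto simp: emeasure_I01_interval less_imp_le)
    also have "\<dots> = ennreal ((1/2)^k / t k * t k)" using t(1)[of k] by (intro ennreal_mult[symmetric]) auto
    also have "(1/2)^k / t k * t k = (1/2)^k" using t(1)[of k] by simp
    finally show "(\<integral>\<^sup>+x. ennreal ((1/2)^k / t k) * indicator {0<..<t k} x \<partial>I01) = ennreal ((1/2)^k)" .
  qed
  also have "\<dots> = 2" by (rule suminf_half_powers)
  finally have int: "(\<integral>\<^sup>+x. u x \<partial>I01) = 2" .
  have fin: "AE x in I01. u x \<noteq> \<infinity>"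
    by (rule nn_integral_PInf_AE) (auto simp: int)
  define f where "f x = enn2real (u x)" for x
  have fm[measurable]: "f \<in> borel_measurable I01" unfolding f_def by measurable
  have f0: "0 \<le> f x" for x by (simp add: f_def)
  have "(\<integral>\<^sup>+x. ennreal (norm (f x)) \<partial>I01) \<le> (\<integral>\<^sup>+x. u x \<partial>I01)"
    unfolding f_def by (intro nn_integral_mono) (simp add: ennreal_enn2real_if)
  then have "integrable I01 f"
    by (intro integrableI_bounded) (auto simp: int order_le_less_trans)
  then have "f \<in> ri_space N" using assms by (simp add: L1_space_def)
  then have Nf: "N f < \<infinity>" by (simp add: ri_space_def rinorm_def f0)
  have big: "ennreal (2 ^ k) \<le> N f" for k
  proof -
    have "ennreal (2 ^ k) = ennreal ((1/2)^k / t k) * (ennreal (4 ^ k) * ennreal (t k))"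
    proof -
      have "(2::real) ^ k = (1/2)^k * 4 ^ k" by (simp flip: power_mult_distrib)
      then have "(2::real) ^ k = (1/2)^k / t k * (4 ^ k * t k)" using t(1)[of k] by simp
      then show ?thesis using t(1)[of k] by (simp flip: ennreal_mult)
    qed
    also have "\<dots> \<le> ennreal ((1/2)^k / t k) * \<phi> (t k)"
      using t(3)[of k] by (intro mult_left_mono) auto
    also have "\<dots> = N (\<lambda>x. (1/2)^k / t k * indicator {0<..<t k} x)"
      using t[of k] by (intro scale[symmetric] nonneg_meas_indicator) (auto simp: less_imp_le)
    also have "\<dots> \<le> N f"
    proof (rule mono)
      show "nonneg_meas (\<lambda>x. (1/2)^k / t k * indicator {0<..<t k} x)"
        using t[of k] by (intro nonneg_measI) (auto simp: less_imp_le intro!: borel_measurable_times borel_measurable_indicator)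
      show "nonneg_meas f" by (simp add: nonneg_meas_def f0)
      show "AE x in I01. (1/2)^k / t k * indicator {0<..<t k} x \<le> f x"
        using fin
      proof eventually_elim
        case (elim x)
        have "ennreal ((1/2)^k / t k) * indicator {0<..<t k} x \<le> u x"
          unfolding u_def using sum_le_suminf[of "\<lambda>k. ennreal ((1/2)^k / t k) * indicator {0<..<t k} x" "{k}"]
          by (simp del: sum_mult_indicator)
        then have "ennreal ((1/2)^k / t k * indicator {0<..<t k} x) \<le> ennreal (f x)"
          using elim t(1)[of k] by (auto simp: f_def indicator_def less_top)
        then show ?case using f0[of x] by (simp add: ennreal_le_iff)
      qed
    qed
    finally show ?thesis .
  qed
  obtain r where r: "N f = ennreal r" "0 \<le> r" using Nf by (cases "N f") auto
  obtain k where "r < 2 ^ k" using real_arch_pow[of 2 r] by auto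
  then show False using big[of k] r by (simp add: ennreal_le_iff)
qed

text \<open>If \<phi> stayed above \<open>e\<close>, then exceeding \<open>C\<close> on a set of
  positive measure would cost norm at least \<open>C * e\<close>; so every function of finite norm
  would be essentially bounded.\<close>

lemma phi_small_of_not_Linf:
  assumes "ri_space N \<noteq> Linf_space" "0 < e"
  shows "\<exists>t. 0 < t \<and> t \<le> 1 \<and> \<phi> t < ennreal e"
proof (rule ccontr)
  assume "\<not> ?thesis"
  then have e: "ennreal e \<le> \<phi> t" if "0 < t" "t \<le> 1" for t using that not_less by blast
  have "ri_space N \<subseteq> Linf_space"
  proof
    fix f assume f: "f \<in> ri_space N"
    then have fm[measurable]: "f \<in> borel_measurable I01" and Nf: "rinorm N f < \<infinity>" by (auto simp: ri_space_def)
    obtain r where r: "rinorm N f = ennreal r" "0 \<le> r" using Nf by (cases "rinorm N f") auto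
    \<comment> \<open>Then \<open>C * e = r + e\<close> exceeds the norm \<open>r\<close> of
      \<open>f\<close>.\<close>
    define C where "C = r / e + 1"
    have C0: "0 < C" using r assms by (simp add: C_def add_nonneg_pos)
    define A where "A = {t \<in> {0<..<1}. \<bar>f t\<bar> > C}"
    have A: "A \<in> sets I01" unfolding A_def by (rule superlevel_sets[OF fm])
    have "measure I01 A = 0"
    proof (rule ccontr)
      assume "measure I01 A \<noteq> 0"
      then have "ennreal e \<le> \<phi> (measure I01 A)" by (intro e) (auto simp: order_less_le)
      then have "ennreal C * ennreal e \<le> ennreal C * N (indicator A)"
        by (intro mult_left_mono) (auto simp: indicator_interval[OF A])
      also have "\<dots> = N (\<lambda>x. C * indicator A x)"
        using A C0 by (intro scale[symmetric] nonneg_meas_indicator) auto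
      also have "\<dots> \<le> rinorm N f"
        unfolding rinorm_def
        using A C0 by (intro mono nonneg_measI AE_I2 borel_measurable_times borel_measurable_indicator)
          (auto simp: A_def indicator_def)
      finally have "C * e \<le> r" using r C0 assms by (simp flip: ennreal_mult)
      then show False using assms by (simp add: C_def distrib_right)
    qed
    then have "A \<in> null_sets I01" using A by (auto simp: I01.emeasure_eq_measure)
    then have "AE t in I01. t \<notin> A" by (rule AE_not_in)
    moreover have "AE t in I01. t \<in> {0<..<1}" by (rule AE_I2) simp
    ultimately have "AE t in I01. \<bar>f t\<bar> \<le> C"
      by eventually_elim (auto simp: A_def)
    then show "f \<in> Linf_space" by (auto simp: Linf_space_def)
  qed
  then show False using assms Linf_subset_ri_space by auto
qed

text \<open>Gliding hump again: with \<phi>(\<open>t k\<close>) below \<open>4^(-k)\<close>, the sum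
  of \<open>2^k\<close> times the characteristic functions of (0, \<open>t k\<close>) has norm at
  most 2 but is essentially unbounded.\<close>

lemma phi_ge_of_Linf:
  assumes "ri_space N = Linf_space"
  shows "\<exists>c>0. \<forall>t. 0 < t \<longrightarrow> t \<le> 1 \<longrightarrow> ennreal c \<le> \<phi> t"
proof (rule ccontr)
  assume "\<not> ?thesis"
  then have "\<exists>t. 0 < t \<and> t \<le> 1 \<and> \<not> ennreal c \<le> \<phi> t" if "0 < c" for c
    using that by blast
  then have "\<forall>k::nat. \<exists>t. 0 < t \<and> t \<le> 1 \<and> \<phi> t < ennreal ((1/4) ^ k)"
    by (metis not_le zero_less_divide_1_iff zero_less_numeral zero_less_power)
  then obtain t where t: "\<And>k. 0 < t k" "\<And>k. t k \<le> 1" "\<And>k::nat. \<phi> (t k) < ennreal ((1/4) ^ k)"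
    by metis
  obtain C where C: "0 < C" "\<And>f. nonneg_meas f \<Longrightarrow> (\<integral>\<^sup>+ t. ennreal (f t) \<partial>I01) \<le> ennreal C * N f"
    using L1 by metis
  have half: "(2::real) ^ k * (1/4)^k = (1/2)^k" for k by (simp flip: power_mult_distrib)
  \<comment> \<open>Embedding into L^1 makes the lengths \<open>t k\<close> decay as well. Hence the
    sum below is finite almost everywhere and defines a real function.\<close>
  have tC: "ennreal (t k) \<le> ennreal C * ennreal ((1/4)^k)" for k
  proof -
    have "ennreal (t k) = (\<integral>\<^sup>+ x. ennreal (indicator {0<..<t k} x) \<partial>I01)"
      using t[of k] by (simp add: ennreal_indicator emeasure_I01_interval less_imp_le)
    also have "\<dots> \<le> ennreal C * \<phi> (t k)"
      using t[of k] by (intro C nonneg_meas_indicator) (auto simp: less_imp_le)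
    also have "\<dots> \<le> ennreal C * ennreal ((1/4)^k)" using t(3)[of k] by (intro mult_left_mono) auto
    finally show ?thesis .
  qed
  define u where "u x = (\<Sum>k. ennreal (2^k) * indicator {0<..<t k} x)" for x
  have um[measurable]: "u \<in> borel_measurable I01"
    unfolding u_def using t by (intro borel_measurable_I01 borel_measurable_suminf) measurable
  have "(\<integral>\<^sup>+x. u x \<partial>I01) = (\<Sum>k. \<integral>\<^sup>+x. ennreal (2^k) * indicator {0<..<t k} x \<partial>I01)"
    unfolding u_def using t by (intro nn_integral_suminf) (auto intro!: borel_measurable_indicator)
  also have "\<dots> \<le> (\<Sum>k. ennreal C * ennreal ((1/2)^k))"
  proof (rule suminf_le)
    fix k
    have "(\<integral>\<^sup>+x. ennreal (2^k) * indicator {0<..<t k} x \<partial>I01) = ennreal (2^k) * ennreal (t k)"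
      using t[of k] by (subst nn_integral_cmult_indicator) (auto simp: emeasure_I01_interval less_imp_le)
    also have "\<dots> \<le> ennreal (2^k) * (ennreal C * ennreal ((1/4)^k))" by (intro mult_left_mono tC) auto
    also have "\<dots> = ennreal C * ennreal ((1/2)^k)"
      unfolding half[of k, symmetric] by (subst ennreal_mult) (auto simp: mult_ac)
    finally show "(\<integral>\<^sup>+x. ennreal (2^k) * indicator {0<..<t k} x \<partial>I01) \<le> ennreal C * ennreal ((1/2)^k)" .
  qed auto
  also have "\<dots> = ennreal C * 2" by (simp add: ennreal_suminf_cmult suminf_half_powers)
  finally have int: "(\<integral>\<^sup>+x. u x \<partial>I01) < \<infinity>" by (auto simp: ennreal_mult_less_top order_le_less_trans)
  have fin: "AE x in I01. u x \<noteq> \<infinity>"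
    by (rule nn_integral_PInf_AE) (use int in auto)
  define f where "f x = enn2real (u x)" for x
  have fm[measurable]: "f \<in> borel_measurable I01" unfolding f_def by measurable
  have f0: "0 \<le> f x" for x by (simp add: f_def)
  have fnm: "nonneg_meas f" by (simp add: nonneg_meas_def f0)
  define s where "s n x = (\<Sum>k<n. 2^k * indicator {0<..<t k} x :: real)" for n x
  have tm: "nonneg_meas (\<lambda>x. 2^k * indicator {0<..<t k} x)" for k
    using t[of k] by (intro nonneg_measI) (auto simp: less_imp_le intro!: borel_measurable_times borel_measurable_indicator)
  have snm: "nonneg_meas (s n)" for n
    unfolding s_def by (intro nonneg_measI borel_measurable_sum sum_nonneg) (use tm in \<open>auto simp: nonneg_meas_def\<close>)
  have Ns: "N (s n) \<le> 2" for n
  proof -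
    have "N (s n) \<le> (\<Sum>k<n. N (\<lambda>x. 2^k * indicator {0<..<t k} x))"
      unfolding s_def by (intro finite_sum tm) auto
    also have "\<dots> \<le> (\<Sum>k<n. ennreal ((1/2)^k))"
    proof (rule sum_mono)
      fix k
      have "N (\<lambda>x. 2^k * indicator {0<..<t k} x) = ennreal (2^k) * \<phi> (t k)"
        using t[of k] by (intro scale nonneg_meas_indicator) (auto simp: less_imp_le)
      also have "\<dots> \<le> ennreal (2^k) * ennreal ((1/4)^k)" using t(3)[of k] by (intro mult_left_mono) auto
      also have "\<dots> = ennreal ((1/2)^k)" unfolding half[of k, symmetric] by (subst ennreal_mult) auto
      finally show "N (\<lambda>x. 2^k * indicator {0<..<t k} x) \<le> ennreal ((1/2)^k)" .
    qed
    also have "\<dots> \<le> 2" unfolding suminf_half_powers[symmetric] by (rule sum_le_suminf) auto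
    finally show ?thesis .
  qed
  have se: "ennreal (s n x) = (\<Sum>k<n. ennreal (2^k) * indicator {0<..<t k} x)" for n x
    unfolding s_def by (subst sum_ennreal[symmetric]) (auto intro!: sum.cong simp: indicator_def)
  have conv: "(\<lambda>n. s n x) \<longlonglongrightarrow> f x" if "u x \<noteq> \<infinity>" for x
  proof (rule tendsto_ennrealD)
    have "(\<lambda>n. ennreal (s n x)) \<longlonglongrightarrow> u x"
      unfolding se u_def by (rule summable_LIMSEQ) auto
    then show "(\<lambda>n. ennreal (s n x)) \<longlonglongrightarrow> ennreal (f x)" using that by (simp add: f_def less_top)
  qed (use snm f0 in \<open>auto simp: nonneg_meas_def\<close>)
  have inc: "incseq (\<lambda>n. s n x)" for x
    by (intro incseq_SucI) (simp add: s_def)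
  have lm: "(\<lambda>n. N (s n)) \<longlonglongrightarrow> N f"
    using fin by (intro lim snm fnm) (auto elim!: eventually_mono intro: conv inc)
  have "N f \<le> 2" by (rule LIMSEQ_le_const2[OF lm]) (use Ns in auto)
  then have "f \<in> ri_space N" by (simp add: ri_space_def rinorm_def f0 order_le_less_trans)
  then obtain K where K: "AE x in I01. \<bar>f x\<bar> \<le> K" using assms by (auto simp: Linf_space_def)
  obtain k where k: "K < 2 ^ k" using real_arch_pow[of 2 K] by auto
  have "AE x in I01. x \<notin> {0<..<t k}"
    using K fin
  proof eventually_elim
    case (elim x)
    show ?case
    proof
      assume x: "x \<in> {0<..<t k}"
      have "2 ^ k * indicator {0<..<t k} x \<le> s (Suc k) x"
        unfolding s_def by (rule member_le_sum) auto
      also have "\<dots> \<le> f x" using incseq_le[OF inc conv[OF elim(2)]] .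
      finally show False using x elim k by simp
    qed
  qed
  then have "{0<..<t k} \<in> null_sets I01"
    using t[of k] by (subst AE_iff_null_sets) auto
  then have "emeasure I01 {0<..<t k} = 0" by auto
  then show False using t[of k] by (simp add: emeasure_I01_interval less_imp_le)
qed

text \<open>Split each function at a small level \<open>d\<close>: the part below is at most
  \<open>d\<close> times the norm of 1, and the part above is bounded and lives on sets of vanishing
  measure, whose characteristic functions have small norm because \<phi> takes arbitrarily small
  values.\<close>

lemma dominated_convergence:
  assumes small: "\<And>e. 0 < e \<Longrightarrow> \<exists>t. 0 < t \<and> t \<le> 1 \<and> \<phi> t < ennreal e"
    and h: "\<And>n. nonneg_meas (h n)" and K: "\<And>n. AE t in I01. h n t \<le> K"
    and conv: "AE t in I01. (\<lambda>n. h n t) \<longlonglongrightarrow> 0"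
  shows "(\<lambda>n. N (h n)) \<longlonglongrightarrow> 0"
proof (rule tendsto_ennreal_0I)
  fix e :: real assume e: "0 < e"
  have hm[measurable]: "h n \<in> borel_measurable I01" and h0: "0 \<le> h n t" for n t
    using h by (auto simp: nonneg_meas_def)
  obtain r where r: "N (\<lambda>_. 1) = ennreal r" "0 \<le> r" using one by (cases "N (\<lambda>_. 1)") auto
  \<comment> \<open>Half of \<open>e\<close> is reserved for the level \<open>d\<close>, the other
    half for the exceptional set; \<open>r + 1\<close> also covers \<open>r = 0\<close>.\<close>
  define d where "d = e / (2 * (r + 1))"
  have d: "0 < d" "d * r \<le> e / 2" using e r by (auto simp: d_def field_simps)
  define K' where "K' = max K 1"
  have K': "0 < K'" by (simp add: K'_def)
  obtain t where t: "0 < t" "t \<le> 1" "\<phi> t < ennreal (e / (2 * K'))"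
    using small[of "e / (2 * K')"] e K' by auto
  define A where "A n = {x \<in> {0<..<1}. \<bar>h n x\<bar> > d}" for n
  have A: "A n \<in> sets I01" for n unfolding A_def by (rule superlevel_sets[OF hm])
  have "(\<lambda>n. \<integral>x. indicator (A n) x \<partial>I01) \<longlonglongrightarrow> (\<integral>x. (0::real) \<partial>I01)"
  proof (rule integral_dominated_convergence[where w="\<lambda>_. 1"])
    show "AE x in I01. (\<lambda>n. indicator (A n) x :: real) \<longlonglongrightarrow> 0"
      using conv
    proof eventually_elim
      case (elim x)
      then have "eventually (\<lambda>n. h n x < d) sequentially" using d by (intro order_tendstoD)
      then have "eventually (\<lambda>n. indicator (A n) x = (0::real)) sequentially"
        by (auto elim!: eventually_mono simp: A_def h0)
      then show ?case by (rule tendsto_eventually)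
    qed
  qed (use A in \<open>auto simp: indicator_def intro!: borel_measurable_indicator\<close>)
  then have "(\<lambda>n. measure I01 (A n)) \<longlonglongrightarrow> 0" 
    using sets.Int_space_eq2[OF A] by simp
  then have "eventually (\<lambda>n. measure I01 (A n) < t) sequentially" using t by (intro order_tendstoD)
  then show "\<forall>\<^sub>F n in sequentially. N (h n) \<le> ennreal e"
  proof eventually_elim
    case (elim n)
    have nm1: "nonneg_meas (\<lambda>x. d * 1)" and nm2: "nonneg_meas (\<lambda>x. K' * indicator (A n) x)"
      using d K' A by (auto intro!: nonneg_measI borel_measurable_times borel_measurable_indicator)
    have AEK: "AE x in I01. h n x \<le> d * 1 + K' * indicator (A n) x"
    proof -
      have "AE x in I01. x \<in> {0<..<1}" by (rule AE_I2) simp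
      with K[of n] show ?thesis
      proof eventually_elim
        case (elim x) then show ?case using d h0[of n x] by (auto simp: A_def indicator_def K'_def)
      qed
    qed
    have "N (h n) \<le> N (\<lambda>x. d * 1 + K' * indicator (A n) x)"
      by (rule mono[OF h _ AEK]) (use nm1 nm2 in \<open>auto simp: nonneg_meas_def\<close>)
    also have "\<dots> \<le> N (\<lambda>x. d * 1) + N (\<lambda>x. K' * indicator (A n) x)" by (rule subadd[OF nm1 nm2])
    also have "\<dots> = ennreal d * N (\<lambda>_. 1) + ennreal K' * N (indicator (A n))"
      using d K' A by (intro arg_cong2[where f="(+)"] scale nonneg_meas_indicator) (auto simp: nonneg_meas_def)
    also have "\<dots> \<le> ennreal (e / 2) + ennreal K' * ennreal (e / (2 * K'))"
    proof (intro add_mono mult_left_mono)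
      show "ennreal d * N (\<lambda>_. 1) \<le> ennreal (e / 2)"
        using d r by (simp add: ennreal_leI flip: ennreal_mult)
      have "N (indicator (A n)) \<le> \<phi> t"
        unfolding indicator_interval[OF A] using elim t by (intro phi_mono) auto
      then show "N (indicator (A n)) \<le> ennreal (e / (2 * K'))" using t by simp
    qed auto
    also have "\<dots> = ennreal (e / 2 + K' * (e / (2 * K')))" using e K' by (simp flip: ennreal_mult ennreal_plus)
    also have "e / 2 + K' * (e / (2 * K')) = e" using K' by (simp add: field_simps)
    finally show ?case .
  qed
qed

end

section \<open>The iterated Hardy operator\<close>


lemma downset_borel:
  fixes A :: "real set"
  assumes "\<And>x y. x \<in> A \<Longrightarrow> y \<le> x \<Longrightarrow> y \<in> A"
  shows "A \<in> sets borel"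
  by (rule real_interval_borel_measurable) (use assms in \<open>auto simp: is_interval_1\<close>)

lemma borel_measurable_antimono_ennreal:
  fixes g :: "real \<Rightarrow> ennreal"
  assumes "antimono g"
  shows "g \<in> borel_measurable borel"
proof (rule borel_measurableI_greater)
  fix y show "{x \<in> space borel. y < g x} \<in> sets borel"
    by (rule downset_borel) (use assms in \<open>auto simp: antimono_def intro: less_le_trans\<close>)
qed

lemma borel_measurable_mono_ennreal:
  fixes g :: "real \<Rightarrow> ennreal"
  assumes "mono g"
  shows "g \<in> borel_measurable borel"
proof (rule borel_measurableI_less)
  fix y show "{x \<in> space borel. g x < y} \<in> sets borel"
    by (rule downset_borel) (use assms in \<open>auto simp: mono_def intro: le_less_trans\<close>)
qed

lemma indicator_I01 [measurable]:
  "A \<in> sets borel \<Longrightarrow> (indicator A :: real \<Rightarrow> ennreal) \<in> borel_measurable I01"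
  "A \<in> sets borel \<Longrightarrow> (indicator A :: real \<Rightarrow> real) \<in> borel_measurable I01"
  by (auto intro!: borel_measurable_I01)

lemma AE_I01_neq: "AE r in I01. r \<noteq> (u::real)"
proof -
  have "{u} \<in> null_sets lebesgue" by simp
  then have "AE r in lebesgue. r \<noteq> u" using AE_not_in[of "{u}" lebesgue] by simp
  then show ?thesis by (subst AE_restrict_space_iff) (auto elim!: eventually_mono)
qed

text \<open>The operator integrates against Borel-Lebesgue measure although \<open>f\<close> and
  \<open>J\<close> are only Lebesgue measurable. Completing the measure does not change nonnegative
  integrals, and the endpoint 1 is null.\<close>

lemma nn_integral_lborel_I01:
  assumes "0 < t"
  shows "(\<integral>\<^sup>+ s. indicator {t..1} s * g s \<partial>lborel) = (\<integral>\<^sup>+ s. indicator {t..} s * g s \<partial>I01)"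
proof -
  have "{1::real} \<in> null_sets lebesgue" by simp
  then have ae: "AE r in lebesgue. r \<noteq> (1::real)" using AE_not_in[of "{1}" lebesgue] by simp
  have "(\<integral>\<^sup>+ s. indicator {t..1} s * g s \<partial>lborel) = (\<integral>\<^sup>+ s. indicator {t..1} s * g s \<partial>lebesgue)"
    by (rule nn_integral_completion[symmetric])
  also have "\<dots> = (\<integral>\<^sup>+ s. indicator {t..} s * g s * indicator {0<..<1} s \<partial>lebesgue)"
    using ae assms by (intro nn_integral_cong_AE) (auto elim!: eventually_mono simp: indicator_def)
  also have "\<dots> = (\<integral>\<^sup>+ s. indicator {t..} s * g s \<partial>I01)"
    by (subst nn_integral_restrict_space) auto
  finally show ?thesis .
qed

lemma emeasure_I01_Icc_le: "emeasure I01 ({t..s} \<inter> {0<..<1}) \<le> ennreal (max 0 (s - t))"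
proof -
  have "emeasure I01 ({t..s} \<inter> {0<..<1}) = emeasure lebesgue ({t..s} \<inter> {0<..<1})"
    by (intro emeasure_I01) auto
  also have "\<dots> \<le> emeasure lebesgue {t..s}" by (intro emeasure_mono) auto
  also have "\<dots> \<le> ennreal (max 0 (s - t))" by (cases "t \<le> s") (auto simp: ennreal_leI)
  finally show ?thesis .
qed

text \<open>Mean value estimate for the p-th power, phrased without subtraction because the values
  may be infinite.\<close>

lemma power_add_le_ennreal:
  fixes y d L :: ennreal
  assumes "y + d \<le> L"
  shows "(y + d) ^ p \<le> y ^ p + of_nat p * d * L ^ (p - 1)"
proof (induction p)
  case 0 then show ?case by simp
next
  case (Suc p)
  have yL: "y \<le> L" using assms by (meson add_increasing2 order_trans zero_le order_refl)
  have "(y + d) ^ Suc p = y * (y + d) ^ p + d * (y + d) ^ p" by (simp add: distrib_right)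
  also have "\<dots> \<le> y * (y ^ p + of_nat p * d * L ^ (p - 1)) + d * L ^ p"
    by (intro add_mono mult_left_mono Suc power_mono assms) auto
  also have "\<dots> = y ^ Suc p + of_nat p * d * (y * L ^ (p - 1)) + d * L ^ p"
    by (simp add: distrib_left mult_ac)
  also have "\<dots> \<le> y ^ Suc p + of_nat p * d * L ^ p + d * L ^ p"
  proof (cases p)
    case 0 then show ?thesis by simp
  next
    case (Suc q)
    then have "y * L ^ (p - 1) \<le> L ^ p" using yL by (auto intro!: mult_right_mono)
    then show ?thesis by (intro add_mono mult_left_mono) auto
  qed
  also have "\<dots> = y ^ Suc p + of_nat (Suc p) * d * L ^ (Suc p - 1)"
    by (simp add: distrib_right distrib_left algebra_simps)
  finally show ?case .
qed

section \<open>Kernel of the operator and its estimates away from zero\<close>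

locale hardy =
  fixes J :: "real \<Rightarrow> real" and c :: real
  assumes J_meas [measurable]: "J \<in> borel_measurable I01"
    and c_pos: "0 < c"
    and J_ge: "\<And>t. 0 < t \<Longrightarrow> t < 1 \<Longrightarrow> c * t \<le> J t"
begin

definition KK :: "real \<Rightarrow> real \<Rightarrow> ennreal" where
  "KK t s = (\<integral>\<^sup>+ r. indicator {t..s} r * ennreal (1 / J r) \<partial>I01)"

text \<open>The operator for \<open>j = p + 1\<close> without its factor \<open>1/p!\<close>. No
  upper cutoff is written since the measure lives on (0,1).\<close>

definition HH :: "nat \<Rightarrow> (real \<Rightarrow> real) \<Rightarrow> real \<Rightarrow> ennreal" where
  "HH p f t = (\<integral>\<^sup>+ s. indicator {t..} s * (ennreal (\<bar>f s\<bar> / J s) * KK t s ^ p) \<partial>I01)"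

lemma J_pos: "0 < t \<Longrightarrow> t < 1 \<Longrightarrow> 0 < J t"
  using J_ge[of t] c_pos by (meson less_le_trans mult_pos_pos)

lemma inv_J_le:
  assumes "0 < a" "a \<le> s" "s < 1" shows "1 / J s \<le> 1 / (c * a)"
proof -
  have "c * a \<le> J s" using J_ge[of s] c_pos assms by (meson less_le_trans mult_left_mono order_trans less_imp_le)
  then show ?thesis using c_pos assms by (intro divide_left_mono) (auto intro!: mult_pos_pos J_pos)
qed

lemma abs_div_J_le:
  assumes "0 < a" "a \<le> s" "s < 1" shows "ennreal (\<bar>x\<bar> / J s) \<le> ennreal (1 / (c * a)) * ennreal \<bar>x\<bar>"
proof -
  have "\<bar>x\<bar> / J s \<le> 1 / (c * a) * \<bar>x\<bar>"
    using mult_right_mono[OF inv_J_le[OF assms], of "\<bar>x\<bar>"] by simp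
  then show ?thesis using c_pos assms by (subst ennreal_mult[symmetric]) (auto intro: ennreal_leI)
qed

lemma KK_le_diff:
  assumes "0 < a" "a \<le> t" "t \<le> s"
  shows "KK t s \<le> ennreal ((s - t) / (c * a))"
proof -
  have "KK t s \<le> (\<integral>\<^sup>+ r. ennreal (1 / (c * a)) * indicator ({t..s} \<inter> {0<..<1}) r \<partial>I01)"
    unfolding KK_def
    using assms by (intro nn_integral_mono) (auto simp: indicator_def intro!: ennreal_leI inv_J_le)
  also have "\<dots> = ennreal (1 / (c * a)) * emeasure I01 ({t..s} \<inter> {0<..<1})"
    by (intro nn_integral_cmult_indicator borel_set_I01) auto
  also have "\<dots> \<le> ennreal (1 / (c * a)) * ennreal (max 0 (s - t))"
    by (intro mult_left_mono emeasure_I01_Icc_le) auto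
  also have "\<dots> = ennreal ((s - t) / (c * a))"
    using assms c_pos by (subst ennreal_mult[symmetric]) auto
  finally show ?thesis .
qed

lemma KK_le:
  assumes "0 < a" "a \<le> t"
  shows "KK t s \<le> ennreal (1 / (c * a))"
proof -
  have "KK t s \<le> (\<integral>\<^sup>+ r. ennreal (1 / (c * a)) \<partial>I01)"
    unfolding KK_def
    using assms by (intro nn_integral_mono) (auto simp: indicator_def intro!: ennreal_leI inv_J_le)
  also have "\<dots> = ennreal (1 / (c * a))" using I01.emeasure_space_1 by simp
  finally show ?thesis .
qed

lemma KK_finite: "0 < t \<Longrightarrow> KK t s < \<infinity>"
  using KK_le[of t t s] by (simp add: order_le_less_trans)

lemma KK_mono: "t' \<le> t \<Longrightarrow> s \<le> s' \<Longrightarrow> KK t s \<le> KK t' s'"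
  unfolding KK_def by (intro nn_integral_mono mult_right_mono) (auto simp: indicator_def)

lemma KK_empty: "s < t \<Longrightarrow> KK t s = 0"
  unfolding KK_def by simp

lemma KK_split:
  assumes "t \<le> u" "u \<le> s"
  shows "KK t s = KK t u + KK u s"
proof -
  have "KK t s = (\<integral>\<^sup>+ r. indicator {t..u} r * ennreal (1 / J r) + indicator {u..s} r * ennreal (1 / J r) \<partial>I01)"
    unfolding KK_def using AE_I01_neq[of u] assms
    by (intro nn_integral_cong_AE) (auto elim!: eventually_mono simp: indicator_def)
  also have "\<dots> = KK t u + KK u s"
    unfolding KK_def by (intro nn_integral_add) measurable
  finally show ?thesis .
qed

lemma KK_pos:
  assumes "0 < b" "b < a" "a < 1"
  shows "KK b a \<noteq> 0"
proof
  assume "KK b a = 0"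
  then have "AE r in I01. indicator {b..a} r * ennreal (1 / J r) = 0"
    unfolding KK_def by (subst (asm) nn_integral_0_iff_AE) (auto, measurable)
  moreover have "AE r in I01. r \<in> {0<..<1}" by (rule AE_I2) simp
  ultimately have "AE r in I01. r \<notin> {b..a}"
  proof eventually_elim
    case (elim r)
    then show ?case using J_pos[of r] by (auto simp: indicator_def ennreal_eq_0_iff split: if_splits)
  qed
  moreover have ba: "{b..a} \<in> sets I01" using assms by (auto simp: sets_I01_iff)
  ultimately have "{b..a} \<in> null_sets I01" by (subst AE_iff_null_sets) auto
  then have "emeasure I01 {b..a} = 0" by auto
  then show False using assms by (subst (asm) emeasure_I01) auto
qed

lemma KK_meas [measurable]: "KK t \<in> borel_measurable I01" "(\<lambda>t. KK t s) \<in> borel_measurable I01"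
  by (rule borel_measurable_I01[OF borel_measurable_mono_ennreal], simp add: mono_def KK_mono)
     (rule borel_measurable_I01[OF borel_measurable_antimono_ennreal], simp add: antimono_def KK_mono)

lemma HH_antimono: "t \<le> t' \<Longrightarrow> HH p f t' \<le> HH p f t"
  unfolding HH_def
  by (intro nn_integral_mono mult_mono power_mono KK_mono) (auto simp: indicator_def)

lemma HH_meas [measurable]: "HH p f \<in> borel_measurable I01"
  by (intro borel_measurable_I01 borel_measurable_antimono_ennreal) (auto simp: antimono_def HH_antimono)

text \<open>On [t,1) both the density 1/J and the inner integral are at most
  \<open>1 / (c * t)\<close>; the former contributes one factor and the latter
  \<open>p\<close>.\<close>

lemma HH_le:
  assumes [measurable]: "f \<in> borel_measurable I01" and "0 < t"
  shows "HH p f t \<le> ennreal (1 / (c * t)) ^ Suc p * (\<integral>\<^sup>+ s. ennreal \<bar>f s\<bar> \<partial>I01)"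
proof -
  have "HH p f t \<le> (\<integral>\<^sup>+ s. ennreal (1 / (c * t)) ^ Suc p * ennreal \<bar>f s\<bar> \<partial>I01)"
    unfolding HH_def
  proof (rule nn_integral_mono)
    fix s assume s: "s \<in> space I01"
    show "indicator {t..} s * (ennreal (\<bar>f s\<bar> / J s) * KK t s ^ p) \<le> ennreal (1 / (c * t)) ^ Suc p * ennreal \<bar>f s\<bar>"
    proof (cases "t \<le> s")
      case True
      have "ennreal (\<bar>f s\<bar> / J s) * KK t s ^ p \<le> (ennreal (1 / (c * t)) * ennreal \<bar>f s\<bar>) * ennreal (1 / (c * t)) ^ p"
        using True s assms by (intro mult_mono power_mono abs_div_J_le KK_le) auto
      then show ?thesis using True by (simp add: mult_ac)
    qed auto
  qed
  also have "\<dots> = ennreal (1 / (c * t)) ^ Suc p * (\<integral>\<^sup>+ s. ennreal \<bar>f s\<bar> \<partial>I01)"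
    by (intro nn_integral_cmult) measurable
  finally show ?thesis .
qed

lemma Hop_eq:
  assumes "0 < t"
  shows "Hop (Suc p) J f t = HH p f t / ennreal (fact p)"
proof -
  have K: "(\<integral>\<^sup>+ r. indicator {t..s} r * ennreal (1 / J r) \<partial>lborel) = KK t s" if "s < 1" for s
  proof -
    have "(\<integral>\<^sup>+ r. indicator {t..s} r * ennreal (1 / J r) \<partial>lborel)
        = (\<integral>\<^sup>+ r. indicator {t..1} r * (indicator {t..s} r * ennreal (1 / J r)) \<partial>lborel)"
      using that by (intro nn_integral_cong) (auto simp: indicator_def)
    also have "\<dots> = (\<integral>\<^sup>+ r. indicator {t..} r * (indicator {t..s} r * ennreal (1 / J r)) \<partial>I01)"
      by (rule nn_integral_lborel_I01[OF assms])
    also have "\<dots> = KK t s" unfolding KK_def by (intro nn_integral_cong) (auto simp: indicator_def)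
    finally show ?thesis .
  qed
  show ?thesis
    unfolding Hop_def HH_def diff_Suc_1 mult.assoc nn_integral_lborel_I01[OF assms]
    by (intro arg_cong2[where f="(/)"] nn_integral_cong refl) (auto simp: K)
qed

lemma HH_add:
  assumes [measurable]: "f \<in> borel_measurable I01"
  shows "HH p f t = HH p (\<lambda>s. indicator {0<..<a} s * f s) t + HH p (\<lambda>s. indicator {a..} s * f s) t"
proof -
  have "HH p f t = (\<integral>\<^sup>+ s. indicator {t..} s * (ennreal (\<bar>indicator {0<..<a} s * f s\<bar> / J s) * KK t s ^ p)
      + indicator {t..} s * (ennreal (\<bar>indicator {a..} s * f s\<bar> / J s) * KK t s ^ p) \<partial>I01)"
    unfolding HH_def by (intro nn_integral_cong) (auto simp: indicator_def)
  also have "\<dots> = HH p (\<lambda>s. indicator {0<..<a} s * f s) t + HH p (\<lambda>s. indicator {a..} s * f s) t"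
    unfolding HH_def by (intro nn_integral_add) measurable
  finally show ?thesis .
qed

lemma HH_scale:
  assumes [measurable]: "f \<in> borel_measurable I01" and "0 \<le> C"
  shows "HH p (\<lambda>s. C * f s) t = ennreal C * HH p f t"
proof -
  have "HH p (\<lambda>s. C * f s) t = (\<integral>\<^sup>+ s. ennreal C * (indicator {t..} s * (ennreal (\<bar>f s\<bar> / J s) * KK t s ^ p)) \<partial>I01)"
    unfolding HH_def
  proof (rule nn_integral_cong)
    fix s assume s: "s \<in> space I01"
    then have "ennreal (\<bar>C * f s\<bar> / J s) = ennreal C * ennreal (\<bar>f s\<bar> / J s)"
      using assms J_pos[of s] by (simp add: abs_mult flip: ennreal_mult)
    then show "indicator {t..} s * (ennreal (\<bar>C * f s\<bar> / J s) * KK t s ^ p) =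
        ennreal C * (indicator {t..} s * (ennreal (\<bar>f s\<bar> / J s) * KK t s ^ p))"
      by (simp add: mult_ac)
  qed
  also have "\<dots> = ennreal C * HH p f t"
    unfolding HH_def by (intro nn_integral_cmult) measurable
  finally show ?thesis .
qed

lemma HH_zero: "a \<le> t \<Longrightarrow> HH p (\<lambda>s. indicator {0<..<a} s * f s) t = 0"
  unfolding HH_def by (rule trans[OF nn_integral_cong[of _ _ "\<lambda>_. 0"]]) (auto simp: indicator_def)

lemma HH_trunc: "b \<le> t \<Longrightarrow> HH p (\<lambda>s. indicator {b..} s * f s) t = HH p f t"
  unfolding HH_def by (intro nn_integral_cong) (auto simp: indicator_def)

text \<open>Since \<open>KK t s = KK t b + KK b s\<close> for \<open>s \<ge> b\<close>, the part of
  \<open>f\<close> on [b,1) influences the image to the left of \<open>b\<close> only through the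
  p+1 numbers \<open>HH k f b\<close>. This finite-dimensionality is what makes compactness near 0
  accessible.\<close>

lemma HH_binomial:
  assumes [measurable]: "f \<in> borel_measurable I01" and "t \<le> b"
  shows "HH p (\<lambda>s. indicator {b..} s * f s) t = (\<Sum>k\<le>p. of_nat (p choose k) * KK t b ^ (p - k) * HH k f b)"
proof -
  have "HH p (\<lambda>s. indicator {b..} s * f s) t =
    (\<integral>\<^sup>+ s. (\<Sum>k\<le>p. of_nat (p choose k) * KK t b ^ (p - k) * (indicator {b..} s * (ennreal (\<bar>f s\<bar> / J s) * KK b s ^ k))) \<partial>I01)"
    unfolding HH_def
  proof (rule nn_integral_cong)
    fix s
    show "indicator {t..} s * (ennreal (\<bar>indicator {b..} s * f s\<bar> / J s) * KK t s ^ p) =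
      (\<Sum>k\<le>p. of_nat (p choose k) * KK t b ^ (p - k) * (indicator {b..} s * (ennreal (\<bar>f s\<bar> / J s) * KK b s ^ k)))"
    proof (cases "b \<le> s")
      case True
      have "KK t s ^ p = (KK b s + KK t b) ^ p" using KK_split[OF assms(2) True] by (simp add: add.commute)
      also have "\<dots> = (\<Sum>k\<le>p. of_nat (p choose k) * KK b s ^ k * KK t b ^ (p - k))" by (rule binomial_ring)
      finally show ?thesis using True assms(2) by (simp add: sum_distrib_left mult_ac)
    qed auto
  qed
  also have "\<dots> = (\<Sum>k\<le>p. of_nat (p choose k) * KK t b ^ (p - k) * HH k f b)"
    unfolding HH_def
    by (subst nn_integral_sum, measurable) (intro sum.cong refl nn_integral_cmult, measurable)
  finally show ?thesis .
qed

text \<open>For \<open>p \<ge> 1\<close> the kernel vanishes on the diagonal, so moving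
  \<open>t\<close> to \<open>t'\<close> creates no jump. The inner integral changes by at most
  \<open>(t' - t) / (c * a)\<close>, and \<open>2 / (c * a)\<close> bounds both values in the mean
  value estimate, as \<open>t' - t \<le> 1\<close>.\<close>

lemma HH_lipschitz:
  assumes [measurable]: "f \<in> borel_measurable I01" and "0 < a" "a \<le> t" "t \<le> t'" "t' \<le> 1" "1 \<le> p"
  shows "HH p f t \<le> HH p f t' + ennreal (real p * (2 / (c * a)) ^ (p - 1) / (c * a) ^ 2 * (t' - t)) * (\<integral>\<^sup>+ s. ennreal \<bar>f s\<bar> \<partial>I01)"
proof -
  let ?d = "ennreal ((t' - t) / (c * a))" and ?L = "ennreal (2 / (c * a))"
  let ?M = "of_nat p * ?d * ?L ^ (p - 1) * ennreal (1 / (c * a))"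
  have pos: "0 < c * a" using c_pos assms by simp
  have "HH p f t \<le> (\<integral>\<^sup>+ s. indicator {t'..} s * (ennreal (\<bar>f s\<bar> / J s) * KK t' s ^ p) + ?M * ennreal \<bar>f s\<bar> \<partial>I01)"
    unfolding HH_def
  proof (rule nn_integral_mono)
    fix s assume s: "s \<in> space I01"
    let ?e = "ennreal (\<bar>f s\<bar> / J s)"
    show "indicator {t..} s * (?e * KK t s ^ p) \<le> indicator {t'..} s * (?e * KK t' s ^ p) + ?M * ennreal \<bar>f s\<bar>"
    proof (cases "t \<le> s")
      case True
      have K: "KK t s \<le> KK t' s + ?d"
      proof (cases "t' \<le> s")
        case True
        then show ?thesis using KK_split[OF assms(4) True] KK_le_diff[of a t t'] assms
          by (simp add: add.commute add_mono)
      next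
        case False
        then have "KK t s \<le> KK t t'" by (intro KK_mono) auto
        also have "\<dots> \<le> ?d" using assms by (intro KK_le_diff) auto
        finally show ?thesis by (simp add: add_increasing)
      qed
      have "KK t' s + ?d \<le> ennreal (1 / (c * a)) + ennreal (1 / (c * a))"
        using assms pos by (intro add_mono KK_le ennreal_leI divide_right_mono) auto
      also have "\<dots> = ?L" using pos by (subst ennreal_plus[symmetric]) (auto simp: mult.commute)
      finally have L: "KK t' s + ?d \<le> ?L" .
      have "KK t s ^ p \<le> (KK t' s + ?d) ^ p" by (intro power_mono K) auto
      also have "\<dots> \<le> KK t' s ^ p + of_nat p * ?d * ?L ^ (p - 1)" by (rule power_add_le_ennreal[OF L])
      finally have "?e * KK t s ^ p \<le> ?e * KK t' s ^ p + (of_nat p * ?d * ?L ^ (p - 1)) * ?e"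
        by (subst mult.commute[of _ ?e], subst distrib_left[symmetric]) (intro mult_left_mono, auto)
      also have "\<dots> \<le> ?e * KK t' s ^ p + (of_nat p * ?d * ?L ^ (p - 1)) * (ennreal (1 / (c * a)) * ennreal \<bar>f s\<bar>)"
        using assms True s by (intro add_mono mult_left_mono abs_div_J_le) auto
      \<comment> \<open>Here \<open>p \<ge> 1\<close> matters: for \<open>s < t'\<close> the inner
        integral is 0, and \<open>0 ^ p\<close> has to vanish.\<close>
      also have "?e * KK t' s ^ p = indicator {t'..} s * (?e * KK t' s ^ p)"
        using assms(6) by (cases "t' \<le> s") (auto simp: KK_empty)
      finally show ?thesis using True by (simp add: mult_ac)
    qed auto
  qed
  also have "\<dots> = HH p f t' + ?M * (\<integral>\<^sup>+ s. ennreal \<bar>f s\<bar> \<partial>I01)"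
    unfolding HH_def by (subst nn_integral_add, measurable, subst nn_integral_cmult) auto
  also have "?M = ennreal (real p * ((t' - t) / (c * a)) * (2 / (c * a)) ^ (p - 1) * (1 / (c * a)))"
    using pos assms
    by (simp add: ennreal_power ennreal_of_nat_eq_real_of_nat del: times_divide_eq_right times_divide_eq_left flip: ennreal_mult)
  also have "real p * ((t' - t) / (c * a)) * (2 / (c * a)) ^ (p - 1) * (1 / (c * a)) = real p * (2 / (c * a)) ^ (p - 1) / (c * a) ^ 2 * (t' - t)"
    by (simp add: power2_eq_square)
  finally show ?thesis .
qed

text \<open>For \<open>p = 0\<close> the kernel jumps at the diagonal, so the increment is only
  controlled by the mass of \<open>f\<close> on \<open>{t..<t'}\<close>; uniform smallness of that
  mass needs information on X.\<close>

lemma HH_0_increment: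
  assumes [measurable]: "f \<in> borel_measurable I01" and "0 < a" "a \<le> t" "t \<le> t'"
  shows "HH 0 f t \<le> HH 0 f t' + ennreal (1 / (c * a)) * (\<integral>\<^sup>+ s. ennreal (\<bar>f s\<bar> * indicator {t..<t'} s) \<partial>I01)"
proof -
  have "HH 0 f t \<le> (\<integral>\<^sup>+ s. indicator {t'..} s * (ennreal (\<bar>f s\<bar> / J s) * KK t' s ^ 0) +
      ennreal (1 / (c * a)) * ennreal (\<bar>f s\<bar> * indicator {t..<t'} s) \<partial>I01)"
    unfolding HH_def
    using assms by (intro nn_integral_mono) (auto simp: indicator_def intro!: abs_div_J_le)
  also have "\<dots> = HH 0 f t' + ennreal (1 / (c * a)) * (\<integral>\<^sup>+ s. ennreal (\<bar>f s\<bar> * indicator {t..<t'} s) \<partial>I01)"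
    unfolding HH_def by (subst nn_integral_add, measurable, subst nn_integral_cmult) auto
  finally show ?thesis .
qed

end

section \<open>Monotone sequences and pointwise bounds\<close>


text \<open>Monotonicity reduces uniform control to a finite grid. If t lies between neighbouring
  grid points q and q', then F n t \<le> F n q \<le> F n q' + e \<le> F m q' + 2e \<le> F m t +
  2e.\<close>

lemma antimono_uniform_Cauchy:
  fixes F :: "nat \<Rightarrow> real \<Rightarrow> real"
  assumes anti: "\<And>n t t'. 0 < t \<Longrightarrow> t \<le> t' \<Longrightarrow> t' \<le> 1 \<Longrightarrow> F n t' \<le> F n t"
    and conv: "\<And>q. q \<in> \<rat> \<Longrightarrow> 0 < q \<Longrightarrow> q \<le> 1 \<Longrightarrow> convergent (\<lambda>n. F n q)"
    and b: "b \<in> \<rat>" "0 < b" "b < 1" and d: "0 < d"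
    and eq: "\<And>n t t'. b \<le> t \<Longrightarrow> t \<le> t' \<Longrightarrow> t' \<le> 1 \<Longrightarrow> t' - t \<le> d \<Longrightarrow> F n t \<le> F n t' + e"
    and e: "0 < e"
  shows "\<exists>M. \<forall>n\<ge>M. \<forall>m\<ge>M. \<forall>t. b \<le> t \<longrightarrow> t < 1 \<longrightarrow> \<bar>F n t - F m t\<bar> \<le> 2 * e"
proof -
  obtain K :: nat where K: "(1 - b) / d < real K" using reals_Archimedean2 by blast
  have "0 < (1 - b) / d" using b d by simp
  then have K0: "0 < real K" using K by linarith
  have Kd: "(1 - b) / K \<le> d" using K d K0 by (simp add: field_simps)
  \<comment> \<open>The grid has mesh at most \<open>d\<close> and stays rational because
    \<open>b\<close> is; convergence is known at rational points only.\<close>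
  define q where "q i = b + real i * (1 - b) / K" for i
  have qQ: "q i \<in> \<rat>" for i unfolding q_def using b by (intro Rats_add Rats_divide Rats_mult Rats_diff) auto
  have qb: "b \<le> q i" for i unfolding q_def using b by simp
  have q1: "q i \<le> 1" if "i \<le> K" for i
  proof -
    have "real i * (1 - b) \<le> real K * (1 - b)" using that b by (intro mult_right_mono) auto
    then show ?thesis unfolding q_def using K0 by (simp add: field_simps)
  qed
  have "\<exists>M. \<forall>n\<ge>M. \<forall>m\<ge>M. \<bar>F n (q i) - F m (q i)\<bar> < e" if "i \<le> K" for i
  proof -
    have "convergent (\<lambda>n. F n (q i))" using qQ qb[of i] q1[OF that] b by (intro conv) auto
    then have "Cauchy (\<lambda>n. F n (q i))" by (rule convergent_Cauchy)
    then show ?thesis using e unfolding Cauchy_def dist_real_def by blast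
  qed
  then obtain M where M: "\<And>i n m. i \<le> K \<Longrightarrow> n \<ge> M i \<Longrightarrow> m \<ge> M i \<Longrightarrow> \<bar>F n (q i) - F m (q i)\<bar> < e"
    by metis
  define M' where "M' = Max (M ` {..K})"
  have M': "M i \<le> M'" if "i \<le> K" for i unfolding M'_def using that by (intro Max_ge) auto
  have one: "F n t \<le> F m t + 2 * e" if nm: "n \<ge> M'" "m \<ge> M'" and t: "b \<le> t" "t < 1" for n m t
  proof -
    define i where "i = nat \<lfloor>(t - b) * K / (1 - b)\<rfloor>"
    have nn: "0 \<le> (t - b) * K / (1 - b)" using t b by simp
    have i: "real i \<le> (t - b) * K / (1 - b)" "(t - b) * K / (1 - b) < real i + 1"
      using nn unfolding i_def by linarith+
    have "(t - b) * K / (1 - b) < K" using t b K0 by (simp add: field_simps)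
    then have iK: "Suc i \<le> K" using i by linarith
    have qi: "q i \<le> t" "t \<le> q (Suc i)"
      using i b K0 unfolding q_def by (simp_all add: field_simps)
    have step: "q (Suc i) - q i \<le> d" using Kd unfolding q_def by (simp add: add_divide_distrib distrib_right)
    have "F n t \<le> F n (q i)" using qi qb[of i] b t by (intro anti) auto
    also have "\<dots> \<le> F n (q (Suc i)) + e" using qb[of i] qi q1[OF iK] step by (intro eq) auto
    also have "F n (q (Suc i)) \<le> F m (q (Suc i)) + e"
      using M[OF iK, of n m] M'[OF iK] nm by (auto simp: abs_less_iff)
    also have "F m (q (Suc i)) \<le> F m t" using qi q1[OF iK] t b by (intro anti) auto
    finally show ?thesis by simp
  qed
  have "\<bar>F n t - F m t\<bar> \<le> 2 * e" if "n \<ge> M'" "m \<ge> M'" "b \<le> t" "t < 1" for n m t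
    using one[OF that] one[OF that(2,1,3,4)] by (auto simp: abs_le_iff)
  then show ?thesis by blast
qed

lemma antimono_on_measurable_I01:
  fixes g :: "real \<Rightarrow> real"
  assumes "\<And>t t'. 0 < t \<Longrightarrow> t \<le> t' \<Longrightarrow> t' < 1 \<Longrightarrow> g t' \<le> g t"
  shows "g \<in> borel_measurable I01"
proof -
  have "(\<lambda>t. - g t) \<in> borel_measurable (restrict_space borel {0<..<1})"
    using assms by (intro borel_measurable_mono_on_fnc) (auto simp: mono_on_def)
  moreover have "(\<lambda>t. t) \<in> I01 \<rightarrow>\<^sub>M restrict_space borel {0<..<1::real}"
    by (rule measurable_restrict_space3) (auto intro!: measurable_completion)
  ultimately have "(\<lambda>t. - g t) \<in> borel_measurable I01" by (rule measurable_compose[rotated])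
  then show ?thesis using borel_measurable_uminus_eq by blast
qed

text \<open>Helly's argument: convergence at the rationals forces convergence at every continuity
  point of the monotone limit, and a monotone function has countably many discontinuities.\<close>

lemma antimono_convergence_AE:
  fixes F :: "nat \<Rightarrow> real \<Rightarrow> real"
  assumes anti: "\<And>n t t'. 0 < t \<Longrightarrow> t \<le> t' \<Longrightarrow> t' \<le> 1 \<Longrightarrow> F n t' \<le> F n t"
    and nn: "\<And>n t. 0 \<le> F n t"
    and conv: "\<And>q. q \<in> \<rat> \<Longrightarrow> 0 < q \<Longrightarrow> q \<le> 1 \<Longrightarrow> convergent (\<lambda>n. F n q)"
  shows "\<exists>g. g \<in> borel_measurable I01 \<and> (AE t in I01. (\<lambda>n. F n t) \<longlonglongrightarrow> g t)"
proof -
  define L where "L q = lim (\<lambda>n. F n q)" for q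
  have L: "(\<lambda>n. F n q) \<longlonglongrightarrow> L q" if "q \<in> \<rat>" "0 < q" "q \<le> 1" for q
    using conv[OF that] unfolding L_def by (simp add: convergent_LIMSEQ_iff)
  have L0: "0 \<le> L q" if "q \<in> \<rat>" "0 < q" "q \<le> 1" for q
    using L[OF that] nn by (intro LIMSEQ_le_const) auto
  \<comment> \<open>An infimum over the rationals to the left of \<open>t\<close> is nonincreasing
    in \<open>t\<close> merely by inclusion of the index sets.\<close>
  define g where "g t = Inf (L ` {q \<in> \<rat>. 0 < q \<and> q < t})" for t
  have ne: "{q \<in> \<rat>. 0 < q \<and> q < t} \<noteq> {}" if "0 < t" for t :: real
    using Rats_dense_in_real[OF that] by auto
  have bdd: "bdd_below (L ` {q \<in> \<rat>. 0 < q \<and> q < t})" if "t \<le> 1" for t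
    using that by (intro bdd_belowI[of _ 0]) (auto intro: L0)
  have g_anti: "g t' \<le> g t" if "0 < t" "t \<le> t'" "t' < 1" for t t'
    unfolding g_def using that ne[of t] bdd[of t'] by (intro cInf_superset_mono) auto
  have gm: "g \<in> borel_measurable I01" by (rule antimono_on_measurable_I01) (rule g_anti)
  let ?D = "{a \<in> {0<..<1}. \<not> continuous (at a within {0<..<1}) (\<lambda>t. - g t)}"
  have "countable ?D"
    using g_anti by (intro mono_on_ctble_discont) (auto simp: mono_on_def)
  then have "?D \<in> null_sets lebesgue"
    by (intro null_sets_completionI countable_imp_null_set_lborel)
  then have "AE t in lebesgue. t \<notin> ?D" by (rule AE_not_in)
  then have "AE t in I01. t \<notin> ?D" by (subst AE_restrict_space_iff) (auto elim!: eventually_mono)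
  moreover have "AE t in I01. t \<in> {0<..<1}" by (rule AE_I2) simp
  ultimately have "AE t in I01. (\<lambda>n. F n t) \<longlonglongrightarrow> g t"
  proof eventually_elim
    case (elim t)
    then have t: "0 < t" "t < 1" and "continuous (at t within {0<..<1}) (\<lambda>t. - g t)" by auto
    then have cont: "isCont g t"
      using continuous_minus[of "at t within {0<..<1}" "\<lambda>t. - g t"]
      by (simp add: at_within_open[of t "{0<..<1}"])
    show ?case
    proof (rule LIMSEQ_I)
      fix e :: real assume e: "0 < e"
      have "g t < g t + e / 2" using e by simp
      then obtain x where x: "x \<in> L ` {q \<in> \<rat>. 0 < q \<and> q < t}" "x < g t + e / 2"
        using cInf_lessD[of "L ` {q \<in> \<rat>. 0 < q \<and> q < t}" "g t + e / 2"] ne[OF t(1)] unfolding g_def by blast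
      then obtain q where q: "q \<in> \<rat>" "0 < q" "q < t" "L q < g t + e / 2" by auto
      obtain d where d: "0 < d" "\<And>u. \<bar>u - t\<bar> < d \<Longrightarrow> \<bar>g u - g t\<bar> < e / 2"
        using cont e unfolding continuous_at_eps_delta dist_real_def by (metis half_gt_zero)
      \<comment> \<open>Every rational \<open>q'\<close> in (t,u) satisfies
        \<open>g u \<le> L q'\<close>, and continuity puts \<open>g u\<close> within
        \<open>e / 2\<close> of \<open>g t\<close>; this gives the lower bound. The second argument
        of the minimum keeps \<open>u\<close> below 1.\<close>
      define u where "u = min (t + d / 2) ((t + 1) / 2)"
      have u: "t < u" "u < 1" "\<bar>u - t\<bar> < d" using t d unfolding u_def by (auto simp: min_def)
      obtain q' where q': "q' \<in> \<rat>" "t < q'" "q' < u" using Rats_dense_in_real[OF u(1)] by auto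
      have "g u \<le> L q'" unfolding g_def using q' u t bdd[of u] by (intro cInf_lower) auto
      then have Lq': "g t - e / 2 < L q'" using d(2)[OF u(3)] by linarith
      have "\<forall>\<^sub>F n in sequentially. F n q < g t + e / 2"
        using q t by (intro order_tendstoD(2)[OF L]) auto
      moreover have "\<forall>\<^sub>F n in sequentially. g t - e / 2 < F n q'"
        using q' u t Lq' by (intro order_tendstoD(1)[OF L]) auto
      ultimately have "\<forall>\<^sub>F n in sequentially. norm (F n t - g t) < e"
      proof eventually_elim
        case (elim n)
        have "F n t \<le> F n q" "F n q' \<le> F n t" using q q' u t by (auto intro!: anti)
        then show ?case using elim e by (auto simp: abs_less_iff)
      qed
      then show "\<exists>no. \<forall>n\<ge>no. norm (F n t - g t) < e" by (simp add: eventually_sequentially)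
    qed
  qed
  then show ?thesis using gm by blast
qed

lemma diagonal_subsequence:
  fixes f :: "nat \<Rightarrow> 'a \<Rightarrow> real"
  assumes "countable S" and B: "\<And>n x. x \<in> S \<Longrightarrow> \<bar>f n x\<bar> \<le> B x"
  shows "\<exists>r::nat \<Rightarrow> nat. strict_mono r \<and> (\<forall>x\<in>S. convergent (\<lambda>n. f (r n) x))"
proof -
  have B0: "0 \<le> B x" if "x \<in> S" for x using B[OF that, of 0] by linarith
  \<comment> \<open>Normalising turns the bounds depending on \<open>x\<close> into a common one;
    adding 1 avoids a zero denominator.\<close>
  have "norm (f n x / (B x + 1)) \<le> 1" if "x \<in> S" for n x
    using B[OF that, of n] B0[OF that] by (simp add: abs_divide field_simps)
  then obtain r where r: "strict_mono (r::nat\<Rightarrow>nat)" "\<And>x. x \<in> S \<Longrightarrow> \<exists>l. (\<lambda>n. f (r n) x / (B x + 1)) \<longlonglongrightarrow> l"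
    using function_convergent_subsequence[OF assms(1), of "\<lambda>n x. f n x / (B x + 1)" 1] by metis
  have "convergent (\<lambda>n. f (r n) x)" if x: "x \<in> S" for x
  proof -
    obtain l where "(\<lambda>n. f (r n) x / (B x + 1)) \<longlonglongrightarrow> l" using r(2)[OF x] by blast
    then have "(\<lambda>n. f (r n) x / (B x + 1) * (B x + 1)) \<longlonglongrightarrow> l * (B x + 1)" by (intro tendsto_intros)
    moreover have "B x + 1 \<noteq> 0" using B0[OF x] by linarith
    ultimately show ?thesis by (auto simp: convergent_def)
  qed
  then show ?thesis using r(1) by blast
qed

section \<open>Pointwise decomposition of the images at a point b\<close>

context hardy begin

definition G :: "nat \<Rightarrow> (real \<Rightarrow> real) \<Rightarrow> real \<Rightarrow> real" where
  "G p f t = enn2real (HH p f t)"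

lemma G_nonneg: "0 \<le> G p f t" by (simp add: G_def)

lemma HH_eq_G:
  assumes "f \<in> L1_space" "0 < t" shows "HH p f t = ennreal (G p f t)"
proof -
  have f: "f \<in> borel_measurable I01" "(\<integral>\<^sup>+ s. ennreal \<bar>f s\<bar> \<partial>I01) < \<infinity>"
    using assms by (auto simp: L1_space_def integrable_iff_bounded)
  have "ennreal (1 / (c * t)) ^ Suc p < \<infinity>"
    using c_pos assms(2) by (subst ennreal_power) auto
  then have "HH p f t < \<infinity>"
    by (intro order_le_less_trans[OF HH_le[OF f(1) assms(2)]])
       (use f in \<open>auto simp: ennreal_mult_less_top simp del: power_Suc\<close>)
  then show ?thesis by (simp add: G_def)
qed

lemma G_meas [measurable]: "G p f \<in> borel_measurable I01"
  unfolding G_def by measurable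

lemma G_nonneg_meas: "nonneg_meas (G p f)"
  by (simp add: nonneg_meas_def G_nonneg)

lemma Hop_eq_ennreal_G:
  assumes "f \<in> L1_space" "0 < t"
  shows "Hop (Suc p) J f t = ennreal (G p f t / fact p)"
  using assms by (simp add: Hop_eq HH_eq_G divide_ennreal G_nonneg)

lemma G_antimono: "f \<in> L1_space \<Longrightarrow> 0 < t \<Longrightarrow> t \<le> t' \<Longrightarrow> G p f t' \<le> G p f t"
  using HH_antimono[of t t' p f] HH_eq_G[of f t p] HH_eq_G[of f t' p] G_nonneg
  by (metis ennreal_le_iff order_less_le_trans)

lemma L1_indicator:
  assumes "f \<in> L1_space" "A \<in> sets borel"
  shows "(\<lambda>t. indicator A t * f t) \<in> L1_space"
proof -
  have f: "f \<in> borel_measurable I01" "integrable I01 f" using assms by (auto simp: L1_space_def)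
  have "(\<lambda>t. indicator A t * f t) \<in> borel_measurable I01" using f assms(2) by (intro borel_measurable_times indicator_I01)
  moreover from this have "integrable I01 (\<lambda>t. indicator A t * f t)"
    by (rule Bochner_Integration.integrable_bound[OF f(2)]) (auto simp: indicator_def)
  ultimately show ?thesis by (simp add: L1_space_def)
qed

lemma G_split:
  assumes "f \<in> L1_space" "0 < t"
  shows "G p f t = G p (\<lambda>s. indicator {0<..<a} s * f s) t + G p (\<lambda>s. indicator {a..} s * f s) t"
proof -
  have "ennreal (G p f t) = ennreal (G p (\<lambda>s. indicator {0<..<a} s * f s) t + G p (\<lambda>s. indicator {a..} s * f s) t)"
    using assms HH_add[of f p t a] L1_indicator[OF assms(1)]
    by (simp add: L1_space_def G_nonneg flip: HH_eq_G)
  then show ?thesis using G_nonneg by (subst (asm) ennreal_inj) (auto intro: add_nonneg_nonneg)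
qed

definition kr :: "real \<Rightarrow> real \<Rightarrow> real" where "kr t b = enn2real (KK t b)"

lemma KK_eq_kr: "0 < t \<Longrightarrow> KK t b = ennreal (kr t b)"
  using KK_finite[of t b] by (simp add: kr_def)

lemma kr_nonneg: "0 \<le> kr t b" by (simp add: kr_def)

lemma G_binomial:
  assumes "f \<in> L1_space" "0 < t" "t \<le> b"
  shows "G p (\<lambda>s. indicator {b..} s * f s) t = (\<Sum>k\<le>p. (p choose k) * kr t b ^ (p - k) * G k f b)"
proof -
  have "ennreal (G p (\<lambda>s. indicator {b..} s * f s) t) = (\<Sum>k\<le>p. of_nat (p choose k) * KK t b ^ (p - k) * HH k f b)"
    using assms HH_binomial[of f t b p] L1_indicator[OF assms(1)]
    by (simp add: L1_space_def flip: HH_eq_G)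
  also have "\<dots> = (\<Sum>k\<le>p. ennreal ((p choose k) * kr t b ^ (p - k) * G k f b))"
    using assms by (intro sum.cong refl)
      (simp add: KK_eq_kr HH_eq_G ennreal_mult ennreal_power G_nonneg kr_nonneg ennreal_of_nat_eq_real_of_nat)
  also have "\<dots> = ennreal (\<Sum>k\<le>p. (p choose k) * kr t b ^ (p - k) * G k f b)"
    by (intro sum_ennreal) (auto intro!: mult_nonneg_nonneg G_nonneg zero_le_power kr_nonneg)
  finally show ?thesis
    by (subst (asm) ennreal_inj) (auto intro!: G_nonneg sum_nonneg mult_nonneg_nonneg zero_le_power kr_nonneg)
qed

text \<open>Absorbs all powers of the weight that occur in the binomial formula into the single
  function \<open>1 + x ^ p\<close>.\<close>

lemma power_le_one_plus: "(x::real) \<ge> 0 \<Longrightarrow> k \<le> p \<Longrightarrow> x ^ k \<le> 1 + x ^ p"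
proof (cases "x \<le> 1")
  case True
  then show "x \<ge> 0 \<Longrightarrow> ?thesis" using power_le_one[of x k] zero_le_power[of x p] by linarith
next
  case False
  then show "k \<le> p \<Longrightarrow> ?thesis" using power_increasing[of k p x] by linarith
qed

text \<open>Separates the sources of the difference: two tails, a finite-dimensional part with
  coefficients evaluated at \<open>b\<close>, and the behaviour on [b,1). Each is later made small
  by a different mechanism.\<close>

lemma G_diff_bound:
  assumes f: "f \<in> L1_space" and h: "h \<in> L1_space" and t: "0 < t" and b: "0 < b"
  shows "\<bar>G p f t - G p h t\<bar> \<le> G p (\<lambda>s. indicator {0<..<b} s * f s) t + G p (\<lambda>s. indicator {0<..<b} s * h s) t
     + (\<Sum>k\<le>p. (p choose k) * \<bar>G k f b - G k h b\<bar>) * (1 + kr t b ^ p)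
     + indicator {b..} t * \<bar>G p f t - G p h t\<bar>"
proof (cases "b \<le> t")
  case True
  then show ?thesis
    by (simp add: G_nonneg kr_nonneg sum_nonneg)
next
  case False
  let ?f = "\<lambda>s. indicator {b..} s * f s" and ?h = "\<lambda>s. indicator {b..} s * h s"
  have "\<bar>G p ?f t - G p ?h t\<bar> = \<bar>\<Sum>k\<le>p. (p choose k) * kr t b ^ (p - k) * (G k f b - G k h b)\<bar>"
    using False f h t by (simp add: G_binomial sum_subtractf right_diff_distrib)
  also have "\<dots> \<le> (\<Sum>k\<le>p. \<bar>(p choose k) * kr t b ^ (p - k) * (G k f b - G k h b)\<bar>)" by (rule sum_abs)
  also have "\<dots> \<le> (\<Sum>k\<le>p. (p choose k) * \<bar>G k f b - G k h b\<bar> * (1 + kr t b ^ p))"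
  proof (rule sum_mono)
    fix k assume "k \<in> {..p}"
    have "\<bar>(p choose k) * kr t b ^ (p - k) * (G k f b - G k h b)\<bar> = (p choose k) * \<bar>G k f b - G k h b\<bar> * kr t b ^ (p - k)"
      using kr_nonneg by (simp add: abs_mult)
    also have "\<dots> \<le> (p choose k) * \<bar>G k f b - G k h b\<bar> * (1 + kr t b ^ p)"
      by (intro mult_left_mono power_le_one_plus kr_nonneg) auto
    finally show "\<bar>(p choose k) * kr t b ^ (p - k) * (G k f b - G k h b)\<bar> \<le> (p choose k) * \<bar>G k f b - G k h b\<bar> * (1 + kr t b ^ p)" .
  qed
  also have "\<dots> = (\<Sum>k\<le>p. (p choose k) * \<bar>G k f b - G k h b\<bar>) * (1 + kr t b ^ p)" by (simp add: sum_distrib_right)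
  finally show ?thesis
    using G_split[OF f t, of p b] G_split[OF h t, of p b] False
      G_nonneg[of p "\<lambda>s. indicator {0<..<b} s * f s" t] G_nonneg[of p "\<lambda>s. indicator {0<..<b} s * h s" t]
    by simp
qed

text \<open>The same splitting for one function. To the right of \<open>b\<close> no extra term is
  needed, since images are nonincreasing and the value at \<open>b\<close> is already
  counted.\<close>

lemma G_bound:
  assumes f: "f \<in> L1_space" and t: "0 < t" and b: "0 < b"
  shows "G p f t \<le> G p (\<lambda>s. indicator {0<..<b} s * f s) t + (\<Sum>k\<le>p. (p choose k) * G k f b) * (1 + kr t b ^ p)"
proof -
  have le: "G p (\<lambda>s. indicator {b..} s * f s) u \<le> (\<Sum>k\<le>p. (p choose k) * G k f b) * (1 + kr u b ^ p)"
    if "0 < u" "u \<le> b" for u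
    unfolding G_binomial[OF f that] sum_distrib_right
  proof (rule sum_mono)
    fix k assume "k \<in> {..p}"
    show "(p choose k) * kr u b ^ (p - k) * G k f b \<le> (p choose k) * G k f b * (1 + kr u b ^ p)"
      using mult_left_mono[OF power_le_one_plus[OF kr_nonneg[of u b], of "p - k" p], of "(p choose k) * G k f b"]
      by (simp add: G_nonneg mult_ac)
  qed
  have "G p (\<lambda>s. indicator {b..} s * f s) t \<le> (\<Sum>k\<le>p. (p choose k) * G k f b) * (1 + kr t b ^ p)"
  proof (cases "t \<le> b")
    case True then show ?thesis using le t by blast
  next
    case False
    have "G p (\<lambda>s. indicator {b..} s * f s) t \<le> G p (\<lambda>s. indicator {b..} s * f s) b"
      using False b by (intro G_antimono L1_indicator f) auto
    also have "\<dots> \<le> (\<Sum>k\<le>p. (p choose k) * G k f b)"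
      unfolding G_binomial[OF f b order_refl]
    proof (rule sum_mono)
      fix k assume "k \<in> {..p}"
      \<comment> \<open>So \<open>kr b b ^ (p - k)\<close> is 1 for \<open>k = p\<close> and 0
        otherwise.\<close>
      have "kr b b = 0" using KK_le_diff[of b b b] b by (simp add: kr_def)
      then have "kr b b ^ (p - k) \<le> 1" by (cases "p - k") auto
      then show "(p choose k) * kr b b ^ (p - k) * G k f b \<le> (p choose k) * G k f b"
        using mult_left_mono[of "kr b b ^ (p - k)" 1 "(p choose k) * G k f b"] by (simp add: G_nonneg mult_ac)
    qed
    also have "\<dots> \<le> (\<Sum>k\<le>p. (p choose k) * G k f b) * (1 + kr t b ^ p)"
      using mult_left_mono[of 1 "1 + kr t b ^ p" "\<Sum>k\<le>p. (p choose k) * G k f b"]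
      by (simp add: kr_nonneg sum_nonneg G_nonneg)
    finally show ?thesis .
  qed
  then show ?thesis using G_split[OF f t, of p b] by simp
qed

text \<open>For \<open>t \<le> b\<close> and \<open>s\<close> between \<open>b\<close> and
  \<open>a\<close> the inner integral up to \<open>s\<close> dominates the one up to
  \<open>b\<close>. Integrating 1/J over that gap bounds \<open>kr t b ^ p * kr b a\<close> by the
  image of the characteristic function of (0,a).\<close>

lemma kr_power_bound:
  assumes t: "0 < t" "t < 1" and ba: "0 < b" "b < a" "a < 1"
  shows "kr t b ^ p \<le> 1 + G p (indicator {0<..<a}) t / kr b a"
proof -
  have ind: "(indicator {0<..<a} :: real \<Rightarrow> real) \<in> L1_space"
    using L1_indicator[of "\<lambda>_. 1" "{0<..<a}"] by (simp add: L1_space_def)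
  have krp: "0 < kr b a" using KK_pos[OF ba] KK_eq_kr[of b a] ba kr_nonneg[of b a] by (auto simp: order_less_le)
  show ?thesis
  proof (cases "t \<le> b")
    case True
    have "KK t b ^ p * KK b a = (\<integral>\<^sup>+ s. KK t b ^ p * (indicator {b..a} s * ennreal (1 / J s)) \<partial>I01)"
      unfolding KK_def[of b a] by (intro nn_integral_cmult[symmetric]) measurable
    also have "\<dots> \<le> HH p (indicator {0<..<a}) t"
      unfolding HH_def
    proof (rule nn_integral_mono_AE)
      show "AE s in I01. KK t b ^ p * (indicator {b..a} s * ennreal (1 / J s)) \<le>
        indicator {t..} s * (ennreal (\<bar>indicator {0<..<a} s\<bar> / J s) * KK t s ^ p)"
        using AE_I01_neq[of a]
      proof eventually_elim
        case (elim s)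
        show ?case
        proof (cases "s \<in> {b..a}")
          case True
          then have "KK t b ^ p * ennreal (1 / J s) \<le> KK t s ^ p * ennreal (1 / J s)"
            by (intro mult_right_mono power_mono KK_mono) auto
          then show ?thesis using True \<open>t \<le> b\<close> elim ba by (simp add: indicator_def mult_ac)
        qed auto
      qed
    qed
    finally have "ennreal (kr t b ^ p * kr b a) \<le> ennreal (G p (indicator {0<..<a}) t)"
      using t ba by (simp add: KK_eq_kr HH_eq_G[OF ind] ennreal_power kr_nonneg flip: ennreal_mult)
    then have "kr t b ^ p * kr b a \<le> G p (indicator {0<..<a}) t" by (simp add: G_nonneg)
    then have "kr t b ^ p \<le> G p (indicator {0<..<a}) t / kr b a" using krp by (simp add: field_simps)
    then show ?thesis by simp
  next
    case False
    \<comment> \<open>Beyond \<open>b\<close> the power is 0, or 1 if \<open>p = 0\<close>; the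
      summand 1 in the bound covers this.\<close>
    then have "kr t b = 0" by (simp add: kr_def KK_empty)
    then have "kr t b ^ p \<le> 1" by (cases p) auto
    moreover have "0 \<le> G p (indicator {0<..<a}) t / kr b a" using krp by (simp add: G_nonneg)
    ultimately show ?thesis by linarith
  qed
qed

end

section \<open>Vanishing tails\<close>


locale hardy_ri = hardy J c + X: ri NX + Y: ri NY for J c NX NY
begin

definition tail_norm :: "nat \<Rightarrow> real \<Rightarrow> ennreal" where
  "tail_norm p a = (SUP f\<in>{f. f \<in> borel_measurable I01 \<and> rinorm NX f \<le> 1}.
     ri_norm_ext NY (Hop (Suc p) J (\<lambda>t. indicator {0<..<a} t * f t)))"

lemma L1_of_X: "f \<in> borel_measurable I01 \<Longrightarrow> rinorm NX f \<le> ennreal C \<Longrightarrow> f \<in> L1_space"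
  using X.ri_space_subset_L1 by (auto simp: ri_space_def order_le_less_trans)

lemma enn2real_Hop_AE:
  assumes "f \<in> L1_space"
  shows "AE t in I01. Hop (Suc p) J f t \<noteq> \<infinity>"
    and "AE t in I01. enn2real (Hop (Suc p) J f t) = 1 / fact p * G p f t"
    and "(\<lambda>t. enn2real (Hop (Suc p) J f t)) \<in> borel_measurable I01"
proof -
  show "AE t in I01. Hop (Suc p) J f t \<noteq> \<infinity>"
    using assms by (intro AE_I2) (simp add: Hop_eq_ennreal_G)
  show "AE t in I01. enn2real (Hop (Suc p) J f t) = 1 / fact p * G p f t"
    using assms by (intro AE_I2) (simp add: Hop_eq_ennreal_G G_nonneg)
  have "(\<lambda>t. enn2real (Hop (Suc p) J f t)) \<in> borel_measurable I01 \<longleftrightarrow> (\<lambda>t. 1 / fact p * G p f t) \<in> borel_measurable I01"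
    using assms by (intro measurable_cong) (simp add: Hop_eq_ennreal_G G_nonneg)
  then show "(\<lambda>t. enn2real (Hop (Suc p) J f t)) \<in> borel_measurable I01" by simp
qed

lemma NY_Hop:
  assumes "f \<in> L1_space"
  shows "NY (\<lambda>t. enn2real (Hop (Suc p) J f t)) = ennreal (1 / fact p) * NY (G p f)"
proof -
  have "NY (\<lambda>t. enn2real (Hop (Suc p) J f t)) = NY (\<lambda>t. 1 / fact p * G p f t)"
    using enn2real_Hop_AE[OF assms]
    by (intro Y.cong_AE nonneg_measI) (auto simp: G_nonneg)
  also have "\<dots> = ennreal (1 / fact p) * NY (G p f)" by (intro Y.scale G_nonneg_meas) auto
  finally show ?thesis .
qed

lemma ri_norm_ext_Hop:
  assumes "f \<in> L1_space"
  shows "ri_norm_ext NY (Hop (Suc p) J f) = ennreal (1 / fact p) * NY (G p f)"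
  using enn2real_Hop_AE(1)[OF assms] NY_Hop[OF assms] by (simp add: ri_norm_ext_def)

text \<open>Homogeneity carries the estimate from the unit ball to radius \<open>C\<close>;
  \<open>fact p\<close> restores the factor dropped in \<open>G\<close>.\<close>

lemma tail_bound:
  assumes f[measurable]: "f \<in> borel_measurable I01" and "rinorm NX f \<le> ennreal C" "0 < C"
  shows "NY (G p (\<lambda>t. indicator {0<..<a} t * f t)) \<le> ennreal (fact p * C) * tail_norm p a"
proof -
  define h where "h t = f t / C" for t
  have hm[measurable]: "h \<in> borel_measurable I01" unfolding h_def by measurable
  have "rinorm NX h = NX (\<lambda>t. (1 / C) * \<bar>f t\<bar>)" unfolding rinorm_def h_def using assms by simp
  also have "\<dots> = ennreal (1 / C) * rinorm NX f"
    unfolding rinorm_def using assms by (intro X.scale nonneg_measI) auto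
  also have "\<dots> \<le> ennreal (1 / C) * ennreal C" using assms by (intro mult_left_mono) auto
  also have "\<dots> = 1" using assms by (simp flip: ennreal_mult)
  finally have h1: "rinorm NX h \<le> 1" .
  then have hL: "h \<in> L1_space" using L1_of_X[OF hm, of 1] by simp
  let ?h = "\<lambda>t. indicator {0<..<a} t * h t"
  have hL': "?h \<in> L1_space" by (intro L1_indicator hL) auto
  have hm': "?h \<in> borel_measurable I01" using hL' by (simp add: L1_space_def)
  have eq: "(\<lambda>t. indicator {0<..<a} t * f t) = (\<lambda>t. C * ?h t)" using assms by (auto simp: h_def)
  have "G p (\<lambda>t. indicator {0<..<a} t * f t) t = C * G p ?h t" for t
    unfolding G_def eq HH_scale[OF hm' less_imp_le[OF assms(3)]]
    using assms by (simp add: enn2real_mult)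
  then have "NY (G p (\<lambda>t. indicator {0<..<a} t * f t)) = NY (\<lambda>t. C * G p ?h t)" by presburger
  also have "\<dots> = ennreal C * NY (G p ?h)" using assms by (intro Y.scale G_nonneg_meas) auto
  also have "NY (G p ?h) = ennreal (fact p) * (ennreal (1 / fact p) * NY (G p ?h))"
    by (simp flip: ennreal_mult mult.assoc)
  also have "ennreal (1 / fact p) * NY (G p ?h) \<le> tail_norm p a"
    unfolding tail_norm_def ri_norm_ext_Hop[OF hL', symmetric]
    by (rule SUP_upper) (use h1 hm in auto)
  then have "ennreal C * (ennreal (fact p) * (ennreal (1 / fact p) * NY (G p ?h))) \<le> ennreal C * (ennreal (fact p) * tail_norm p a)"
    by (intro mult_left_mono) auto
  also have "\<dots> = ennreal (fact p * C) * tail_norm p a"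
    using assms by (simp add: ennreal_mult mult_ac)
  finally show ?thesis .
qed

text \<open>Functions supported near \<open>0\<close> have images supported near \<open>0\<close>, so a limit in \<open>Y\<close> must vanish.\<close>
lemma tail_tendsto_of_compact:
  assumes comp: "compact_into (Hop (Suc p) J) NX NY"
  shows "(tail_norm p \<longlongrightarrow> 0) (at_right 0)"
proof (rule tendsto_ennreal_0I, rule ccontr)
  fix e :: real assume e: "0 < e" and neg: "\<not> (\<forall>\<^sub>F a in at_right 0. tail_norm p a \<le> ennreal e)"
  have "\<exists>a. 0 < a \<and> a < 1 / Suc n \<and> ennreal e < tail_norm p a" for n
  proof (rule ccontr)
    assume "\<not> ?thesis"
    then have "\<forall>a>0. a < 1 / Suc n \<longrightarrow> tail_norm p a \<le> ennreal e" by (meson not_le)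
    moreover have "0 < 1 / real (Suc n)" by simp
    ultimately show False using neg unfolding eventually_at_right_field by blast
  qed
  then obtain a where a: "\<And>n. 0 < a n" "\<And>n. a n < 1 / Suc n" "\<And>n. ennreal e < tail_norm p (a n)" by metis
  have "\<exists>f. f \<in> borel_measurable I01 \<and> rinorm NX f \<le> 1 \<and>
      ennreal e < ri_norm_ext NY (Hop (Suc p) J (\<lambda>t. indicator {0<..<a n} t * f t))" for n
    using a(3)[of n] unfolding tail_norm_def less_SUP_iff by blast
  then obtain f where f: "\<And>n. f n \<in> borel_measurable I01" "\<And>n. rinorm NX (f n) \<le> 1"
      "\<And>n. ennreal e < ri_norm_ext NY (Hop (Suc p) J (\<lambda>t. indicator {0<..<a n} t * f n t))" by metis
  define h where "h n t = indicator {0<..<a n} t * f n t" for n t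
  have hm: "h n \<in> borel_measurable I01" for n
    unfolding h_def using f(1) by (intro borel_measurable_times indicator_I01) auto
  have hN: "rinorm NX (h n) \<le> ennreal 1" for n
  proof -
    have "rinorm NX (h n) \<le> rinorm NX (f n)"
      unfolding rinorm_def
    proof (intro X.mono nonneg_measI AE_I2)
      fix t show "\<bar>h n t\<bar> \<le> \<bar>f n t\<bar>" by (simp add: h_def indicator_def)
    qed (use hm f(1) in auto)
    then show ?thesis using f(2)[of n] by simp
  qed
  have hX: "h n \<in> ri_space NX" for n using hm hN[of n] by (auto simp: ri_space_def order_le_less_trans)
  have hL: "h n \<in> L1_space" for n using hX X.ri_space_subset_L1 by blast
  define F where "F n t = enn2real (Hop (Suc p) J (h n) t)" for n t
  have Fm[measurable]: "F n \<in> borel_measurable I01" for n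
    unfolding F_def by (rule enn2real_Hop_AE[OF hL])
  have F0: "0 \<le> F n t" for n t by (simp add: F_def)
  have big: "ennreal e < NY (F n)" for n
    using f(3)[of n] enn2real_Hop_AE(1)[OF hL[of n]] unfolding F_def ri_norm_ext_def h_def by auto
  have Fz: "F n t = 0" if "1 / Suc n \<le> t" for n t
  proof -
    have "0 < t" using that by (meson divide_pos_pos less_le_trans of_nat_0_less_iff zero_less_Suc zero_less_one)
    moreover have "a n \<le> t" using a(2)[of n] that by linarith
    then have "HH p (h n) t = 0" unfolding h_def by (rule HH_zero)
    ultimately show ?thesis by (simp add: F_def Hop_eq)
  qed
  have "\<exists>(r::nat \<Rightarrow> nat) g. strict_mono r \<and> g \<in> ri_space NY \<and>
      (\<lambda>n. rinorm NY (\<lambda>t. enn2real (Hop (Suc p) J (h (r n)) t) - g t)) \<longlonglongrightarrow> 0"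
    using comp hX hN unfolding compact_into_def by blast
  then obtain r g where r: "strict_mono (r::nat\<Rightarrow>nat)" and g: "g \<in> ri_space NY"
      and lim: "(\<lambda>n. rinorm NY (\<lambda>t. F (r n) t - g t)) \<longlonglongrightarrow> 0"
    unfolding F_def by blast
  have gm[measurable]: "g \<in> borel_measurable I01" using g by (simp add: ri_space_def)
  \<comment> \<open>From index \<open>m\<close> on the images vanish on [1/(m+1), 1), so there
    \<open>\<bar>g\<bar>\<close> is dominated by the difference of image and limit, whose norm tends
    to 0.\<close>
  have g0: "AE t in I01. 1 / Suc m \<le> t \<longrightarrow> g t = 0" for m
  proof -
    let ?u = "\<lambda>t. indicator {1 / Suc m..} t * \<bar>g t\<bar>"
    have unm: "nonneg_meas ?u" by (intro nonneg_measI borel_measurable_times indicator_I01) auto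
    have "NY ?u \<le> rinorm NY (\<lambda>t. F (r n) t - g t)" if "n \<ge> m" for n
      unfolding rinorm_def
    proof (intro Y.mono unm nonneg_measI AE_I2)
      fix t
      have "m \<le> r n" using seq_suble[OF r, of n] that by simp
      then have "1 / real (Suc (r n)) \<le> 1 / real (Suc m)" by (simp add: field_simps)
      then show "?u t \<le> \<bar>F (r n) t - g t\<bar>" using Fz[of "r n" t] by (auto simp: indicator_def)
    qed auto
    then have "NY ?u \<le> 0" by (intro LIMSEQ_le_const[OF lim]) blast
    then have "AE t in I01. ?u t = 0" using Y.zero_iff[OF unm] by simp
    then show ?thesis by (auto elim!: eventually_mono simp: indicator_def split: if_splits)
  qed
  have "AE t in I01. \<forall>m::nat. 1 / Suc m \<le> t \<longrightarrow> g t = 0" using g0 by (subst AE_all_countable) blast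
  moreover have "AE t in I01. t \<in> {0<..<1}" by (rule AE_I2) simp
  ultimately have gz: "AE t in I01. g t = 0"
  proof eventually_elim
    case (elim t)
    then obtain m where "1 / Suc m < t" using reals_Archimedean[of t] by (auto simp: inverse_eq_divide)
    then show ?case using elim(1) less_imp_le by blast
  qed
  \<comment> \<open>With \<open>g = 0\<close> the differences are the images themselves, whose norms
    exceed \<open>e\<close> by choice.\<close>
  have "ennreal e \<le> rinorm NY (\<lambda>t. F (r n) t - g t)" for n
  proof -
    have "NY (F (r n)) = rinorm NY (\<lambda>t. F (r n) t - g t)"
      unfolding rinorm_def using gz F0 by (intro Y.cong_AE nonneg_measI) (auto elim!: eventually_mono)
    then show ?thesis using big[of "r n"] by simp
  qed
  then have "ennreal e \<le> 0" by (intro LIMSEQ_le_const[OF lim]) auto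
  then show False using e by simp
qed

text \<open>A finite tail norm at \<open>a\<close> puts the image of the characteristic function of
  (0,a) into Y, because constants belong to X; the weight is dominated by that image plus a
  constant.\<close>

lemma weight_finite:
  assumes ba: "0 < b" "b < a" "a < 1" and fin: "tail_norm p a < \<infinity>"
  shows "nonneg_meas (\<lambda>t. 1 + kr t b ^ p)" "NY (\<lambda>t. 1 + kr t b ^ p) < \<infinity>"
proof -
  have [measurable]: "(\<lambda>t. kr t b) \<in> borel_measurable I01" unfolding kr_def by measurable
  show nm: "nonneg_meas (\<lambda>t. 1 + kr t b ^ p)" by (intro nonneg_measI) (auto simp: kr_nonneg)
  obtain r where r: "NX (\<lambda>_. 1) = ennreal r" "0 \<le> r" using X.one by (cases "NX (\<lambda>_. 1)") auto
  have r0: "0 < r" using X.one_pos r by (auto simp: order_less_le)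
  let ?g = "G p (indicator {0<..<a})" and ?k = "1 / kr b a"
  have k0: "0 \<le> ?k" by (simp add: kr_nonneg)
  have "NY ?g \<le> ennreal (fact p * r) * tail_norm p a"
    using tail_bound[of "\<lambda>_. 1" r p a] r r0 by (simp add: rinorm_def)
  then have gfin: "NY ?g < \<infinity>" using fin by (auto simp: ennreal_mult_less_top order_le_less_trans)
  have m1: "nonneg_meas (\<lambda>t. 2 * (\<lambda>_. 1) t)" and m2: "nonneg_meas (\<lambda>t. ?k * ?g t)"
    by (auto intro!: nonneg_measI simp: G_nonneg kr_nonneg)
  have "NY (\<lambda>t. 1 + kr t b ^ p) \<le> NY (\<lambda>t. 2 * (\<lambda>_. 1) t + ?k * ?g t)"
  proof (intro Y.mono nm nonneg_measI AE_I2)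
    fix t assume "t \<in> space I01"
    then show "1 + kr t b ^ p \<le> 2 * (\<lambda>_. 1) t + ?k * ?g t"
      using kr_power_bound[OF _ _ ba, of t p] by simp
  qed (auto simp: G_nonneg kr_nonneg)
  also have "\<dots> \<le> NY (\<lambda>t. 2 * (\<lambda>_. 1) t) + NY (\<lambda>t. ?k * ?g t)" by (rule Y.subadd[OF m1 m2])
  also have "\<dots> = ennreal 2 * NY (\<lambda>_. 1) + ennreal ?k * NY ?g"
    using k0 by (intro arg_cong2[where f="(+)"] Y.scale G_nonneg_meas nonneg_measI) auto
  also have "\<dots> < \<infinity>" using Y.one gfin by (auto simp: ennreal_mult_less_top)
  finally show "NY (\<lambda>t. 1 + kr t b ^ p) < \<infinity>" .
qed

lemma tail_eventually:
  assumes "(tail_norm p \<longlongrightarrow> 0) (at_right 0)" "0 < e"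
  obtains a where "0 < a" "a < 1" "\<And>b. 0 < b \<Longrightarrow> b \<le> a \<Longrightarrow> tail_norm p b \<le> ennreal e"
proof -
  have "\<forall>\<^sub>F a in at_right 0. tail_norm p a < ennreal e" using assms by (intro order_tendstoD) auto
  then obtain d where d: "0 < d" "\<And>y. 0 < y \<Longrightarrow> y < d \<Longrightarrow> tail_norm p y < ennreal e"
    unfolding eventually_at_right_field by blast
  show ?thesis
  proof (rule that[of "min (d / 2) (1 / 2)"])
    fix b :: real assume "0 < b" "b \<le> min (d / 2) (1 / 2)"
    then show "tail_norm p b \<le> ennreal e" using d(2)[of b] d(1) by auto
  qed (use d in auto)
qed

text \<open>The tail below \<open>b\<close> is controlled by assumption, and the rest is a multiple
  of the weight. Any \<open>b\<close> below \<open>a\<close> would do; half of \<open>a\<close> is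
  taken.\<close>

lemma Hop_maps_into:
  assumes ii: "(tail_norm p \<longlongrightarrow> 0) (at_right 0)" and f: "f \<in> ri_space NX"
  shows "NY (G p f) < \<infinity>"
proof -
  have fL: "f \<in> L1_space" using f X.ri_space_subset_L1 by blast
  have fm: "f \<in> borel_measurable I01" using f by (simp add: ri_space_def)
  obtain C where C: "rinorm NX f \<le> ennreal C" "0 < C"
  proof -
    obtain r where "rinorm NX f = ennreal r" "0 \<le> r" using f by (cases "rinorm NX f") (auto simp: ri_space_def)
    then show ?thesis by (intro that[of "r + 1"]) (auto simp: ennreal_leI)
  qed
  obtain a where a: "0 < a" "a < 1" "\<And>b. 0 < b \<Longrightarrow> b \<le> a \<Longrightarrow> tail_norm p b \<le> ennreal 1"
    using tail_eventually[OF ii, of 1] by auto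
  define b where "b = a / 2"
  have b: "0 < b" "b < a" using a by (auto simp: b_def)
  have "tail_norm p a \<le> ennreal 1" using a by simp
  then have ta: "tail_norm p a < \<infinity>" by (simp add: order_le_less_trans)
  note W = weight_finite[OF b(1,2) a(2) ta]
  let ?f = "\<lambda>s. indicator {0<..<b} s * f s" and ?D = "\<Sum>k\<le>p. (p choose k) * G k f b"
  have D0: "0 \<le> ?D" by (intro sum_nonneg) (simp add: G_nonneg)
  have nmD: "nonneg_meas (\<lambda>t. ?D * (1 + kr t b ^ p))"
    using W(1) D0 by (auto simp: nonneg_meas_def)
  have "NY (G p f) \<le> NY (\<lambda>t. G p ?f t + ?D * (1 + kr t b ^ p))"
  proof (intro Y.mono G_nonneg_meas AE_I2)
    show "nonneg_meas (\<lambda>t. G p ?f t + ?D * (1 + kr t b ^ p))"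
      using nmD G_nonneg_meas[of p ?f] by (auto simp: nonneg_meas_def)
    fix t assume "t \<in> space I01"
    then show "G p f t \<le> G p ?f t + ?D * (1 + kr t b ^ p)" using G_bound[OF fL _ b(1), of t p] by simp
  qed
  also have "\<dots> \<le> NY (G p ?f) + NY (\<lambda>t. ?D * (1 + kr t b ^ p))" by (rule Y.subadd[OF G_nonneg_meas nmD])
  also have "NY (\<lambda>t. ?D * (1 + kr t b ^ p)) = ennreal ?D * NY (\<lambda>t. 1 + kr t b ^ p)" by (rule Y.scale[OF W(1) D0])
  also have "NY (G p ?f) \<le> ennreal (fact p * C) * ennreal 1"
    using a b tail_bound[OF fm C, of p b] by (meson less_imp_le mult_left_mono order_trans zero_le)
  then have "NY (G p ?f) + ennreal ?D * NY (\<lambda>t. 1 + kr t b ^ p) < \<infinity>"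
    using W(2) by (auto simp: ennreal_mult_less_top order_le_less_trans)
  finally show ?thesis .
qed

end

section \<open>Sufficiency of vanishing tails\<close>


context hardy begin

lemma G_le:
  assumes "f \<in> L1_space" "(\<integral>\<^sup>+ s. ennreal \<bar>f s\<bar> \<partial>I01) \<le> ennreal B" "0 \<le> B" "0 < t"
  shows "G k f t \<le> (1 / (c * t)) ^ Suc k * B"
proof -
  have fm: "f \<in> borel_measurable I01" using assms by (simp add: L1_space_def)
  have "ennreal (G k f t) \<le> ennreal (1 / (c * t)) ^ Suc k * ennreal B"
    unfolding HH_eq_G[OF assms(1,4), symmetric]
    by (rule order_trans[OF HH_le[OF fm assms(4)] mult_left_mono[OF assms(2)]]) auto
  also have "\<dots> = ennreal ((1 / (c * t)) ^ Suc k * B)"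
    using c_pos assms by (subst ennreal_power) (auto simp: ennreal_mult simp del: power_Suc)
  finally show ?thesis using c_pos assms by (subst (asm) ennreal_le_iff) auto
qed

end

context hardy_ri begin

lemma integral_bound:
  obtains D where "0 < D" "\<And>f C. f \<in> borel_measurable I01 \<Longrightarrow> rinorm NX f \<le> ennreal C \<Longrightarrow> 0 \<le> C \<Longrightarrow>
     (\<integral>\<^sup>+ s. ennreal \<bar>f s\<bar> \<partial>I01) \<le> ennreal (D * C)"
proof -
  obtain D where D: "0 < D" "\<And>f. nonneg_meas f \<Longrightarrow> (\<integral>\<^sup>+ t. ennreal (f t) \<partial>I01) \<le> ennreal D * NX f"
    using X.L1 by metis
  show ?thesis
  proof (rule that[OF D(1)])
    fix f C assume f: "f \<in> borel_measurable I01" "rinorm NX f \<le> ennreal C" "0 \<le> C"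
    have "(\<integral>\<^sup>+ s. ennreal \<bar>f s\<bar> \<partial>I01) \<le> ennreal D * rinorm NX f"
      unfolding rinorm_def using f by (intro D nonneg_measI) auto
    also have "\<dots> \<le> ennreal D * ennreal C" by (intro mult_left_mono f) auto
    finally show "(\<integral>\<^sup>+ s. ennreal \<bar>f s\<bar> \<partial>I01) \<le> ennreal (D * C)" using D f by (simp add: ennreal_mult)
  qed
qed

lemma equi_lipschitz:
  assumes p: "1 \<le> p" and a: "0 < a" and e: "0 < e" and B: "0 \<le> B"
  shows "\<exists>d>0. \<forall>f t t'. f \<in> L1_space \<longrightarrow> (\<integral>\<^sup>+ s. ennreal \<bar>f s\<bar> \<partial>I01) \<le> ennreal B \<longrightarrow>
     a \<le> t \<longrightarrow> t \<le> t' \<longrightarrow> t' \<le> 1 \<longrightarrow> t' - t \<le> d \<longrightarrow> G p f t \<le> G p f t' + e"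
proof -
  define M where "M = real p * (2 / (c * a)) ^ (p - 1) / (c * a) ^ 2"
  have M: "0 \<le> M" using c_pos a by (simp add: M_def)
  have MB: "0 \<le> M * B" using M B by simp
  \<comment> \<open>The denominator is increased by 1 because \<open>M * B\<close> may be 0.\<close>
  define d where "d = e / (M * B + 1)"
  have d: "0 < d" using e MB by (simp add: d_def)
  have dMB: "M * B * d \<le> e" using e MB by (simp add: d_def field_simps)
  have "G p f t \<le> G p f t' + e"
    if f: "f \<in> L1_space" and i: "(\<integral>\<^sup>+ s. ennreal \<bar>f s\<bar> \<partial>I01) \<le> ennreal B"
      and t: "a \<le> t" "t \<le> t'" "t' \<le> 1" "t' - t \<le> d" for f t t'
  proof -
    have fm: "f \<in> borel_measurable I01" using f by (simp add: L1_space_def)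
    have "ennreal (G p f t) \<le> ennreal (G p f t') + ennreal (M * (t' - t)) * (\<integral>\<^sup>+ s. ennreal \<bar>f s\<bar> \<partial>I01)"
      using HH_lipschitz[OF fm a t(1-3) p] a t f by (simp add: HH_eq_G M_def)
    also have "\<dots> \<le> ennreal (G p f t') + ennreal (M * (t' - t)) * ennreal B"
      by (intro add_left_mono mult_left_mono i) auto
    also have "\<dots> = ennreal (G p f t' + M * (t' - t) * B)"
      using t M B G_nonneg by (simp add: ennreal_mult[symmetric] ennreal_plus[symmetric] del: ennreal_plus)
    finally have "G p f t \<le> G p f t' + M * (t' - t) * B"
      using G_nonneg M B t by (subst (asm) ennreal_le_iff) (auto intro!: add_nonneg_nonneg mult_nonneg_nonneg)
    also have "M * (t' - t) * B \<le> M * B * d"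
      using mult_left_mono[OF t(4) MB] by (simp add: mult_ac)
    finally show ?thesis using dMB by linarith
  qed
  then show ?thesis using d by blast
qed

text \<open>The averaging inequality bounds the mass of \<open>f\<close> on an interval of length at
  most \<open>d\<close> by \<open>C * d\<close> over \<phi>(d). For X other than L^1 this can be
  made arbitrarily small, uniformly in \<open>f\<close>.\<close>

lemma equi_integrable:
  assumes X: "ri_space NX \<noteq> L1_space" and a: "0 < a" and e: "0 < e" and C: "0 < C"
  shows "\<exists>d>0. \<forall>f t t'. f \<in> borel_measurable I01 \<longrightarrow> rinorm NX f \<le> ennreal C \<longrightarrow>
     a \<le> t \<longrightarrow> t \<le> t' \<longrightarrow> t' \<le> 1 \<longrightarrow> t' - t \<le> d \<longrightarrow> G 0 f t \<le> G 0 f t' + e"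
proof -
  \<comment> \<open>With \<phi>(d)/d above this \<open>K\<close>, the mass is at most
    \<open>c * a * e\<close>, and 1/J costs the factor \<open>1 / (c * a)\<close>.\<close>
  define K where "K = C / (c * a * e)"
  have K: "0 < K" using C c_pos a e by (simp add: K_def)
  obtain d where d: "0 < d" "d \<le> 1" "ennreal K * ennreal d < X.\<phi> d"
    using X.phi_unbounded_of_not_L1[OF X] by blast
  have "G 0 f t \<le> G 0 f t' + e"
    if fm[measurable]: "f \<in> borel_measurable I01" and fC: "rinorm NX f \<le> ennreal C"
      and t: "a \<le> t" "t \<le> t'" "t' \<le> 1" "t' - t \<le> d" for f t t'
  proof -
    have f: "f \<in> L1_space" by (rule L1_of_X[OF fm fC])
    define h where "h s = \<bar>f s\<bar> * indicator {t..<t'} s" for s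
    have hm[measurable]: "h \<in> borel_measurable I01"
      unfolding h_def by (intro borel_measurable_times indicator_I01) auto
    have hnm: "nonneg_meas h" by (simp add: nonneg_meas_def, simp add: h_def)
    have "{s \<in> {0<..<1}. \<bar>h s\<bar> > 0} \<subseteq> {t..t'} \<inter> {0<..<1}" by (auto simp: h_def indicator_def split: if_splits)
    then have "distrib_fun h 0 \<le> emeasure I01 ({t..t'} \<inter> {0<..<1})"
      unfolding distrib_fun_def by (rule emeasure_mono) (auto intro!: borel_set_I01)
    also have "\<dots> \<le> ennreal (max 0 (t' - t))" by (rule emeasure_I01_Icc_le)
    also have "\<dots> \<le> ennreal d" using t d by (intro ennreal_leI) auto
    finally have supp: "distrib_fun h 0 \<le> ennreal d" .
    have NXh: "NX h \<le> ennreal C"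
    proof -
      have "NX h \<le> rinorm NX f" unfolding rinorm_def
        by (intro X.mono hnm nonneg_measI AE_I2) (auto simp: h_def indicator_def)
      then show ?thesis using fC by simp
    qed
    have "(\<integral>\<^sup>+ s. ennreal (h s) \<partial>I01) \<le> (\<integral>\<^sup>+ s. ennreal (norm (f s)) \<partial>I01)"
      by (intro nn_integral_mono ennreal_leI) (auto simp: h_def indicator_def)
    also have "\<dots> < \<infinity>" using f by (simp add: L1_space_def integrable_iff_bounded)
    finally obtain i where i: "(\<integral>\<^sup>+ s. ennreal (h s) \<partial>I01) = ennreal i" "0 \<le> i"
      by (cases "\<integral>\<^sup>+ s. ennreal (h s) \<partial>I01") auto
    have "ennreal i * (ennreal K * ennreal d) \<le> ennreal i * X.\<phi> d" using d by (intro mult_left_mono) auto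
    also have "\<dots> \<le> ennreal d * NX h" using X.averaging[OF hnm d(1,2) supp] i by simp
    also have "\<dots> \<le> ennreal d * ennreal C" by (intro mult_left_mono NXh) auto
    finally have "i * (K * d) \<le> d * C" using i K d C by (simp flip: ennreal_mult)
    then have "i * K \<le> C" using d by (simp add: mult_ac)
    then have iK: "i / (c * a) \<le> e" using c_pos a e C unfolding K_def by (simp add: field_simps)
    have "ennreal (G 0 f t) \<le> ennreal (G 0 f t') + ennreal (1 / (c * a)) * ennreal i"
      using HH_0_increment[OF fm a t(1,2)] a t f i by (simp add: HH_eq_G h_def)
    also have "\<dots> = ennreal (G 0 f t' + 1 / (c * a) * i)"
      using c_pos a i G_nonneg by (simp add: ennreal_mult[symmetric] ennreal_plus[symmetric] del: ennreal_plus)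
    finally have "G 0 f t \<le> G 0 f t' + 1 / (c * a) * i"
      using c_pos a i G_nonneg by (subst (asm) ennreal_le_iff) (auto intro!: add_nonneg_nonneg)
    then show ?thesis using iK by simp
  qed
  then show ?thesis using d(1) by blast
qed

text \<open>The exclusion of L^1, L^infinity and order one enters the sufficiency argument only
  here. Uniform convergence gives convergence in Y because constants have finite norm; without it,
  the uniform bound on [b,1) serves as the majorant.\<close>

lemma Cauchy_away_from_zero:
  assumes fs: "\<And>n. fs n \<in> borel_measurable I01" "\<And>n. rinorm NX (fs n) \<le> ennreal C" and C: "0 < C"
    and conv: "\<And>q. q \<in> \<rat> \<Longrightarrow> 0 < q \<Longrightarrow> q \<le> 1 \<Longrightarrow> convergent (\<lambda>n. G p (fs n) q)"
    and b: "b \<in> \<rat>" "0 < b" "b < 1" and e: "0 < e"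
    and gen: "1 \<le> p \<or> ri_space NX \<noteq> L1_space \<or> ri_space NY \<noteq> Linf_space"
  shows "\<exists>M. \<forall>n\<ge>M. \<forall>m\<ge>M. NY (\<lambda>t. indicator {b..} t * \<bar>G p (fs n) t - G p (fs m) t\<bar>) \<le> ennreal e"
proof -
  have fL: "fs n \<in> L1_space" for n by (rule L1_of_X[OF fs])
  have anti: "0 < t \<Longrightarrow> t \<le> t' \<Longrightarrow> t' \<le> 1 \<Longrightarrow> G p (fs n) t' \<le> G p (fs n) t" for n t t'
    by (rule G_antimono[OF fL])
  obtain D where D: "0 < D" "\<And>f C. f \<in> borel_measurable I01 \<Longrightarrow> rinorm NX f \<le> ennreal C \<Longrightarrow> 0 \<le> C \<Longrightarrow>
     (\<integral>\<^sup>+ s. ennreal \<bar>f s\<bar> \<partial>I01) \<le> ennreal (D * C)" using integral_bound by blast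
  define B where "B = D * C"
  have B: "0 \<le> B" using D C by (simp add: B_def)
  have fB: "(\<integral>\<^sup>+ s. ennreal \<bar>fs n s\<bar> \<partial>I01) \<le> ennreal B" for n
    unfolding B_def using fs C by (intro D) auto
  have dm: "(\<lambda>t. indicator {b..} t * \<bar>G p (fs n) t - u t\<bar>) \<in> borel_measurable I01"
    if "u \<in> borel_measurable I01" for n u
    using that by (intro borel_measurable_times indicator_I01 borel_measurable_abs borel_measurable_diff G_meas) auto
  show ?thesis
  proof (cases "1 \<le> p \<or> ri_space NX \<noteq> L1_space")
    case True
    note pX = this
    have equi: "\<exists>d>0. \<forall>n t t'. b \<le> t \<longrightarrow> t \<le> t' \<longrightarrow> t' \<le> 1 \<longrightarrow> t' - t \<le> d \<longrightarrow> G p (fs n) t \<le> G p (fs n) t' + e'"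
      if "0 < e'" for e'
    proof (cases "1 \<le> p")
      case True
      show ?thesis using equi_lipschitz[OF True b(2) that B] fL fB by meson
    next
      case False
      then have "p = 0" "ri_space NX \<noteq> L1_space" using pX by auto
      then show ?thesis using equi_integrable[OF _ b(2) that C] fs by meson
    qed
    obtain r where r: "NY (\<lambda>_. 1) = ennreal r" "0 \<le> r" using Y.one by (cases "NY (\<lambda>_. 1)") auto
    \<comment> \<open>The grid argument yields differences up to \<open>2 * e'\<close>, and
      \<open>r\<close> is the norm of 1.\<close>
    define e' where "e' = e / (2 * (r + 1))"
    have e': "0 < e'" "2 * e' * r \<le> e" using e r by (auto simp: e'_def field_simps)
    obtain d where d: "0 < d" "\<And>n t t'. b \<le> t \<Longrightarrow> t \<le> t' \<Longrightarrow> t' \<le> 1 \<Longrightarrow> t' - t \<le> d \<Longrightarrow> G p (fs n) t \<le> G p (fs n) t' + e'"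
      using equi[OF e'(1)] by meson
    have "\<exists>M. \<forall>n\<ge>M. \<forall>m\<ge>M. \<forall>t. b \<le> t \<longrightarrow> t < 1 \<longrightarrow> \<bar>G p (fs n) t - G p (fs m) t\<bar> \<le> 2 * e'"
      by (rule antimono_uniform_Cauchy[where d=d]) (rule anti conv b d e'(1); assumption)+
    then obtain M where M: "\<And>n m t. n \<ge> M \<Longrightarrow> m \<ge> M \<Longrightarrow> b \<le> t \<Longrightarrow> t < 1 \<Longrightarrow> \<bar>G p (fs n) t - G p (fs m) t\<bar> \<le> 2 * e'"
      by meson
    have "NY (\<lambda>t. indicator {b..} t * \<bar>G p (fs n) t - G p (fs m) t\<bar>) \<le> ennreal e" if "n \<ge> M" "m \<ge> M" for n m
    proof -
      have "NY (\<lambda>t. indicator {b..} t * \<bar>G p (fs n) t - G p (fs m) t\<bar>) \<le> NY (\<lambda>t. (2 * e') * (\<lambda>_. 1) t)"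
      proof (intro Y.mono nonneg_measI AE_I2 dm)
        fix t assume "t \<in> space I01"
        then show "indicator {b..} t * \<bar>G p (fs n) t - G p (fs m) t\<bar> \<le> (2 * e') * (\<lambda>_. 1) t"
          using M[OF that, of t] e' by (auto simp: indicator_def)
      qed (use e' in auto)
      also have "\<dots> = ennreal (2 * e') * NY (\<lambda>_. 1)" using e' by (intro Y.scale nonneg_measI) auto
      also have "\<dots> \<le> ennreal e" using e' r by (simp add: ennreal_leI flip: ennreal_mult)
      finally show ?thesis .
    qed
    then show ?thesis by blast
  next
    case False
    then have Y: "ri_space NY \<noteq> Linf_space" using gen by blast
    have "\<exists>g. g \<in> borel_measurable I01 \<and> (AE t in I01. (\<lambda>n. G p (fs n) t) \<longlonglongrightarrow> g t)"
      by (rule antimono_convergence_AE) (rule anti G_nonneg conv; assumption)+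
    then obtain g where g[measurable]: "g \<in> borel_measurable I01" and lim: "AE t in I01. (\<lambda>n. G p (fs n) t) \<longlonglongrightarrow> g t"
      by blast
    define K where "K = (1 / (c * b)) ^ Suc p * B"
    have GK: "G p (fs n) t \<le> K" if "b \<le> t" for n t
      using G_antimono[OF fL b(2) that, of p n] G_le[OF fL[of n] fB B b(2), of p] unfolding K_def by linarith
    have dist: "(\<lambda>n. NY (\<lambda>t. indicator {b..} t * \<bar>G p (fs n) t - g t\<bar>)) \<longlonglongrightarrow> 0"
    proof (rule Y.dominated_convergence)
      show "\<exists>t. 0 < t \<and> t \<le> 1 \<and> Y.\<phi> t < ennreal e" if "0 < e" for e
        by (rule Y.phi_small_of_not_Linf[OF Y that])
      show "nonneg_meas (\<lambda>t. indicator {b..} t * \<bar>G p (fs n) t - g t\<bar>)" for n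
        by (intro nonneg_measI dm g) auto
      show "AE t in I01. indicator {b..} t * \<bar>G p (fs n) t - g t\<bar> \<le> K" for n
        using lim
      proof eventually_elim
        case (elim t)
        have K0: "0 \<le> K" using c_pos b B unfolding K_def by simp
        show ?case
        proof (cases "b \<le> t")
          case True
          have "0 \<le> g t" "g t \<le> K"
            using LIMSEQ_le_const[OF elim, of 0] LIMSEQ_le_const2[OF elim, of K] G_nonneg GK[OF True] by auto
          then show ?thesis using GK[OF True, of n] G_nonneg[of p "fs n" t] True by (auto simp: abs_le_iff)
        qed (use K0 in auto)
      qed
      show "AE t in I01. (\<lambda>n. indicator {b..} t * \<bar>G p (fs n) t - g t\<bar>) \<longlonglongrightarrow> 0"
        using lim
      proof eventually_elim
        case (elim t)
        then have "(\<lambda>n. indicator {b..} t * \<bar>G p (fs n) t - g t\<bar>) \<longlonglongrightarrow> indicator {b..} t * \<bar>g t - g t\<bar>"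
          by (intro tendsto_intros)
        then show ?case by simp
      qed
    qed
    have "0 < ennreal (e / 2)" using e by simp
    then have "\<forall>\<^sub>F n in sequentially. NY (\<lambda>t. indicator {b..} t * \<bar>G p (fs n) t - g t\<bar>) < ennreal (e / 2)"
      by (intro order_tendstoD[OF dist])
    then obtain M where M: "\<And>n. n \<ge> M \<Longrightarrow> NY (\<lambda>t. indicator {b..} t * \<bar>G p (fs n) t - g t\<bar>) < ennreal (e / 2)"
      unfolding eventually_sequentially by blast
    have "NY (\<lambda>t. indicator {b..} t * \<bar>G p (fs n) t - G p (fs m) t\<bar>) \<le> ennreal e" if nm: "n \<ge> M" "m \<ge> M" for n m
    proof -
      let ?u = "\<lambda>n t. indicator {b..} t * \<bar>G p (fs n) t - g t\<bar>"
      have unm: "nonneg_meas (?u n)" for n by (intro nonneg_measI dm g) auto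
      have "NY (\<lambda>t. indicator {b..} t * \<bar>G p (fs n) t - G p (fs m) t\<bar>) \<le> NY (\<lambda>t. ?u n t + ?u m t)"
        using unm[of n] unm[of m]
        by (intro Y.mono nonneg_measI AE_I2 dm) (auto simp: nonneg_meas_def indicator_def)
      also have "\<dots> \<le> NY (?u n) + NY (?u m)" by (rule Y.subadd[OF unm unm])
      also have "\<dots> \<le> ennreal (e / 2) + ennreal (e / 2)"
        using M nm by (intro add_mono) (auto intro: less_imp_le)
      also have "\<dots> = ennreal e" using e by (subst ennreal_plus[symmetric]) auto
      finally show ?thesis .
    qed
    then show ?thesis by blast
  qed
qed

lemma compact_of_tail_tendsto:
  assumes ii: "(tail_norm p \<longlongrightarrow> 0) (at_right 0)"
    and gen: "1 \<le> p \<or> ri_space NX \<noteq> L1_space \<or> ri_space NY \<noteq> Linf_space"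
  shows "compact_into (Hop (Suc p) J) NX NY"
  unfolding compact_into_def
proof (intro conjI ballI allI impI)
  fix f assume f: "f \<in> ri_space NX"
  then have fL: "f \<in> L1_space" using X.ri_space_subset_L1 by blast
  show "AE t in I01. Hop (Suc p) J f t \<noteq> \<infinity>" by (rule enn2real_Hop_AE[OF fL])
  have "NY (\<lambda>t. enn2real (Hop (Suc p) J f t)) < \<infinity>"
    unfolding NY_Hop[OF fL] using Hop_maps_into[OF ii f] by (simp add: ennreal_mult_less_top)
  then show "(\<lambda>t. enn2real (Hop (Suc p) J f t)) \<in> ri_space NY"
    using enn2real_Hop_AE(3)[OF fL] by (simp add: ri_space_def rinorm_def)
next
  fix f0 :: "nat \<Rightarrow> real \<Rightarrow> real"
  assume "(\<forall>n. f0 n \<in> ri_space NX) \<and> (\<exists>C::real. \<forall>n. rinorm NX (f0 n) \<le> ennreal C)"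
  then obtain C0 where f0X: "\<And>n. f0 n \<in> ri_space NX" and "\<And>n. rinorm NX (f0 n) \<le> ennreal C0" by blast
  define C where "C = max C0 1"
  have C: "0 < C" by (simp add: C_def)
  have f0C: "rinorm NX (f0 n) \<le> ennreal C" for n
    using \<open>\<And>n. rinorm NX (f0 n) \<le> ennreal C0\<close>[of n] by (rule order_trans) (auto simp: C_def intro: ennreal_leI)
  have f0m: "f0 n \<in> borel_measurable I01" for n using f0X by (simp add: ri_space_def)
  have f0L: "f0 n \<in> L1_space" for n by (rule L1_of_X[OF f0m f0C])
  obtain D where D: "0 < D" "\<And>f C. f \<in> borel_measurable I01 \<Longrightarrow> rinorm NX f \<le> ennreal C \<Longrightarrow> 0 \<le> C \<Longrightarrow>
     (\<integral>\<^sup>+ s. ennreal \<bar>f s\<bar> \<partial>I01) \<le> ennreal (D * C)" using integral_bound by blast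
  define B where "B = D * C"
  have B: "0 \<le> B" using D C by (simp add: B_def)
  have fB: "(\<integral>\<^sup>+ s. ennreal \<bar>f0 n s\<bar> \<partial>I01) \<le> ennreal B" for n
    unfolding B_def using f0m f0C C by (intro D) auto
  \<comment> \<open>All orders \<open>k\<close> are made to converge along with \<open>p\<close>,
    since the values of lower order at \<open>b\<close> are the coefficients in the binomial
    formula.\<close>
  let ?S = "(UNIV :: nat set) \<times> {q \<in> \<rat>. 0 < q}"
  have cS: "countable ?S" using countable_rat by (intro countable_SIGMA) (auto intro: countable_subset)
  have bS: "\<bar>G (fst x) (f0 n) (snd x)\<bar> \<le> (1 / (c * snd x)) ^ Suc (fst x) * B" if "x \<in> ?S" for n x
    using that G_le[OF f0L[of n] fB B, where t="snd x" and k="fst x"] G_nonneg by (auto simp del: power_Suc)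
  have "\<exists>r::nat \<Rightarrow> nat. strict_mono r \<and> (\<forall>x\<in>?S. convergent (\<lambda>n. G (fst x) (f0 (r n)) (snd x)))"
    by (rule diagonal_subsequence[OF cS]) (rule bS)
  then obtain r where r: "strict_mono (r::nat\<Rightarrow>nat)" "\<And>x. x \<in> ?S \<Longrightarrow> convergent (\<lambda>n. G (fst x) (f0 (r n)) (snd x))"
    by blast
  define fs where "fs n = f0 (r n)" for n
  have fs: "fs n \<in> borel_measurable I01" "rinorm NX (fs n) \<le> ennreal C" "fs n \<in> ri_space NX" "fs n \<in> L1_space" for n
    unfolding fs_def using f0m f0C f0X f0L by auto
  have conv: "convergent (\<lambda>n. G k (fs n) q)" if "q \<in> \<rat>" "0 < q" for k q
    using r(2)[of "(k, q)"] that unfolding fs_def by simp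
  have "\<exists>g. g \<in> borel_measurable I01 \<and> (AE t in I01. (\<lambda>n. G p (fs n) t) \<longlonglongrightarrow> g t)"
    by (rule antimono_convergence_AE) (rule G_antimono[OF fs(4)] G_nonneg conv; assumption)+
  then obtain g where g[measurable]: "g \<in> borel_measurable I01" and lim: "AE t in I01. (\<lambda>n. G p (fs n) t) \<longlonglongrightarrow> g t"
    by blast
  have Cauchy: "\<exists>M. \<forall>n\<ge>M. \<forall>m\<ge>M. rinorm NY (\<lambda>t. G p (fs n) t - G p (fs m) t) \<le> ennreal e" if e: "0 < e" for e
  proof -
    \<comment> \<open>The difference is bounded by four terms, each allotted a quarter of
      \<open>e\<close>; the tails are enlarged by the factor \<open>fact p * C\<close>.\<close>
    define e1 where "e1 = e / (4 * fact p * C)"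
    have e1: "0 < e1" "fact p * C * e1 = e / 4" using e C by (auto simp: e1_def)
    define e2 where "e2 = min e1 1"
    have e2: "0 < e2" "e2 \<le> e1" "e2 \<le> 1" using e1 by (auto simp: e2_def)
    obtain a where a: "0 < a" "a < 1" "\<And>b. 0 < b \<Longrightarrow> b \<le> a \<Longrightarrow> tail_norm p b \<le> ennreal e2"
      using tail_eventually[OF ii e2(1)] by blast
    \<comment> \<open>Rational, so that the coefficients at \<open>b\<close> converge; strictly
      below \<open>a\<close>, so that the weight lies in Y.\<close>
    obtain b where b: "b \<in> \<rat>" "0 < b" "b < a" using Rats_dense_in_real[OF a(1)] by blast
    have ta: "tail_norm p a < \<infinity>" using a(3)[of a] a(1) by (simp add: order_le_less_trans)
    note W = weight_finite[OF b(2,3) a(2) ta]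
    obtain w where w: "NY (\<lambda>t. 1 + kr t b ^ p) = ennreal w" "0 \<le> w" using W(2) by (cases "NY (\<lambda>t. 1 + kr t b ^ p)") auto
    have tail: "NY (G p (\<lambda>s. indicator {0<..<b} s * fs n s)) \<le> ennreal (e / 4)" for n
    proof -
      have "NY (G p (\<lambda>s. indicator {0<..<b} s * fs n s)) \<le> ennreal (fact p * C) * tail_norm p b"
        by (rule tail_bound[OF fs(1,2) C])
      also have "\<dots> \<le> ennreal (fact p * C) * ennreal e1"
        using a(3)[of b] b e2 by (intro mult_left_mono) (auto intro: order_trans ennreal_leI)
      also have "\<dots> = ennreal (fact p * C * e1)" using C e1(1) by (simp add: ennreal_mult)
      finally show ?thesis by (simp only: e1(2))
    qed
    define dd where "dd n m = (\<Sum>k\<le>p. (p choose k) * \<bar>G k (fs n) b - G k (fs m) b\<bar>)" for n m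
    have dd0: "0 \<le> dd n m" for n m unfolding dd_def by (intro sum_nonneg) auto
    \<comment> \<open>The binomial coefficients sum to \<open>2 ^ p\<close> and \<open>w\<close> is
      the norm of the weight; \<open>w + 1\<close> keeps the quotient meaningful.\<close>
    define e3 where "e3 = e / (4 * (w + 1) * 2 ^ p)"
    have e3: "0 < e3" using e w by (simp add: e3_def)
    have "\<exists>M. \<forall>n\<ge>M. \<forall>m\<ge>M. \<bar>G k (fs n) b - G k (fs m) b\<bar> < e3" for k
      using convergent_Cauchy[OF conv[OF b(1,2), of k]] e3 unfolding Cauchy_def dist_real_def by blast
    then obtain M1 where M1: "\<And>k n m. n \<ge> M1 k \<Longrightarrow> m \<ge> M1 k \<Longrightarrow> \<bar>G k (fs n) b - G k (fs m) b\<bar> < e3" by metis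
    define M2 where "M2 = Max (M1 ` {..p})"
    have M2: "M1 k \<le> M2" if "k \<le> p" for k unfolding M2_def using that by (intro Max_ge) auto
    have ddw: "dd n m * w \<le> e / 4" if "n \<ge> M2" "m \<ge> M2" for n m
    proof -
      have "dd n m \<le> (\<Sum>k\<le>p. (p choose k) * e3)"
        unfolding dd_def using that M2 by (intro sum_mono mult_left_mono less_imp_le[OF M1]) (auto intro: le_trans)
      also have "\<dots> = 2 ^ p * e3"
        using choose_row_sum[of p] by (simp flip: sum_distrib_right of_nat_sum)
      finally have "dd n m * w \<le> 2 ^ p * e3 * w" using w by (intro mult_right_mono) auto
      also have "\<dots> = e / 4 * (w / (w + 1))" by (simp add: e3_def)
      also have "\<dots> \<le> e / 4 * 1" using e w by (intro mult_left_mono) auto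
      finally show ?thesis by simp
    qed
    have "b < 1" "0 < e / 4" using b a e by auto
    then have cau: "\<exists>M. \<forall>n\<ge>M. \<forall>m\<ge>M. NY (\<lambda>t. indicator {b..} t * \<bar>G p (fs n) t - G p (fs m) t\<bar>) \<le> ennreal (e / 4)"
      by (intro Cauchy_away_from_zero[OF fs(1,2) C _ b(1,2) _ _ gen] conv)
    obtain M3 where M3: "\<And>n m. n \<ge> M3 \<Longrightarrow> m \<ge> M3 \<Longrightarrow> NY (\<lambda>t. indicator {b..} t * \<bar>G p (fs n) t - G p (fs m) t\<bar>) \<le> ennreal (e / 4)"
      using cau by blast
    have "rinorm NY (\<lambda>t. G p (fs n) t - G p (fs m) t) \<le> ennreal e" if nm: "n \<ge> max M2 M3" "m \<ge> max M2 M3" for n m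
    proof -
      let ?f = "\<lambda>n s. indicator {0<..<b} s * fs n s"
      let ?W = "\<lambda>t. dd n m * (1 + kr t b ^ p)" and ?V = "\<lambda>t. indicator {b..} t * \<bar>G p (fs n) t - G p (fs m) t\<bar>"
      have Wn: "nonneg_meas ?W" using W(1) dd0 by (auto simp: nonneg_meas_def)
      have Vn: "nonneg_meas ?V" by (intro nonneg_measI borel_measurable_times indicator_I01) auto
      have n1: "nonneg_meas (\<lambda>t. G p (?f n) t + G p (?f m) t)"
        by (intro nonneg_measI) (auto simp: G_nonneg)
      have n2: "nonneg_meas (\<lambda>t. G p (?f n) t + G p (?f m) t + ?W t)"
        using n1 Wn by (auto simp: nonneg_meas_def)
      have n3: "nonneg_meas (\<lambda>t. G p (?f n) t + G p (?f m) t + ?W t + ?V t)"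
        using n2 Vn by (auto simp: nonneg_meas_def)
      have "rinorm NY (\<lambda>t. G p (fs n) t - G p (fs m) t) \<le> NY (\<lambda>t. G p (?f n) t + G p (?f m) t + ?W t + ?V t)"
        unfolding rinorm_def
      proof (rule Y.mono[OF nonneg_measI n3 AE_I2])
        fix t assume "t \<in> space I01"
        then show "\<bar>G p (fs n) t - G p (fs m) t\<bar> \<le> G p (?f n) t + G p (?f m) t + ?W t + ?V t"
          unfolding dd_def using fs(4) b(2) by (intro G_diff_bound) auto
      qed auto
      also have "\<dots> \<le> NY (\<lambda>t. G p (?f n) t + G p (?f m) t + ?W t) + NY ?V" by (rule Y.subadd[OF n2 Vn])
      also have "\<dots> \<le> (NY (\<lambda>t. G p (?f n) t + G p (?f m) t) + NY ?W) + NY ?V"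
        by (intro add_right_mono Y.subadd[OF n1 Wn])
      also have "\<dots> \<le> (NY (G p (?f n)) + NY (G p (?f m)) + NY ?W) + NY ?V"
        by (intro add_right_mono Y.subadd G_nonneg_meas)
      also have "\<dots> \<le> (ennreal (e / 4) + ennreal (e / 4) + ennreal (e / 4)) + ennreal (e / 4)"
      proof (intro add_mono tail)
        have "NY ?W = ennreal (dd n m) * ennreal w" using Y.scale[OF W(1) dd0] w by simp
        then show "NY ?W \<le> ennreal (e / 4)" using ddw[of n m] nm dd0 w by (simp add: ennreal_leI flip: ennreal_mult)
        show "NY ?V \<le> ennreal (e / 4)" using M3 nm by simp
      qed
      also have "\<dots> = ennreal e" using e by (simp flip: ennreal_plus)
      finally show ?thesis .
    qed
    then show ?thesis by blast
  qed
  have close: "\<exists>M. \<forall>n\<ge>M. rinorm NY (\<lambda>t. G p (fs n) t - g t) \<le> ennreal e" if e: "0 < e" for e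
  proof -
    obtain M where M: "\<And>n m. n \<ge> M \<Longrightarrow> m \<ge> M \<Longrightarrow> rinorm NY (\<lambda>t. G p (fs n) t - G p (fs m) t) \<le> ennreal e"
      using Cauchy[OF e] by blast
    have "rinorm NY (\<lambda>t. G p (fs n) t - g t) \<le> ennreal e" if n: "n \<ge> M" for n
      unfolding rinorm_def
    \<comment> \<open>With \<open>n\<close> fixed, \<open>m\<close> tends to infinity in the Cauchy
      estimate.\<close>
    proof (rule Y.fatou[where h="\<lambda>m t. \<bar>G p (fs n) t - G p (fs m) t\<bar>"])
      show "AE t in I01. (\<lambda>m. \<bar>G p (fs n) t - G p (fs m) t\<bar>) \<longlonglongrightarrow> \<bar>G p (fs n) t - g t\<bar>"
        using lim by eventually_elim (intro tendsto_intros)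
      show "\<forall>\<^sub>F m in sequentially. NY (\<lambda>t. \<bar>G p (fs n) t - G p (fs m) t\<bar>) \<le> ennreal e"
        using M[OF n] unfolding eventually_sequentially rinorm_def by blast
    qed (auto intro!: nonneg_measI)
    then show ?thesis by blast
  qed
  have gY: "rinorm NY g < \<infinity>"
  proof -
    obtain M where M: "rinorm NY (\<lambda>t. G p (fs M) t - g t) \<le> ennreal 1" using close[of 1] by auto
    have "rinorm NY g = rinorm NY (\<lambda>t. G p (fs M) t + - (G p (fs M) t - g t))" by simp
    also have "\<dots> \<le> rinorm NY (G p (fs M)) + rinorm NY (\<lambda>t. - (G p (fs M) t - g t))"
      by (rule Y.rinorm_triangle) auto
    also have "rinorm NY (G p (fs M)) = NY (G p (fs M))" by (simp add: rinorm_def G_nonneg)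
    also have "rinorm NY (\<lambda>t. - (G p (fs M) t - g t)) = rinorm NY (\<lambda>t. G p (fs M) t - g t)"
      unfolding rinorm_def by (simp add: abs_minus_commute)
    also have "NY (G p (fs M)) + rinorm NY (\<lambda>t. G p (fs M) t - g t) < \<infinity>"
      using M Hop_maps_into[OF ii fs(3)] by (auto simp: order_le_less_trans)
    finally show ?thesis .
  qed
  let ?g = "\<lambda>t. 1 / fact p * g t"
  have scale: "rinorm NY (\<lambda>t. 1 / fact p * u t) = ennreal (1 / fact p) * rinorm NY u"
    if "u \<in> borel_measurable I01" for u
  proof -
    have "rinorm NY (\<lambda>t. 1 / fact p * u t) = NY (\<lambda>t. 1 / fact p * \<bar>u t\<bar>)" by (simp add: rinorm_def abs_mult)
    also have "\<dots> = ennreal (1 / fact p) * rinorm NY u"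
      unfolding rinorm_def using that by (intro Y.scale nonneg_measI) auto
    finally show ?thesis .
  qed
  have "?g \<in> ri_space NY" using scale[OF g] gY by (simp add: ri_space_def ennreal_mult_less_top)
  moreover have "(\<lambda>n. rinorm NY (\<lambda>t. enn2real (Hop (Suc p) J (f0 (r n)) t) - ?g t)) \<longlonglongrightarrow> 0"
  proof (rule tendsto_ennreal_0I)
    fix e :: real assume e: "0 < e"
    have eq: "rinorm NY (\<lambda>t. enn2real (Hop (Suc p) J (fs n) t) - ?g t) = ennreal (1 / fact p) * rinorm NY (\<lambda>t. G p (fs n) t - g t)" for n
    proof -
      have "rinorm NY (\<lambda>t. enn2real (Hop (Suc p) J (fs n) t) - ?g t) = rinorm NY (\<lambda>t. 1 / fact p * (G p (fs n) t - g t))"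
        unfolding rinorm_def using enn2real_Hop_AE(2,3)[OF fs(4), of p n]
        by (intro Y.cong_AE nonneg_measI) (auto elim!: eventually_mono simp: right_diff_distrib diff_divide_distrib)
      also have "\<dots> = ennreal (1 / fact p) * rinorm NY (\<lambda>t. G p (fs n) t - g t)" by (rule scale) auto
      finally show ?thesis .
    qed
    obtain M where M: "\<And>n. n \<ge> M \<Longrightarrow> rinorm NY (\<lambda>t. G p (fs n) t - g t) \<le> ennreal (fact p * e)"
      using close[of "fact p * e"] e by auto
    have "rinorm NY (\<lambda>t. enn2real (Hop (Suc p) J (fs n) t) - ?g t) \<le> ennreal e" if "n \<ge> M" for n
    proof -
      have "ennreal (1 / fact p) * rinorm NY (\<lambda>t. G p (fs n) t - g t) \<le> ennreal (1 / fact p) * ennreal (fact p * e)"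
        by (intro mult_left_mono M that) auto
      also have "\<dots> = ennreal e" using e by (simp flip: ennreal_mult)
      finally show ?thesis unfolding eq .
    qed
    then show "\<forall>\<^sub>F n in sequentially. rinorm NY (\<lambda>t. enn2real (Hop (Suc p) J (f0 (r n)) t) - ?g t) \<le> ennreal e"
      unfolding eventually_sequentially fs_def by blast
  qed
  ultimately show "\<exists>(r::nat \<Rightarrow> nat) g. strict_mono r \<and> g \<in> ri_space NY \<and>
       (\<lambda>n. rinorm NY (\<lambda>t. enn2real (Hop (Suc p) J (f0 (r n)) t) - g t)) \<longlonglongrightarrow> 0"
    using r(1) by blast
qed

end

section \<open>The exceptional case\<close>


lemma AE_lebesgue_on_interval_iff:
  assumes "a \<le> 1"
  shows "(AE t in lebesgue_on {0<..<a}. P t) \<longleftrightarrow> (AE t in I01. t < a \<longrightarrow> P t)"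
  using assms by (subst (1 2) AE_restrict_space_iff) (auto intro!: AE_cong)

context hardy_ri begin

lemma inv_J_measurable:
  "a \<le> 1 \<Longrightarrow> (\<lambda>t. ereal (1 / J t)) \<in> borel_measurable (lebesgue_on {0<..<a})"
  by (rule measurable_restrict_mono[where A="{0<..<1}"]) auto

text \<open>If 1/J is at most \<open>d\<close> almost everywhere on (0,a), the image of the tail is
  at most \<open>d\<close> times the L^1 norm at every point. Both embeddings, of X into L^1 and of
  L^infinity into Y, then give the claim for any pair of norms.\<close>

lemma tail_tendsto_of_esssup:
  assumes ess: "((\<lambda>a. esssup (lebesgue_on {0<..<a}) (\<lambda>t. ereal (1 / J t))) \<longlongrightarrow> 0) (at_right 0)"
  shows "(tail_norm 0 \<longlongrightarrow> 0) (at_right 0)"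
proof (rule tendsto_ennreal_0I)
  fix e :: real assume e: "0 < e"
  obtain D where D: "0 < D" "\<And>f C. f \<in> borel_measurable I01 \<Longrightarrow> rinorm NX f \<le> ennreal C \<Longrightarrow> 0 \<le> C \<Longrightarrow>
     (\<integral>\<^sup>+ s. ennreal \<bar>f s\<bar> \<partial>I01) \<le> ennreal (D * C)" using integral_bound by blast
  obtain r where r: "NY (\<lambda>_. 1) = ennreal r" "0 \<le> r" using Y.one by (cases "NY (\<lambda>_. 1)") auto
  \<comment> \<open>\<open>D\<close> is the constant of the embedding into L^1 and \<open>r\<close>
    the norm of 1 in Y.\<close>
  define d where "d = e / (D * (r + 1))"
  have d: "0 < d" using e D r by (simp add: d_def)
  have dD: "d * D * r \<le> e"
  proof -
    have "d * D = e / (r + 1)" using D by (simp add: d_def)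
    then have "d * D * r = e * (r / (r + 1))" by simp
    also have "\<dots> \<le> e * 1" using e r by (intro mult_left_mono) auto
    finally show ?thesis by simp
  qed
  have ev1: "\<forall>\<^sub>F a in at_right 0. esssup (lebesgue_on {0<..<a}) (\<lambda>t. ereal (1 / J t)) < ereal d"
    using d by (intro order_tendstoD[OF ess]) auto
  have ev2: "\<forall>\<^sub>F a in at_right (0::real). a < 1" by (intro eventually_at_right_real[of 0 1, THEN eventually_mono]) auto
  show "\<forall>\<^sub>F a in at_right 0. tail_norm 0 a \<le> ennreal e"
    using ev1 ev2
  proof eventually_elim
    case (elim a)
    have "AE t in lebesgue_on {0<..<a}. ereal (1 / J t) \<le> esssup (lebesgue_on {0<..<a}) (\<lambda>t. ereal (1 / J t))"
      by (rule esssup_AE)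
    then have "AE t in lebesgue_on {0<..<a}. 1 / J t \<le> d"
    proof eventually_elim
      case (elim t)
      then have "ereal (1 / J t) < ereal d"
        using \<open>esssup (lebesgue_on {0<..<a}) (\<lambda>t. ereal (1 / J t)) < ereal d\<close> by (rule order_le_less_trans)
      then show ?case by simp
    qed
    then have Jd: "AE t in I01. t < a \<longrightarrow> 1 / J t \<le> d"
      using elim(2) by (subst (asm) AE_lebesgue_on_interval_iff) auto
    show ?case unfolding tail_norm_def
    proof (rule SUP_least)
      fix f assume "f \<in> {f. f \<in> borel_measurable I01 \<and> rinorm NX f \<le> 1}"
      then have fm[measurable]: "f \<in> borel_measurable I01" and f1: "rinorm NX f \<le> ennreal 1" by auto
      have fL: "f \<in> L1_space" by (rule L1_of_X[OF fm f1])
      let ?f = "\<lambda>t. indicator {0<..<a} t * f t"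
      have fL': "?f \<in> L1_space" by (intro L1_indicator fL) auto
      have G: "G 0 ?f t \<le> d * D" if t: "0 < t" for t
      proof -
        have "ennreal (G 0 ?f t) \<le> (\<integral>\<^sup>+ s. ennreal d * ennreal \<bar>f s\<bar> \<partial>I01)"
          unfolding HH_eq_G[OF fL' t, symmetric] HH_def
        proof (rule nn_integral_mono_AE)
          show "AE s in I01. indicator {t..} s * (ennreal (\<bar>indicator {0<..<a} s * f s\<bar> / J s) * KK t s ^ 0) \<le> ennreal d * ennreal \<bar>f s\<bar>"
            using Jd
          proof eventually_elim
            case (elim s)
            show ?case
            proof (cases "s < a \<and> 0 < s")
              case True
              then have "\<bar>f s\<bar> / J s \<le> d * \<bar>f s\<bar>" using elim mult_right_mono[of "1 / J s" d "\<bar>f s\<bar>"] by simp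
              then have "ennreal (\<bar>f s\<bar> / J s) \<le> ennreal d * ennreal \<bar>f s\<bar>"
                using d by (simp add: ennreal_leI flip: ennreal_mult)
              then show ?thesis by (auto simp: indicator_def)
            qed (auto simp: indicator_def)
          qed
        qed
        also have "\<dots> = ennreal d * (\<integral>\<^sup>+ s. ennreal \<bar>f s\<bar> \<partial>I01)" by (intro nn_integral_cmult) measurable
        also have "\<dots> \<le> ennreal d * ennreal (D * 1)" by (intro mult_left_mono D fm f1) auto
        finally show ?thesis using d D by (simp flip: ennreal_mult)
      qed
      have "ri_norm_ext NY (Hop (Suc 0) J ?f) = NY (G 0 ?f)" by (simp add: ri_norm_ext_Hop[OF fL'])
      also have "\<dots> \<le> NY (\<lambda>t. (d * D) * (\<lambda>_. 1) t)"
        using G d D by (intro Y.mono G_nonneg_meas nonneg_measI AE_I2) auto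
      also have "\<dots> = ennreal (d * D) * NY (\<lambda>_. 1)" using d D by (intro Y.scale nonneg_measI) auto
      also have "\<dots> \<le> ennreal e" using dD d D r by (simp add: ennreal_leI flip: ennreal_mult)
      finally show "ri_norm_ext NY (Hop (Suc 0) J ?f) \<le> ennreal e" .
    qed
  qed
qed

text \<open>Test with the characteristic function of a set E where 1/J exceeds \<open>e\<close>: its
  norm in X is at most a multiple of the measure of E, while its image is at least \<open>e\<close>
  times that measure to the left of E, and intervals of any length have norm at least
  \<open>k\<close> in Y.\<close>

lemma esssup_tendsto_of_tail:
  assumes X: "ri_space NX = L1_space" and Y: "ri_space NY = Linf_space"
    and ii: "(tail_norm 0 \<longlongrightarrow> 0) (at_right 0)"
  shows "((\<lambda>a. esssup (lebesgue_on {0<..<a}) (\<lambda>t. ereal (1 / J t))) \<longlongrightarrow> 0) (at_right 0)"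
proof -
  obtain C where C: "0 < C" "\<And>t. 0 < t \<Longrightarrow> t \<le> 1 \<Longrightarrow> X.\<phi> t \<le> ennreal C * ennreal t"
    using X.phi_le_of_L1[OF X] by blast
  obtain k where k: "0 < k" "\<And>t. 0 < t \<Longrightarrow> t \<le> 1 \<Longrightarrow> ennreal k \<le> Y.\<phi> t"
    using Y.phi_ge_of_Linf[OF Y] by blast
  \<comment> \<open>The test function gives a tail norm of at least \<open>e * k / C\<close>; half
    of that is a contradiction.\<close>
  have small: "AE t in I01. t < a \<longrightarrow> 1 / J t \<le> e"
    if e: "0 < e" and a: "0 < a" "a < 1" and tail: "tail_norm 0 a \<le> ennreal (e * k / (2 * C))" for e a
  proof -
    \<comment> \<open>Keeping E to the right of \<open>b\<close> leaves the interval (0,b), on which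
      the image sees all of E.\<close>
    have null: "AE t in I01. t < a \<longrightarrow> b < t \<longrightarrow> 1 / J t \<le> e" if b: "0 < b" "b < 1" for b
    proof -
      define E where "E = {t \<in> space I01. 1 / J t > e} \<inter> ({b<..<a} \<inter> {0<..<1})"
      have "{t \<in> space I01. 1 / J t > e} \<in> sets I01" by measurable
      then have E: "E \<in> sets I01" unfolding E_def by (rule sets.Int[OF _ borel_set_I01]) auto
      have "measure I01 E = 0"
      proof (rule ccontr)
        assume "measure I01 E \<noteq> 0"
        then have m: "0 < measure I01 E" by (simp add: order_less_le)
        let ?m = "measure I01 E"
        have Em[measurable]: "(indicator E :: real \<Rightarrow> real) \<in> borel_measurable I01" using E by simp
        have EC: "rinorm NX (indicator E) \<le> ennreal (C * ?m)"
          using C(2)[of ?m] m C(1) X.indicator_interval[OF E] by (simp add: rinorm_def ennreal_mult)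
        let ?f = "\<lambda>t. indicator {0<..<a} t * indicator E t :: real"
        have EL: "(indicator E :: real \<Rightarrow> real) \<in> L1_space" by (rule L1_of_X[OF Em EC])
        have fL: "?f \<in> L1_space" by (intro L1_indicator EL) auto
        have G: "e * ?m \<le> G 0 ?f t" if t: "0 < t" "t < b" for t
        proof -
          have "ennreal (e * ?m) = (\<integral>\<^sup>+ s. ennreal e * indicator E s \<partial>I01)"
            using E e by (simp add: nn_integral_cmult_indicator I01.emeasure_eq_measure ennreal_mult)
          also have "\<dots> \<le> HH 0 ?f t"
            unfolding HH_def
            using t b by (intro nn_integral_mono) (auto simp: E_def indicator_def intro!: ennreal_leI)
          finally show ?thesis using HH_eq_G[OF fL t(1), of 0] G_nonneg by simp
        qed
        have "ennreal (e * ?m) * ennreal k \<le> ennreal (e * ?m) * Y.\<phi> b"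
          using b by (intro mult_left_mono k) auto
        also have "\<dots> = NY (\<lambda>t. (e * ?m) * indicator {0<..<b} t)"
          using e m b by (intro Y.scale[symmetric] nonneg_meas_indicator) auto
        also have "\<dots> \<le> NY (G 0 ?f)"
        proof (intro Y.mono G_nonneg_meas nonneg_measI AE_I2)
          fix t show "e * ?m * indicator {0<..<b} t \<le> G 0 ?f t"
            using G[of t] G_nonneg[of 0 ?f t] by (auto simp: indicator_def)
        qed (use e m in \<open>auto intro!: borel_measurable_times indicator_I01\<close>)
        also have "\<dots> \<le> ennreal (C * ?m) * tail_norm 0 a"
          using tail_bound[OF Em EC, of 0 a] C m by simp
        also have "\<dots> \<le> ennreal (C * ?m) * ennreal (e * k / (2 * C))" by (intro mult_left_mono tail) auto
        finally have "e * ?m * k \<le> C * ?m * (e * k / (2 * C))"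
          using e m k C by (simp flip: ennreal_mult)
        also have "\<dots> = e * ?m * k / 2" using C by (simp add: field_simps)
        finally show False using e m k by (simp add: mult_pos_pos not_le)
      qed
      then have "E \<in> null_sets I01" using E by (auto simp: I01.emeasure_eq_measure)
      then have "AE t in I01. t \<notin> E" by (rule AE_not_in)
      moreover have "AE t in I01. t \<in> {0<..<1}" by (rule AE_I2) simp
      ultimately show ?thesis by eventually_elim (auto simp: E_def)
    qed
    \<comment> \<open>Now \<open>b\<close> runs to 0. It must stay below 1, hence
      \<open>1/(n+2)\<close>.\<close>
    have "AE t in I01. \<forall>n::nat. t < a \<longrightarrow> 1 / Suc (Suc n) < t \<longrightarrow> 1 / J t \<le> e"
      using null by (subst AE_all_countable) (auto intro!: null)
    moreover have "AE t in I01. t \<in> {0<..<1}" by (rule AE_I2) simp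
    ultimately show ?thesis
    proof eventually_elim
      case (elim t)
      then obtain n where n: "1 / Suc n < t" using reals_Archimedean[of t] by (auto simp: inverse_eq_divide)
      have "1 / real (Suc (Suc n)) \<le> 1 / real (Suc n)" by (simp add: field_simps)
      then have "1 / real (Suc (Suc n)) < t" using n by linarith
      then show ?case using elim(1) by blast
    qed
  qed
  show ?thesis
  proof (rule order_tendstoI)
    \<comment> \<open>An extended-real essential supremum could be negative; it is not, because 1/J
      is positive and (0,a) is not null.\<close>
    fix u :: ereal assume u: "u < 0"
    have "\<forall>\<^sub>F a in at_right (0::real). a \<in> {0<..<1}" by (rule eventually_at_right_real) simp
    then show "\<forall>\<^sub>F a in at_right 0. u < esssup (lebesgue_on {0<..<a}) (\<lambda>t. ereal (1 / J t))"
    proof eventually_elim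
      case (elim a)
      show ?case
      proof (rule ccontr)
        assume "\<not> ?thesis"
        then have le: "esssup (lebesgue_on {0<..<a}) (\<lambda>t. ereal (1 / J t)) < 0" using u by simp
        have "AE t in lebesgue_on {0<..<a}. ereal (1 / J t) \<le> esssup (lebesgue_on {0<..<a}) (\<lambda>t. ereal (1 / J t))"
          by (rule esssup_AE)
        then have "AE t in lebesgue_on {0<..<a}. 1 / J t < 0"
        proof eventually_elim
          case (elim t)
          then have "ereal (1 / J t) < 0" using le by (rule order_le_less_trans)
          then show ?case by simp
        qed
        then have "AE t in I01. t < a \<longrightarrow> 1 / J t < 0"
          using elim by (subst (asm) AE_lebesgue_on_interval_iff) auto
        moreover have "AE t in I01. t \<in> {0<..<1}" by (rule AE_I2) simp
        ultimately have "AE t in I01. t \<notin> {0<..<a}"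
        proof eventually_elim
          case (elim t) then show ?case using J_pos[of t] by auto
        qed
        then have "{0<..<a} \<in> null_sets I01" using elim by (subst AE_iff_null_sets) auto
        then have "emeasure I01 {0<..<a} = 0" by auto
        then show False using elim by (simp add: emeasure_I01_interval)
      qed
    qed
  next
    fix u :: ereal assume u: "0 < u"
    then obtain e where e: "0 < e" "ereal e < u" using ereal_dense2[of 0 u] by (auto simp: zero_ereal_def)
    have "\<forall>\<^sub>F a in at_right (0::real). a \<in> {0<..<1}" by (rule eventually_at_right_real) simp
    moreover have "\<forall>\<^sub>F a in at_right 0. tail_norm 0 a < ennreal (e * k / (2 * C))"
      using e k C by (intro order_tendstoD[OF ii]) auto
    ultimately show "\<forall>\<^sub>F a in at_right 0. esssup (lebesgue_on {0<..<a}) (\<lambda>t. ereal (1 / J t)) < u"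
    proof eventually_elim
      case (elim a)
      have "AE t in I01. t < a \<longrightarrow> 1 / J t \<le> e" using elim e by (intro small) auto
      then have "AE t in lebesgue_on {0<..<a}. ereal (1 / J t) \<le> ereal e"
        using elim by (subst AE_lebesgue_on_interval_iff) auto
      then have "esssup (lebesgue_on {0<..<a}) (\<lambda>t. ereal (1 / J t)) \<le> ereal e"
        using elim inv_J_measurable[of a] by (intro esssup_I) auto
      then show ?case using e by simp
    qed
  qed
qed

text \<open>Normalised masses \<open>f n\<close> concentrating at the upper end of a set where \<open>J\<close> is bounded: once \<open>n\<close> is
  large compared with \<open>m\<close>, the images of \<open>f n\<close> and \<open>f m\<close> differ by at least \<open>1/2\<close> on an interval.\<close>
lemma not_compact_L1_Linf:
  assumes X: "ri_space NX = L1_space" and Y: "ri_space NY = Linf_space"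
  shows "\<not> compact_into (Hop (Suc 0) J) NX NY"
proof
  assume comp: "compact_into (Hop (Suc 0) J) NX NY"
  obtain C where C: "0 < C" "\<And>t. 0 < t \<Longrightarrow> t \<le> 1 \<Longrightarrow> X.\<phi> t \<le> ennreal C * ennreal t"
    using X.phi_le_of_L1[OF X] by blast
  obtain k where k: "0 < k" "\<And>t. 0 < t \<Longrightarrow> t \<le> 1 \<Longrightarrow> ennreal k \<le> Y.\<phi> t"
    using Y.phi_ge_of_Linf[OF Y] by blast
  \<comment> \<open>\<open>J\<close> is finite everywhere, so some sublevel set has positive
    measure. Boundedness of \<open>J\<close> there bounds the test functions in X.\<close>
  define S where "S n = {t \<in> space I01. J t \<le> real n}" for n
  have S: "S n \<in> sets I01" for n unfolding S_def by measurable
  have "\<exists>n. emeasure I01 (S n) \<noteq> 0"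
  proof (rule ccontr)
    assume "\<not> ?thesis"
    then have "emeasure I01 (\<Union>n. S n) = 0" using S by (intro emeasure_UN_eq_0) auto
    moreover have "(\<Union>n. S n) = space I01" unfolding S_def using real_arch_simple by auto
    ultimately show False using I01.emeasure_space_1 by simp
  qed
  then obtain M where M: "emeasure I01 (S M) \<noteq> 0" by blast
  define A where "A = S M"
  have A: "A \<in> sets I01" and AJ: "\<And>t. t \<in> A \<Longrightarrow> J t \<le> real M" and A01: "A \<subseteq> {0<..<1}"
    using S by (auto simp: A_def S_def)
  \<comment> \<open>The mass of A to the right of t. It is continuous and nonincreasing with
    \<psi>(1) = 0, so every value up to \<alpha> is attained; this replaces explicit intervals, as A
    is only measurable.\<close>
  define \<psi> where "\<psi> t = measure I01 (A \<inter> {t..})" for t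
  have At: "A \<inter> {t..} \<in> sets I01" for t
  proof -
    have "A \<inter> {t..} = A \<inter> ({t..} \<inter> {0<..<1})" using A01 by auto
    then show ?thesis using A by (auto intro!: sets.Int borel_set_I01)
  qed
  define \<alpha> where "\<alpha> = \<psi> 0"
  have \<alpha>: "0 < \<alpha>"
  proof -
    have "A \<inter> {0..} = A" using A01 by auto
    then show ?thesis using M unfolding \<alpha>_def \<psi>_def A_def by (auto simp: I01.emeasure_eq_measure order_less_le)
  qed
  have \<psi>1: "\<psi> 1 = 0"
  proof -
    have "A \<inter> {1..} = {}" using A01 by auto
    then show ?thesis by (simp add: \<psi>_def)
  qed
  have anti: "\<psi> t' \<le> \<psi> t" if "t \<le> t'" for t t'
    unfolding \<psi>_def using that At by (intro I01.finite_measure_mono) auto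
  have lip: "\<psi> s \<le> \<psi> t + (t - s)" if "s \<le> t" for s t
  proof -
    have st: "{s..t} \<inter> {0<..<1} \<in> sets I01" by (intro borel_set_I01) auto
    have "\<psi> s \<le> measure I01 ((A \<inter> {t..}) \<union> ({s..t} \<inter> {0<..<1}))"
      unfolding \<psi>_def using At st A01 by (intro I01.finite_measure_mono) auto
    also have "\<dots> \<le> \<psi> t + measure I01 ({s..t} \<inter> {0<..<1})"
      unfolding \<psi>_def using At st by (intro measure_Un_le) auto
    also have "measure I01 ({s..t} \<inter> {0<..<1}) \<le> t - s"
      using emeasure_I01_Icc_le[of s t] that by (simp add: I01.emeasure_eq_measure)
    finally show ?thesis by simp
  qed
  have cont: "continuous_on {0..1} \<psi>"
  proof (rule lipschitz_on_continuous_on[where L=1], rule lipschitz_onI)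
    fix x y :: real
    show "dist (\<psi> x) (\<psi> y) \<le> 1 * dist x y"
      using lip[of x y] lip[of y x] anti[of x y] anti[of y x] by (cases "x \<le> y") (auto simp: dist_real_def abs_if)
  qed simp
  have ivt: "\<exists>t\<ge>0. t \<le> 1 \<and> \<psi> t = y" if "0 \<le> y" "y \<le> \<alpha>" for y
    using IVT2'[of \<psi> 1 y 0] that \<psi>1 cont unfolding \<alpha>_def by auto
  have "\<exists>t\<ge>0. t \<le> 1 \<and> \<psi> t = \<alpha> / (real n + 2)" for n
    by (rule ivt) (use \<alpha> in \<open>auto simp: field_simps\<close>)
  then obtain \<tau> where \<tau>: "\<And>n. 0 \<le> \<tau> n" "\<And>n. \<tau> n \<le> 1" "\<And>n. \<psi> (\<tau> n) = \<alpha> / (real n + 2)" by metis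
  \<comment> \<open>Chosen so that \<open>\<beta> n * \<psi> (\<tau> n) = 1\<close>.\<close>
  define \<beta> where "\<beta> n = (real n + 2) / \<alpha>" for n
  have \<beta>: "0 < \<beta> n" for n using \<alpha> by (simp add: \<beta>_def)
  \<comment> \<open>The factor \<open>J\<close> cancels the weight of the operator: the image of
    \<open>f n\<close> is \<open>\<beta> n * \<psi>\<close>, capped at 1 to the left of
    \<open>\<tau> n\<close>.\<close>
  define f where "f n s = \<beta> n * J s * indicator (A \<inter> {\<tau> n..}) s" for n s
  have fm[measurable]: "f n \<in> borel_measurable I01" for n
    unfolding f_def using At by (intro borel_measurable_times borel_measurable_indicator) auto
  have fN: "rinorm NX (f n) \<le> ennreal (C * real M)" for n
  proof -
    have "rinorm NX (f n) \<le> ennreal C * (\<integral>\<^sup>+ s. ennreal \<bar>f n s\<bar> \<partial>I01)"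
      unfolding rinorm_def by (intro X.le_integral_of_phi_le C nonneg_measI) auto
    also have "(\<integral>\<^sup>+ s. ennreal \<bar>f n s\<bar> \<partial>I01) \<le> (\<integral>\<^sup>+ s. ennreal (\<beta> n * real M) * indicator (A \<inter> {\<tau> n..}) s \<partial>I01)"
    proof (intro nn_integral_mono)
      fix s assume "s \<in> space I01"
      then have "s \<in> A \<Longrightarrow> \<bar>f n s\<bar> \<le> \<beta> n * real M" using J_pos[of s] AJ[of s] \<beta>[of n]
        by (auto simp: f_def abs_mult indicator_def)
      then show "ennreal \<bar>f n s\<bar> \<le> ennreal (\<beta> n * real M) * indicator (A \<inter> {\<tau> n..}) s"
        by (cases "s \<in> A \<inter> {\<tau> n..}") (auto simp: ennreal_leI f_def)
    qed
    also have "\<dots> = ennreal (\<beta> n * real M) * ennreal (\<psi> (\<tau> n))"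
      using At by (simp add: nn_integral_cmult_indicator I01.emeasure_eq_measure \<psi>_def)
    also have "\<dots> = ennreal (\<beta> n * real M * \<psi> (\<tau> n))" using \<beta>[of n] by (intro ennreal_mult[symmetric]) (auto simp: \<psi>_def)
    also have "\<beta> n * real M * \<psi> (\<tau> n) = real M" using \<alpha> by (simp add: \<tau> \<beta>_def)
    also have "ennreal C * ennreal (real M) = ennreal (C * real M)" using C by (simp add: ennreal_mult)
    finally show ?thesis by (simp add: mult_left_mono)
  qed
  have fX: "f n \<in> ri_space NX" for n using fN[of n] by (auto simp: ri_space_def order_le_less_trans)
  have fL: "f n \<in> L1_space" for n using fX X by simp
  have G: "G 0 (f n) t = \<beta> n * \<psi> (max t (\<tau> n))" for n t
  proof -
    have "HH 0 (f n) t = (\<integral>\<^sup>+ s. ennreal (\<beta> n) * indicator (A \<inter> {max t (\<tau> n)..}) s \<partial>I01)"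
      unfolding HH_def
    proof (rule nn_integral_cong)
      fix s assume "s \<in> space I01"
      then show "indicator {t..} s * (ennreal (\<bar>f n s\<bar> / J s) * KK t s ^ 0) = ennreal (\<beta> n) * indicator (A \<inter> {max t (\<tau> n)..}) s"
        using J_pos[of s] \<beta>[of n] by (auto simp: f_def indicator_def abs_mult)
    qed
    also have "\<dots> = ennreal (\<beta> n) * ennreal (\<psi> (max t (\<tau> n)))"
      using At by (simp add: nn_integral_cmult_indicator I01.emeasure_eq_measure \<psi>_def)
    also have "\<dots> = ennreal (\<beta> n * \<psi> (max t (\<tau> n)))" using \<beta>[of n] by (intro ennreal_mult[symmetric]) (auto simp: \<psi>_def)
    finally show ?thesis using \<beta>[of n] by (simp add: G_def \<psi>_def)
  qed
  have sep: "ennreal (k / 2) \<le> rinorm NY (\<lambda>t. G 0 (f n) t - G 0 (f m) t)" if nm: "4 * (real m + 2) \<le> real n + 2" for n m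
  proof -
    define y where "y = \<alpha> / (real n + 2)"
    have y: "0 < y" "2 * y \<le> \<alpha>" using \<alpha> by (auto simp: y_def field_simps)
    have y': "0 \<le> 3 / 2 * y" "3 / 2 * y \<le> \<alpha>" using y by linarith+
    \<comment> \<open>Between \<open>t1\<close> and \<open>t2\<close> the value of \<psi> lies in
      [3y/2, 2y]. Being above y it places the point left of \<open>\<tau> n\<close>, where the n-th
      image is 1; being at most 2y it makes the m-th image at most 1/2 by the factor 4 between the
      indices. The interval may be short, but its norm is at least \<open>k\<close>.\<close>
    obtain t1 where t1: "0 \<le> t1" "t1 \<le> 1" "\<psi> t1 = 2 * y" using ivt[of "2 * y"] y by auto
    obtain t2 where t2: "0 \<le> t2" "t2 \<le> 1" "\<psi> t2 = 3 / 2 * y" using ivt[OF y'] by blast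
    have lt: "t1 < t2" using anti[of t2 t1] t1 t2 y by (cases "t1 < t2") auto
    define E where "E = {t1<..<t2}"
    have E: "E \<in> sets I01" using t1 t2 by (auto simp: E_def sets_I01_iff)
    have Em: "measure I01 E = t2 - t1"
      using t1 t2 lt emeasure_I01[of E] by (simp add: E_def subset_eq Sigma_Algebra.measure_def)
    have diff: "1 / 2 \<le> \<bar>G 0 (f n) t - G 0 (f m) t\<bar>" if t: "t \<in> E" for t
    proof -
      have pt: "3 / 2 * y \<le> \<psi> t" "\<psi> t \<le> 2 * y" using anti[of t t2] anti[of t1 t] t t1 t2 by (auto simp: E_def)
      have "t < \<tau> n" using anti[of "\<tau> n" t] pt \<tau>(3)[of n, folded y_def] y by (cases "t < \<tau> n") auto
      then have "G 0 (f n) t = \<beta> n * y" using G[of n t] \<tau>(3)[of n, folded y_def] by simp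
      also have "\<dots> = 1" using \<alpha> by (simp add: \<beta>_def y_def)
      finally have 1: "G 0 (f n) t = 1" .
      have "G 0 (f m) t \<le> \<beta> m * \<psi> t" using G[of m t] anti[of t "max t (\<tau> m)"] \<beta>[of m] by simp
      also have "\<dots> \<le> \<beta> m * (2 * y)" using pt \<beta>[of m] by (intro mult_left_mono) auto
      also have "\<dots> = 2 * (real m + 2) / (real n + 2)" using \<alpha> by (simp add: \<beta>_def y_def)
      also have "\<dots> \<le> 1 / 2" using nm by (simp add: field_simps)
      finally show ?thesis using 1 by simp
    qed
    have "ennreal (k / 2) = ennreal (1 / 2) * ennreal k" using k by (subst ennreal_mult[symmetric]) auto
    also have "\<dots> \<le> ennreal (1 / 2) * NY (indicator E)"
      unfolding Y.indicator_interval[OF E] Em using t1 t2 lt by (intro mult_left_mono k) auto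
    also have "\<dots> = NY (\<lambda>t. 1 / 2 * indicator E t)" using E by (intro Y.scale[symmetric] nonneg_meas_indicator) auto
    also have "\<dots> \<le> rinorm NY (\<lambda>t. G 0 (f n) t - G 0 (f m) t)"
      unfolding rinorm_def
    proof (intro Y.mono nonneg_measI AE_I2)
      fix t show "1 / 2 * indicator E t \<le> \<bar>G 0 (f n) t - G 0 (f m) t\<bar>"
        using diff[of t] by (cases "t \<in> E") auto
    qed (use E in auto)
    finally show ?thesis .
  qed
  have "\<exists>(r::nat \<Rightarrow> nat) g. strict_mono r \<and> g \<in> ri_space NY \<and>
      (\<lambda>n. rinorm NY (\<lambda>t. enn2real (Hop (Suc 0) J (f (r n)) t) - g t)) \<longlonglongrightarrow> 0"
    using comp fX fN unfolding compact_into_def by blast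
  then obtain r g where r: "strict_mono (r::nat\<Rightarrow>nat)" and g: "g \<in> ri_space NY"
      and lim: "(\<lambda>n. rinorm NY (\<lambda>t. enn2real (Hop (Suc 0) J (f (r n)) t) - g t)) \<longlonglongrightarrow> 0" by blast
  have gm[measurable]: "g \<in> borel_measurable I01" using g by (simp add: ri_space_def)
  have eq: "rinorm NY (\<lambda>t. enn2real (Hop (Suc 0) J (f n) t) - g t) = rinorm NY (\<lambda>t. G 0 (f n) t - g t)" for n
    unfolding rinorm_def using enn2real_Hop_AE(2,3)[OF fL, of 0 n]
    by (intro Y.cong_AE nonneg_measI) (auto elim!: eventually_mono)
  have "\<forall>\<^sub>F n in sequentially. rinorm NY (\<lambda>t. G 0 (f (r n)) t - g t) < ennreal (k / 8)"
    using k lim unfolding eq by (intro order_tendstoD) auto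
  then obtain K where K: "\<And>n. n \<ge> K \<Longrightarrow> rinorm NY (\<lambda>t. G 0 (f (r n)) t - g t) < ennreal (k / 8)"
    unfolding eventually_sequentially by blast
  define m where "m = r K"
  \<comment> \<open>With \<open>m\<close> fixed, \<open>r n \<ge> n\<close> makes the index large
    enough for separation. Two images within \<open>k / 8\<close> of the limit would be within
    \<open>k / 4\<close> of each other, against the separation \<open>k / 2\<close>.\<close>
  define n where "n = max K (4 * m + 8)"
  have "4 * m + 8 \<le> r n" using seq_suble[OF r, of n] by (simp add: n_def)
  then have "real (4 * m + 8) \<le> real (r n)" by (simp only: of_nat_le_iff)
  then have "4 * (real m + 2) \<le> real (r n) + 2" by simp
  then have "ennreal (k / 2) \<le> rinorm NY (\<lambda>t. G 0 (f (r n)) t - G 0 (f m) t)" by (rule sep)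
  also have "\<dots> = rinorm NY (\<lambda>t. (G 0 (f (r n)) t - g t) + (g t - G 0 (f m) t))" by simp
  also have "\<dots> \<le> rinorm NY (\<lambda>t. G 0 (f (r n)) t - g t) + rinorm NY (\<lambda>t. g t - G 0 (f m) t)"
    by (rule Y.rinorm_triangle) auto
  also have "rinorm NY (\<lambda>t. g t - G 0 (f m) t) = rinorm NY (\<lambda>t. G 0 (f m) t - g t)"
    by (simp add: rinorm_def abs_minus_commute)
  also have "rinorm NY (\<lambda>t. G 0 (f (r n)) t - g t) + rinorm NY (\<lambda>t. G 0 (f m) t - g t) \<le> ennreal (k / 8) + ennreal (k / 8)"
    using K[of n] K[of K] by (intro add_mono) (auto simp: n_def m_def intro: less_imp_le)
  also have "\<dots> = ennreal (k / 4)" using k by (subst ennreal_plus[symmetric]) auto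
  finally show False using k by simp
qed

end

theorem theorem4p1:
  fixes J :: "real \<Rightarrow> real" and j :: nat
    and NX NY :: "(real \<Rightarrow> real) \<Rightarrow> ennreal"
  assumes J_meas: "J \<in> borel_measurable (lebesgue_on {0<..1})"
    and J_pos: "\<forall>t\<in>{0<..1}. 0 < J t"
    and J_inf: "\<exists>c>0. \<forall>t\<in>{0<..1}. c \<le> J t / t"
    and j_pos: "1 \<le> j"
    and X_ri: "ri_norm NX" and Y_ri: "ri_norm NY"
  defines "cond_i \<equiv> compact_into (Hop j J) NX NY"
    and "cond_ii \<equiv> ((\<lambda>a. SUP f\<in>{f. f \<in> borel_measurable I01 \<and> rinorm NX f \<le> 1}.
                     ri_norm_ext NY (Hop j J (\<lambda>t. indicator {0<..<a} t * f t)))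
                   \<longlongrightarrow> 0) (at_right 0)"
    and "special \<equiv> ri_space NX = L1_space \<and> ri_space NY = Linf_space \<and> j = 1 \<and>
                   ((\<lambda>a. esssup (lebesgue_on {0<..<a}) (\<lambda>t. ereal (1 / J t))) \<longlongrightarrow> 0) (at_right 0)"
  shows "(special \<longrightarrow> cond_ii \<and> \<not> cond_i) \<and> (\<not> special \<longrightarrow> (cond_i \<longleftrightarrow> cond_ii))"
proof -
  obtain c where c: "0 < c" "\<And>t. t \<in> {0<..1} \<Longrightarrow> c \<le> J t / t" using J_inf by blast
  obtain p where p: "j = Suc p" using j_pos by (cases j) auto
  interpret hardy_ri J c NX NY
  proof
    show "J \<in> borel_measurable I01" by (rule measurable_restrict_mono[OF J_meas]) auto
    show "c * t \<le> J t" if "0 < t" "t < 1" for t using c(2)[of t] that by (simp add: field_simps)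
  qed (use c X_ri Y_ri in auto)
  have ii: "cond_ii \<longleftrightarrow> (tail_norm p \<longlongrightarrow> 0) (at_right 0)"
    unfolding cond_ii_def p tail_norm_def ..
  have i: "cond_i \<longleftrightarrow> compact_into (Hop (Suc p) J) NX NY" unfolding cond_i_def p ..
  show ?thesis
  proof (intro conjI impI)
    assume "special"
    then have s: "ri_space NX = L1_space" "ri_space NY = Linf_space" "p = 0"
      "((\<lambda>a. esssup (lebesgue_on {0<..<a}) (\<lambda>t. ereal (1 / J t))) \<longlongrightarrow> 0) (at_right 0)"
      unfolding special_def p by auto
    show "cond_ii" unfolding ii s(3) by (rule tail_tendsto_of_esssup[OF s(4)])
    show "\<not> cond_i" unfolding i s(3) by (rule not_compact_L1_Linf[OF s(1,2)])
  next
    assume ns: "\<not> special"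
    show "cond_i \<longleftrightarrow> cond_ii"
    proof
      show "cond_i \<Longrightarrow> cond_ii" unfolding i ii by (rule tail_tendsto_of_compact)
    next
      assume "cond_ii"
      then have tail: "(tail_norm p \<longlongrightarrow> 0) (at_right 0)" unfolding ii .
      \<comment> \<open>If all three alternatives failed, the vanishing tails would force the
        essential supremum of 1/J to tend to 0, which is exactly the excluded case.\<close>
      have "1 \<le> p \<or> ri_space NX \<noteq> L1_space \<or> ri_space NY \<noteq> Linf_space"
      proof (rule ccontr)
        assume "\<not> ?thesis"
        then have "p = 0" "ri_space NX = L1_space" "ri_space NY = Linf_space" by auto
        then have special unfolding special_def p using esssup_tendsto_of_tail tail by simp
        then show False using ns by simp
      qed
      then show "cond_i" unfolding i by (rule compact_of_tail_tendsto[OF tail])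
    qed
  qed
qed

end
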